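(* Let $0<q<1$. For $u\in\mathbb{R}$, let $\lambda_{1}(u),\lambda_{2}(u),\lambda_{3}(u),\dots$ denote the zeros of the function $$z\mapsto{}_{3}\phi_{3}\left[\begin{matrix}0, & u^{-1}z, & uz^{-1}q \\ q^{1/2}, & -q^{1/2}, & -q\end{matrix}\ ;q, -uz \right].$$ Then for every $u\in\mathbb{R}$ the polynomials $P_{n}(x;q)$ satisfy the orthogonality relation $$\sum_{k=1}^{\infty}\left({}_{3}\phi_{3}\left[\begin{matrix}0, & q, & q\\ q^{3/2}, & -q^{3/2}, & -q\end{matrix}\ ;q, -\lambda_{k}^{2}(u) \right]\right)^{-1}P_{n}(\lambda_{k}(u);q)\,P_{m}(\lambda_{k}(u);q)=\frac{1}{1-q}\,\delta_{mn},\quad m,n\in\mathbb{Z}_{+}=\{0,1,2,\dots\}.$$ Moreover, the map $$u\mapsto\mu_{u}(q)=(1-q)\sum_{k=1}^{\infty}\left({}_{3}\phi_{3}\left[\begin{matrix}0, & q, & q\\ q^{3/2}, & -q^{3/2}, & -q\end{matrix}\ ;q, -\lambda_{k}^{2}(u) \right]\right)^{-1}\delta_{\lambda_{k}(u)}$$ is a one-to-one mapping from $[0,s_{1}(q))$ onto the set of all N-extremal measures associated with the polynomials $P_{n}(x;q)$, where $s_{1}(q)$ is the lowest positive zero of $\mathcal{S}_{q}$ and $\delta_{\lambda}$ denotes the unit point mass at $\lambda$.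
   Context: Here $0<q<1$ and fractional powers of $q$ are positive reals. $(a;q)_{n}=\prod_{k=0}^{n-1}(1-aq^{k})$. **Polynomials.** $P_n(x;q)$ and $Q_n(x;q)$ (polynomials of the first and second kind) are the solutions of $$\beta_{n-1}u_{n-1}+\beta_{n}u_{n+1}=xu_{n},\quad n\ge1,\qquad \beta_n=q^{-n/2},$$ with $P_0=1$, $P_1(x)=x$, $Q_0=0$, $Q_1=1$. The associated Hamburger moment problem is indeterminate. **Nevanlinna functions and N-extremal measures.** Let $A,B,C,D$ be the entire functions which are the locally uniform limits as $n\to\infty$ of $$A_{n+1}(z)=\beta_{n}(Q_{n+1}(z)Q_{n}(0)-Q_{n+1}(0)Q_{n}(z)),\quad B_{n+1}(z)=\beta_{n}(P_{n+1}(z)Q_{n}(0)-Q_{n+1}(0)P_{n}(z)),$$ $$C_{n+1}(z)=\beta_{n}(Q_{n+1}(z)P_{n}(0)-P_{n+1}(0)Q_{n}(z)),\quad D_{n+1}(z)=\beta_{n}(P_{n+1}(z)P_{n}(0)-P_{n+1}(0)P_{n}(z)).$$ The N-extremal measures are the measures of orthogonality $\mu_t$, $t\in\mathbb{R}\cup\{\infty\}$, on $\mathbb{R}$ determined by $$\int_{\mathbb{R}}\frac{\mathrm{d}\mu_{t}(x)}{z-x}=\frac{A(z)t-C(z)}{B(z)t-D(z)},\quad z\in\mathbb{C}\setminus\mathbb{R},$$ the right-hand side being $A(z)/B(z)$ when $t=\infty$. **Special functions.** $\mathcal{S}_{q}(z)=\sum_{n=0}^{\infty}\frac{(-1)^{n}q^{n(n+1)}}{(q;q)_{2n+1}}z^{2n+1}$.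 The basic hypergeometric series is $${}_{3}\phi_{3}\left[\begin{matrix}a_1,a_2,a_3\\ b_1,b_2,b_3\end{matrix};q,z\right]=\sum_{k=0}^{\infty}\frac{(a_1;q)_k(a_2;q)_k(a_3;q)_k}{(b_1;q)_k(b_2;q)_k(b_3;q)_k(q;q)_k}(-1)^kq^{k(k-1)/2}z^k .$$ In the function whose zeros are the $\lambda_k(u)$, when $u=0$ or $z=0$ the product $(u^{-1}z;q)_k(uz^{-1}q;q)_k(uz)^k$ is understood as the polynomial $\prod_{j=0}^{k-1}(u-zq^{j})(z-uq^{j+1})$ (to which it is equal for $uz\ne0$), so the function is entire in $z$ for each $u\in\mathbb{R}$. *)

theory Defs
  imports "HOL-Analysis.Analysis" "HOL-Computational_Algebra.Polynomial"
begin

definition qpoch :: "'a::comm_ring_1 \<Rightarrow> 'a \<Rightarrow> nat \<Rightarrow> 'a" where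
  "qpoch a q n = (\<Prod>k<n. 1 - a * q ^ k)"

definition phi33 ::
  "'a::real_normed_field \<Rightarrow> 'a \<Rightarrow> 'a \<Rightarrow> 'a \<Rightarrow> 'a \<Rightarrow> 'a \<Rightarrow> 'a \<Rightarrow> 'a \<Rightarrow> 'a" where
  "phi33 a1 a2 a3 b1 b2 b3 q z =
     (\<Sum>k. qpoch a1 q k * qpoch a2 q k * qpoch a3 q k
           / (qpoch b1 q k * qpoch b2 q k * qpoch b3 q k * qpoch q q k)
           * (-1) ^ k * q ^ (k * (k - 1) div 2) * z ^ k)"

definition S_fun :: "real \<Rightarrow> real \<Rightarrow> real" where
  "S_fun q x = (\<Sum>n. (-1) ^ n * q ^ (n * (n + 1)) / qpoch q q (2 * n + 1) * x ^ (2 * n + 1))"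

definition lowest_positive_zero :: "(real \<Rightarrow> real) \<Rightarrow> real \<Rightarrow> bool" where
  "lowest_positive_zero f s \<longleftrightarrow> 0 < s \<and> f s = 0 \<and> (\<forall>x. 0 < x \<and> x < s \<longrightarrow> f x \<noteq> 0)"


definition beta :: "real \<Rightarrow> nat \<Rightarrow> real" where
  "beta q n = q powr (- (real n / 2))"

text \<open>
  The coefficients are real; the type is left open so that the polynomials can be evaluated both
  at real and at complex points.
\<close>

fun P_poly :: "real \<Rightarrow> nat \<Rightarrow> 'a::real_field poly" where
  "P_poly q 0 = 1"
| "P_poly q (Suc 0) = [:0, 1:]"
| "P_poly q (Suc (Suc n)) =
     smult (of_real (1 / beta q (Suc n)))
       ([:0, 1:] * P_poly q (Suc n) - smult (of_real (beta q n)) (P_poly q n))"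

fun Q_poly :: "real \<Rightarrow> nat \<Rightarrow> 'a::real_field poly" where
  "Q_poly q 0 = 0"
| "Q_poly q (Suc 0) = 1"
| "Q_poly q (Suc (Suc n)) =
     smult (of_real (1 / beta q (Suc n)))
       ([:0, 1:] * Q_poly q (Suc n) - smult (of_real (beta q n)) (Q_poly q n))"

lemma beta_pos: "0 < q \<Longrightarrow> 0 < beta q n"
  by (simp add: beta_def)

lemma P_poly_recurrence:
  assumes "0 < q" "1 \<le> n"
  shows "of_real (beta q (n - 1)) * poly (P_poly q (n - 1)) x
           + of_real (beta q n) * poly (P_poly q (n + 1)) x = x * poly (P_poly q n) x"
proof (cases n)
  case (Suc m)
  then show ?thesis
    using beta_pos[OF assms(1), of n] by (simp add: field_simps)
qed (use assms in simp)

lemma Q_poly_recurrence: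
  assumes "0 < q" "1 \<le> n"
  shows "of_real (beta q (n - 1)) * poly (Q_poly q (n - 1)) x
           + of_real (beta q n) * poly (Q_poly q (n + 1)) x = x * poly (Q_poly q n) x"
proof (cases n)
  case (Suc m)
  then show ?thesis
    using beta_pos[OF assms(1), of n] by (simp add: field_simps)
qed (use assms in simp)


text \<open>
  For sequences \<open>u\<close>, \<open>v\<close> of polynomials, \<open>nev_approx q u v n\<close> is the approximant with index \<open>n + 1\<close>.
\<close>

definition nev_approx ::
  "real \<Rightarrow> (nat \<Rightarrow> complex poly) \<Rightarrow> (nat \<Rightarrow> complex poly) \<Rightarrow> nat \<Rightarrow> complex \<Rightarrow> complex" where
  "nev_approx q u v n z =
     of_real (beta q n) * (poly (u (n + 1)) z * poly (v n) 0 - poly (v (n + 1)) 0 * poly (u n) z)"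

definition locally_uniform_limit :: "(nat \<Rightarrow> complex \<Rightarrow> complex) \<Rightarrow> (complex \<Rightarrow> complex) \<Rightarrow> bool" where
  "locally_uniform_limit f g \<longleftrightarrow> (\<forall>K. compact K \<longrightarrow> uniform_limit K f g sequentially)"

definition nevanlinna_A :: "real \<Rightarrow> complex \<Rightarrow> complex" where
  "nevanlinna_A q = (THE g. locally_uniform_limit (nev_approx q (Q_poly q) (Q_poly q)) g)"

definition nevanlinna_B :: "real \<Rightarrow> complex \<Rightarrow> complex" where
  "nevanlinna_B q = (THE g. locally_uniform_limit (nev_approx q (P_poly q) (Q_poly q)) g)"

definition nevanlinna_C :: "real \<Rightarrow> complex \<Rightarrow> complex" where
  "nevanlinna_C q = (THE g. locally_uniform_limit (nev_approx q (Q_poly q) (P_poly q)) g)"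

definition nevanlinna_D :: "real \<Rightarrow> complex \<Rightarrow> complex" where
  "nevanlinna_D q = (THE g. locally_uniform_limit (nev_approx q (P_poly q) (P_poly q)) g)"

definition orthogonality_measure :: "real \<Rightarrow> real measure \<Rightarrow> bool" where
  "orthogonality_measure q \<mu> \<longleftrightarrow>
     sets \<mu> = sets borel \<and>
     (\<forall>n. integrable \<mu> (\<lambda>x. x ^ n)) \<and>
     (\<forall>m n. (\<integral>x. poly (P_poly q m) x * poly (P_poly q n) x \<partial>\<mu>) = (if m = n then 1 else 0))"

text \<open>The parameter \<open>None\<close> stands for \<open>t = \<infinity>\<close>.\<close>

fun nevanlinna_quotient :: "real \<Rightarrow> real option \<Rightarrow> complex \<Rightarrow> complex" where
  "nevanlinna_quotient q (Some t) z =
     (nevanlinna_A q z * of_real t - nevanlinna_C q z) /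
     (nevanlinna_B q z * of_real t - nevanlinna_D q z)"
| "nevanlinna_quotient q None z = nevanlinna_A q z / nevanlinna_B q z"

definition N_extremal_measures :: "real \<Rightarrow> real measure set" where
  "N_extremal_measures q =
     {\<mu>. orthogonality_measure q \<mu> \<and>
         (\<exists>t. \<forall>z. z \<notin> \<real> \<longrightarrow> (\<integral>x. 1 / (z - complex_of_real x) \<partial>\<mu>) = nevanlinna_quotient q t z)}"


text \<open>
  The \<open>phi33\<close> series whose zeros carry the measures, in the form that is entire in \<open>z\<close>:
  \<open>(z/u; q)\<^sub>k (uq/z; q)\<^sub>k (uz)\<^sup>k\<close> is written as the polynomial
  \<open>\<Prod>j<k. (u - z q^j) (z - u q^(j+1))\<close>.  The lemma \<open>zero_fun_eq_phi33\<close> gives the agreement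
  for \<open>u \<noteq> 0\<close> and \<open>z \<noteq> 0\<close>.
\<close>

definition zero_fun :: "real \<Rightarrow> real \<Rightarrow> complex \<Rightarrow> complex" where
  "zero_fun q u z =
     (let q' = complex_of_real q; r = complex_of_real (sqrt q); u' = complex_of_real u in
      \<Sum>k. qpoch 0 q' k * (\<Prod>j<k. (u' - z * q' ^ j) * (z - u' * q' ^ (j + 1)))
           / (qpoch r q' k * qpoch (- r) q' k * qpoch (- q') q' k * qpoch q' q' k)
           * (-1) ^ k * q' ^ (k * (k - 1) div 2) * (-1) ^ k)"

lemma zero_fun_eq_phi33:
  assumes "u \<noteq> 0" "z \<noteq> 0"
  shows "zero_fun q u z =
    phi33 0 (inverse (of_real u) * z) (of_real u * inverse z * of_real q)
      (of_real (sqrt q)) (- of_real (sqrt q)) (- of_real q) (of_real q) (- (of_real u * z))"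
proof -
  have "(\<Prod>j<k. (of_real u - z * of_real q ^ j) * (z - of_real u * of_real q ^ (j + 1)))
        = qpoch (inverse (of_real u) * z) (of_real q) k
            * qpoch (of_real u * inverse z * of_real q) (of_real q) k * (of_real u * z) ^ k" for k
    using assms by (induction k) (simp_all add: qpoch_def field_simps)
  moreover have "(- (complex_of_real u * z)) ^ k = (-1) ^ k * (of_real u * z) ^ k" for k
    by (rule power_minus)
  ultimately show ?thesis
    by (simp add: zero_fun_def phi33_def Let_def field_simps)
qed

definition enumerates_zeros :: "(complex \<Rightarrow> complex) \<Rightarrow> (nat \<Rightarrow> real) \<Rightarrow> bool" where
  "enumerates_zeros f l \<longleftrightarrow> bij_betw (\<lambda>k. complex_of_real (l k)) UNIV {z. f z = 0}"

definition weight_fun :: "real \<Rightarrow> real \<Rightarrow> real" where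
  "weight_fun q x =
     phi33 0 q q (q powr (3/2)) (- (q powr (3/2))) (- q) q (- (x ^ 2))"

text \<open>
  The measure \<open>(1 - q) \<Sum>\<^sub>k (weight_fun q (l k))\<^sup>-\<^sup>1 \<delta>\<^bsub>l k\<^esub>\<close> on the Borel sets of the real line.
  Note that \<open>ennreal\<close> sends negative reals to \<open>0\<close>, so this describes the intended measure
  only if all weights are positive.
\<close>

definition point_mass_measure :: "real \<Rightarrow> (nat \<Rightarrow> real) \<Rightarrow> real measure" where
  "point_mass_measure q l =
     distr (point_measure UNIV (\<lambda>k. ennreal ((1 - q) * inverse (weight_fun q (l k))))) borel l"

lemma emeasure_point_mass_measure:
  assumes "A \<in> sets borel"
  shows "emeasure (point_mass_measure q l) A =
    (\<Sum>k. ennreal ((1 - q) * inverse (weight_fun q (l k))) * indicator A (l k))"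
proof -
  let ?w = "\<lambda>k. ennreal ((1 - q) * inverse (weight_fun q (l k)))"
  have "emeasure (point_mass_measure q l) A = emeasure (point_measure UNIV ?w) (l -` A)"
    unfolding point_mass_measure_def
    by (subst emeasure_distr) (use assms in \<open>auto simp: point_measure_def space_density\<close>)
  also have "\<dots> = (\<integral>\<^sup>+k. ?w k * indicator (l -` A) k \<partial>count_space UNIV)"
    unfolding point_measure_def by (subst emeasure_density) auto
  also have "\<dots> = (\<Sum>k. ?w k * indicator (l -` A) k)"
    by (rule nn_integral_count_space_nat)
  also have "\<dots> = (\<Sum>k. ?w k * indicator A (l k))"
    by (simp add: indicator_def)
  finally show ?thesis .
qed

end

theory Submission
  imports Defs "HOL-Computational_Algebra.Fundamental_Theorem_Algebra"
begin

text \<open>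
  Write \<open>r = sqrt q\<close>.  In the form \<open>u (n + 2) = r^(n + 1) z u (n + 1) - r u n\<close> the recurrence shows that all
  its solutions decay geometrically, locally uniformly in \<open>z\<close>.  Hence the reproducing kernel
  \<open>K(z, w) = \<Sum>\<^sub>n P\<^sub>n(z) P\<^sub>n(w)\<close> is a continuous function, and the functions \<open>A\<close>, \<open>B\<close>, \<open>C\<close>, \<open>D\<close> exist.  Two steps of
  the recurrence replace \<open>z\<close> by \<open>q z\<close>.  Therefore \<open>- B\<close> and \<open>D\<close> satisfy first-order q-difference
  equations, which identify them with a q-cosine \<open>qcos\<close> and a q-sine \<open>qsin\<close> (\<open>even_P_LIM\<close>, \<open>odd_P_LIM\<close>).  The
  Christoffel-Darboux formula becomes the subtraction formula \<open>kern_trig\<close>: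
  \<open>(z - w) K(z, w) = qsin z qcos w - qcos z qsin w\<close>.

  Both hypergeometric series of the theorem are addition formulas for these two functions.  Sorting
  a Cauchy product of two of the series by total degree, the Gauss binomial formula factors each homogeneous
  part.  This gives \<open>zero_fun q u z = qcos z qcos (r u) + qsin z qsin (r u) / r\<close> (\<open>zero_fun_eq\<close>) and
  \<open>weight_fun q x = (1 - q) K(x, x)\<close> (\<open>weight_fun_eq\<close>).  So the \<open>\<lambda>\<^sub>k(u)\<close> are the zeros of a combination
  \<open>a qcos + b qsin\<close>, and the weights are the reciprocals of \<open>K\<close> on the diagonal.

  It remains to prove that the masses \<open>1 / K(x, x)\<close> at the zeros of \<open>a qcos + b qsin\<close> form a measure of
  orthogonality.  At distinct zeros \<open>K\<close> vanishes, so the vectors \<open>(P\<^sub>n(x))\<^sub>n\<close> are orthogonal in \<open>\<ell>\<^sup>2\<close>, and what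
  has to be shown is completeness.  By the equality case of the Bessel inequality and the
  recurrence it is enough that the masses add up to \<open>1\<close> (\<open>zeros_orthogonal\<close>).  They do so because they are limits
  of the weights of finite Gauss quadrature rules: a node of such a rule in a bounded interval lies close to a
  zero, two nodes cannot be close to the same zero since \<open>K > 0\<close> near the diagonal, and the second moment
  controls the mass outside the interval (\<open>weights_complete\<close>).

  The Stieltjes transform of such a measure follows by integrating \<open>K(\<lambda>, x) / (z - x)\<close> for a zero \<open>\<lambda>\<close>
  (\<open>point_masses_stieltjes\<close>).  Conversely, a measure of orthogonality with the same transform has the same point
  masses, and these already exhaust its total mass \<open>1\<close> (\<open>eq_point_masses_if_stieltjes_eq\<close>).  Finally
  \<open>qcos / qsin\<close> has derivative \<open>- K(x, x) / (qsin x)\<^sup>2\<close>.  It decreases from \<open>+\<infinity>\<close> to \<open>-\<infinity>\<close> between two consecutive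
  zeros of \<open>qsin\<close>, so \<open>u\<close> in \<open>[0, s\<^sub>1)\<close> runs exactly once through all ratios \<open>a : b\<close>.
\<close>

section \<open>The three-term recurrence\<close>

locale q_recurrence =
  fixes q :: real
  assumes q_pos: "0 < q" and q_less_1: "q < 1"
begin

abbreviation P :: "nat \<Rightarrow> 'a::real_field \<Rightarrow> 'a" where "P n z \<equiv> poly (P_poly q n) z"
abbreviation Q :: "nat \<Rightarrow> 'a::real_field \<Rightarrow> 'a" where "Q n z \<equiv> poly (Q_poly q n) z"
abbreviation r :: real where "r \<equiv> sqrt q"

lemma r_pos: "0 < r" and r_less_1: "r < 1" and r_sq: "r * r = q"
  using q_pos q_less_1 by auto

lemma beta_eq: "beta q n = 1 / r ^ n"
proof -
  have "- (real n / 2) = - ((1/2) * real n)" by simp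
  then have "q powr (- (real n / 2)) = q powr (- ((1/2) * real n))" by (rule arg_cong)
  also have "\<dots> = inverse ((q powr (1/2)) powr real n)"
    by (simp only: powr_powr powr_minus)
  also have "q powr (1/2) = r" using q_pos by (simp add: powr_half_sqrt)
  also have "r powr real n = r ^ n" using q_pos by (simp add: powr_realpow)
  finally show ?thesis unfolding beta_def by (simp only: inverse_eq_divide)
qed

lemma beta_0: "beta q 0 = 1" by (simp add: beta_eq)

text \<open>
  The two initial values are left free: the polynomials of the first and of the second kind are the solutions
  with initial values \<open>1, z\<close> and \<open>0, 1\<close>.
\<close>
definition solves :: "'a::real_field \<Rightarrow> (nat \<Rightarrow> 'a) \<Rightarrow> bool" where
  "solves z u \<longleftrightarrow> (\<forall>n. u (Suc (Suc n)) = of_real (r ^ Suc n) * z * u (Suc n) - of_real r * u n)"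

lemma beta_ratio: "1 / beta q (Suc n) = r ^ Suc n" "1 / beta q (Suc n) * beta q n = r"
  using r_pos by (simp_all add: beta_eq)

lemma solves_P: "solves z (\<lambda>n. P n z)"
  unfolding solves_def P_poly.simps beta_ratio(1)
  using r_pos by (simp add: algebra_simps beta_eq)

lemma solves_Q: "solves z (\<lambda>n. Q n z)"
  unfolding solves_def Q_poly.simps beta_ratio(1)
  using r_pos by (simp add: algebra_simps beta_eq)

lemma P_of_real: "P n (of_real x :: 'a::real_field) = of_real (P n x)"
proof (induction n rule: less_induct)
  case (less n)
  consider "n = 0" | "n = 1" | m where "n = Suc (Suc m)"
    by (metis One_nat_def not0_implies_Suc)
  then show ?case
  proof cases
    case 3
    then show ?thesis using less[of "Suc m"] less[of m] by simp
  qed simp_all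
qed

lemma x_times_P:
  "z * P n z = (if n = 0 then 0 else of_real (beta q (n - 1)) * P (n - 1) z)
               + of_real (beta q n) * P (Suc n) (z :: 'a::real_field)"
proof (cases n)
  case 0 then show ?thesis by (simp add: beta_0)
next
  case (Suc m)
  then show ?thesis using P_poly_recurrence[OF q_pos, of n z] by simp
qed

section \<open>Geometric decay of the solutions\<close>

definition s :: real where "s = sqrt r"

lemma s_pos: "0 < s" and s_less_1: "s < 1" and s_sq: "s * s = r"
  using r_pos r_less_1 by (auto simp: s_def)

text \<open>
  Rescaled by \<open>s^n\<close> with \<open>s\<^sup>2 = r\<close>, the coefficient of the middle term becomes \<open>z s r^n\<close>, which is summable, and
  that of the last term becomes \<open>- 1\<close>.  The maximum of two consecutive rescaled values therefore grows
  at most by the convergent product of the \<open>1 + R s r^k\<close>.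
\<close>
lemma solution_bound:
  fixes u :: "nat \<Rightarrow> 'a::real_normed_field"
  assumes u: "solves z u" and z: "norm z \<le> R" and u0: "norm (u 0) \<le> 1" and u1: "norm (u 1) \<le> 1 + R"
  shows "norm (u n) \<le> (1 + R) / s * exp (R * s / (1 - r)) * s ^ n"
proof -
  have R: "0 \<le> R" using z norm_ge_zero order_trans by blast
  define v where "v n = norm (u n) / s ^ n" for n
  have v: "v (Suc (Suc n)) \<le> R * s * r ^ n * v (Suc n) + v n" for n
  proof -
    have "norm (u (Suc (Suc n))) \<le> norm (of_real (r ^ Suc n) * z * u (Suc n)) + norm (of_real r * u n)"
      using u norm_triangle_ineq4 unfolding solves_def by metis
    also have "\<dots> = r ^ Suc n * norm z * norm (u (Suc n)) + r * norm (u n)"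
      using r_pos by (simp add: norm_mult norm_power)
    also have "\<dots> \<le> r ^ Suc n * R * norm (u (Suc n)) + r * norm (u n)"
      using z r_pos q_pos by (intro add_mono mult_right_mono mult_left_mono) auto
    finally have *: "norm (u (Suc (Suc n))) \<le> r ^ Suc n * R * norm (u (Suc n)) + r * norm (u n)" .
    have "v (Suc (Suc n)) \<le> (r ^ Suc n * R * norm (u (Suc n)) + r * norm (u n)) / s ^ Suc (Suc n)"
      unfolding v_def using * s_pos by (intro divide_right_mono) auto
    also have "\<dots> = R * s * r ^ n * v (Suc n) + v n"
      using s_pos unfolding v_def by (simp add: s_sq[symmetric] field_simps)
    finally show ?thesis .
  qed
  define m where "m n = max (v n) (v (Suc n))" for n
  have m0: "0 \<le> m n" for n unfolding m_def v_def using s_pos by (simp add: le_max_iff_disj)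
  have step: "m (Suc n) \<le> exp (R * s * r ^ n) * m n" for n
  proof -
    have c: "0 \<le> R * s * r ^ n" using R s_pos r_pos q_pos by auto
    have e: "1 + R * s * r ^ n \<le> exp (R * s * r ^ n)" by (rule exp_ge_add_one_self)
    have "v (Suc (Suc n)) \<le> R * s * r ^ n * m n + m n"
      using v[of n] mult_left_mono[OF _ c, of "v (Suc n)" "m n"] unfolding m_def by force
    also have "\<dots> = (1 + R * s * r ^ n) * m n" by (simp add: algebra_simps)
    also have "\<dots> \<le> exp (R * s * r ^ n) * m n" by (rule mult_right_mono[OF e m0])
    finally have 1: "v (Suc (Suc n)) \<le> exp (R * s * r ^ n) * m n" .
    have "v (Suc n) \<le> 1 * m n" unfolding m_def by simp
    also have "\<dots> \<le> exp (R * s * r ^ n) * m n" using c by (intro mult_right_mono m0) simp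
    finally show ?thesis using 1 unfolding m_def by simp
  qed
  have "m n \<le> exp (R * s * (\<Sum>k<n. r ^ k)) * m 0"
  proof (induction n)
    case (Suc n)
    have "m (Suc n) \<le> exp (R * s * r ^ n) * (exp (R * s * (\<Sum>k<n. r ^ k)) * m 0)"
      using step[of n] Suc by (meson exp_ge_zero mult_left_mono order_trans)
    then show ?case by (simp add: exp_add[symmetric] algebra_simps mult_exp_exp)
  qed simp
  also have "\<dots> \<le> exp (R * s / (1 - r)) * m 0"
  proof (intro mult_right_mono m0)
    have "(\<Sum>k<n. r ^ k) \<le> 1 / (1 - r)"
      using r_pos r_less_1 q_pos sum_le_suminf[of "\<lambda>k. r ^ k" "{..<n}"]
      by (simp add: suminf_geometric summable_geometric)
    then show "exp (R * s * (\<Sum>k<n. r ^ k)) \<le> exp (R * s / (1 - r))"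
      using R s_pos mult_left_mono[of "(\<Sum>k<n. r ^ k)" "1 / (1 - r)" "R * s"] by simp
  qed
  also have "\<dots> \<le> exp (R * s / (1 - r)) * ((1 + R) / s)"
  proof (intro mult_left_mono)
    have "v 0 \<le> (1 + R) / s" "v 1 \<le> (1 + R) / s"
      using u0 u1 s_pos s_less_1 R unfolding v_def by (auto simp: field_simps)
        (smt (verit) mult_left_le mult_nonneg_nonneg)
    then show "m 0 \<le> (1 + R) / s" by (simp add: m_def)
  qed simp
  finally have "v n \<le> exp (R * s / (1 - r)) * ((1 + R) / s)" by (simp add: m_def)
  then have "norm (u n) \<le> exp (R * s / (1 - r)) * ((1 + R) / s) * s ^ n"
    unfolding v_def using s_pos by (simp add: pos_divide_le_eq)
  then show ?thesis by (simp add: algebra_simps)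
qed

definition decay_const :: "real \<Rightarrow> real" where "decay_const R = (1 + R) / s * exp (R * s / (1 - r))"

lemma norm_P_le: "norm (z :: 'a::real_normed_field) \<le> R \<Longrightarrow> norm (P n z) \<le> decay_const R * s ^ n"
  unfolding decay_const_def by (rule solution_bound[OF solves_P]) auto

lemma norm_Q_le:
  fixes z :: "'a::real_normed_field"
  assumes "norm z \<le> R" shows "norm (Q n z) \<le> decay_const R * s ^ n"
proof -
  have "0 \<le> R" using assms norm_ge_zero order_trans by blast
  then show ?thesis unfolding decay_const_def by (intro solution_bound[OF solves_Q]) (use assms in auto)
qed

section \<open>The Green formula\<close>

text \<open>
  The weighted Casorati determinant of two sequences, the discrete analogue of a Wronskian.
\<close>
definition casorati :: "(nat \<Rightarrow> 'a::real_field) \<Rightarrow> (nat \<Rightarrow> 'a) \<Rightarrow> nat \<Rightarrow> 'a" where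
  "casorati u v N = of_real (beta q N) * (u (Suc N) * v N - v (Suc N) * u N)"

text \<open>
  The discrete Green formula.  With polynomials of the first kind it is the Christoffel-Darboux formula;
  the mixed cases express the approximants of \<open>A\<close>, \<open>B\<close>, \<open>C\<close>, \<open>D\<close> as partial sums.
\<close>
lemma casorati_green:
  assumes u: "solves z u" and v: "solves w v"
  shows "casorati u v N = (u 1 * v 0 - v 1 * u 0) - (z - w) * (u 0 * v 0) + (z - w) * (\<Sum>k\<le>N. u k * v k)"
proof (induction N)
  case 0 show ?case by (simp add: casorati_def beta_0)
next
  case (Suc N)
  have u': "u (Suc (Suc N)) = of_real (r ^ Suc N) * z * u (Suc N) - of_real r * u N"
   and v': "v (Suc (Suc N)) = of_real (r ^ Suc N) * w * v (Suc N) - of_real r * v N"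
    using u v by (auto simp: solves_def)
  have b1: "of_real (beta q (Suc N)) * of_real (r ^ Suc N) = (1::'a)"
    using r_pos unfolding of_real_mult[symmetric] beta_eq by simp
  have b2: "of_real (beta q (Suc N)) * of_real r = (of_real (beta q N)::'a)"
    using r_pos unfolding of_real_mult[symmetric] beta_eq by simp
  have "casorati u v (Suc N) = (of_real (beta q (Suc N)) * of_real (r ^ Suc N)) * (z - w) * (u (Suc N) * v (Suc N))
      + (of_real (beta q (Suc N)) * of_real r) * (u (Suc N) * v N - v (Suc N) * u N)"
    unfolding casorati_def u' v' by (simp add: algebra_simps)
  also have "\<dots> = (z - w) * (u (Suc N) * v (Suc N)) + casorati u v N"
    unfolding b1 b2 casorati_def by simp
  finally show ?case unfolding Suc by (simp add: algebra_simps)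
qed

text \<open>
  The Pluecker relation between \<open>2 \<times> 2\<close> minors.  It expresses a Casorati determinant with arguments \<open>z\<close>, \<open>w\<close>
  by determinants in which one argument is \<open>0\<close>, which is how the kernel is reduced to \<open>B\<close> and \<open>D\<close>.
\<close>
lemma casorati_pluecker: "casorati a e N * casorati b f N - casorati a f N * casorati b e N = casorati a b N * casorati e f N"
  unfolding casorati_def by (simp add: algebra_simps)

lemma casorati_PP: "casorati (\<lambda>n. P n z) (\<lambda>n. P n w) N = (z - w) * (\<Sum>k\<le>N. P k z * P k w)"
  by (subst casorati_green[OF solves_P solves_P]) simp
lemma casorati_PQ: "casorati (\<lambda>n. P n z) (\<lambda>n. Q n w) N = - 1 + (z - w) * (\<Sum>k\<le>N. P k z * Q k w)"
  by (subst casorati_green[OF solves_P solves_Q]) simp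
lemma casorati_QP: "casorati (\<lambda>n. Q n z) (\<lambda>n. P n w) N = 1 + (z - w) * (\<Sum>k\<le>N. Q k z * P k w)"
  by (subst casorati_green[OF solves_Q solves_P]) simp
lemma casorati_QQ: "casorati (\<lambda>n. Q n z) (\<lambda>n. Q n w) N = (z - w) * (\<Sum>k\<le>N. Q k z * Q k w)"
  by (subst casorati_green[OF solves_Q solves_Q]) simp

section \<open>The reproducing kernel\<close>

lemma summable_s2: "summable (\<lambda>k. c * (s ^ k * s ^ k))"
proof -
  have "s ^ k * s ^ k = r ^ k" for k by (simp add: s_sq[symmetric] power_mult_distrib)
  then show ?thesis using r_pos r_less_1 by (simp add: summable_mult summable_geometric)
qed

text \<open>
  Stated for two arbitrary families because the four Nevanlinna functions and the kernel need all
  combinations of \<open>P\<close> and \<open>Q\<close>.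
\<close>

lemma
  fixes U V :: "nat \<Rightarrow> 'a::{real_normed_field,banach} \<Rightarrow> 'a"
  assumes U: "\<And>R z n. norm z \<le> R \<Longrightarrow> norm (U n z) \<le> decay_const R * s ^ n"
    and V: "\<And>R z n. norm z \<le> R \<Longrightarrow> norm (V n z) \<le> decay_const R * s ^ n"
  shows bilinear_series_uniform_limit:
    "uniform_limit (cball 0 R \<times> cball 0 R) (\<lambda>N (z, w). \<Sum>k\<le>N. U k z * V k w)
       (\<lambda>(z, w). \<Sum>k. U k z * V k w) sequentially" (is ?A)
   and bilinear_series_summable: "summable (\<lambda>k. norm (U k z * V k w))" (is ?B)
proof -
  have b: "norm (U k z * V k w) \<le> (decay_const R * decay_const R) * (s ^ k * s ^ k)" if "norm z \<le> R" "norm w \<le> R" for z w R k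
  proof -
    have "norm (U k z * V k w) \<le> (decay_const R * s ^ k) * (decay_const R * s ^ k)"
      unfolding norm_mult using U[OF that(1), of k] V[OF that(2), of k]
      by (intro mult_mono) (auto intro: order_trans[OF norm_ge_zero])
    then show ?thesis by (simp add: algebra_simps)
  qed
  show ?B
  proof (rule summable_comparison_test'[OF summable_s2])
    show "norm (norm (U k z * V k w)) \<le> (decay_const (max (norm z) (norm w)) * decay_const (max (norm z) (norm w))) * (s ^ k * s ^ k)" for k
      using b[of z "max (norm z) (norm w)" w k] by simp
  qed
  have "uniform_limit (cball 0 R \<times> cball 0 R) (\<lambda>N x. \<Sum>k<N. U k (fst x) * V k (snd x))
       (\<lambda>x. \<Sum>k. U k (fst x) * V k (snd x)) sequentially"
    by (rule Weierstrass_m_test[OF _ summable_s2[of "decay_const R * decay_const R"]]) (auto intro!: b)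
  then have "uniform_limit (cball 0 R \<times> cball 0 R) (\<lambda>N x. \<Sum>k<Suc N. U k (fst x) * V k (snd x))
       (\<lambda>x. \<Sum>k. U k (fst x) * V k (snd x)) sequentially"
    by (rule filterlim_compose[OF _ filterlim_Suc])
  then show ?A by (simp add: lessThan_Suc_atMost case_prod_unfold)
qed

definition kern :: "'a::{real_normed_field,banach} \<Rightarrow> 'a \<Rightarrow> 'a" where
  "kern z w = (\<Sum>k. P k z * P k w)"

lemmas kern_uniform_limit = bilinear_series_uniform_limit[where U = P and V = P, OF norm_P_le norm_P_le, folded kern_def]
lemmas kern_summable_norm = bilinear_series_summable[where U = P and V = P, OF norm_P_le norm_P_le]

lemma kern_sums: "(\<lambda>k. P k z * P k w) sums kern z (w::'a::{real_normed_field,banach})"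
  unfolding kern_def by (rule summable_sums[OF summable_norm_cancel[OF kern_summable_norm]])

lemma kern_LIM: "(\<lambda>N. \<Sum>k\<le>N. P k z * P k w) \<longlonglongrightarrow> kern z (w::'a::{real_normed_field,banach})"
  using kern_sums sums_def_le by blast

lemma kern_continuous: "continuous_on UNIV (\<lambda>(z, w). kern z (w::'a::{real_normed_field,banach}))"
proof -
  have big: "continuous_on (cball 0 R \<times> cball 0 R) (\<lambda>(z, w). kern z (w::'a))" for R
    by (rule uniform_limit_theorem[OF _ kern_uniform_limit])
       (auto intro!: always_eventually continuous_intros simp: case_prod_unfold)
  have *: "continuous_on (ball 0 R \<times> ball 0 R) (\<lambda>(z, w). kern z (w::'a))" for R
    by (rule continuous_on_subset[OF big[of R]]) auto
  have "isCont (\<lambda>(z, w). kern z (w::'a)) x" for x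
  proof -
    obtain z w where x: "x = (z, w)" by (cases x)
    have "x \<in> ball 0 (norm z + norm w + 1) \<times> ball 0 (norm z + norm w + 1)"
      unfolding x by (simp add: add_nonneg_pos add_strict_increasing2)
    then show ?thesis
      using continuous_on_eq_continuous_at[OF open_Times[OF open_ball open_ball]] * by blast
  qed
  then show ?thesis by (simp add: continuous_at_imp_continuous_on)
qed

lemma kern_commute: "kern z w = kern w z"
  by (simp add: kern_def mult.commute)

lemma kern_diag_ge_1: "1 \<le> kern x (x::real)"
proof -
  have "sum (\<lambda>k. P k x * P k x) {..<Suc 0} \<le> kern x x"
    unfolding kern_def by (rule sum_le_suminf[OF sums_summable[OF kern_sums]]) auto
  then show ?thesis by simp
qed

definition qpoch_q :: "nat \<Rightarrow> real" where "qpoch_q n = qpoch q q n"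

lemma qpoch_q_0: "qpoch_q 0 = 1" by (simp add: qpoch_q_def qpoch_def)
lemma qpoch_q_Suc: "qpoch_q (Suc n) = qpoch_q n * (1 - q ^ Suc n)" by (simp add: qpoch_q_def qpoch_def)

lemma one_minus_power_ge: "1 - q \<le> 1 - q ^ Suc n"
  using q_pos q_less_1 by (simp add: mult_left_le power_le_one)

lemma qpoch_q_ge: "(1 - q) ^ n \<le> qpoch_q n"
proof (induction n)
  case (Suc n)
  have "(1 - q) ^ n * (1 - q) \<le> qpoch_q n * (1 - q ^ Suc n)"
    using q_less_1 one_minus_power_ge[of n] order_trans[OF _ Suc]
    by (intro mult_mono[OF Suc]) auto
  then show ?case by (simp add: qpoch_q_Suc mult.commute)
qed (simp add: qpoch_q_0)

lemma qpoch_q_pos: "0 < qpoch_q n"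
  using qpoch_q_ge[of n] q_less_1 by (smt (verit) zero_less_power)

lemma one_minus_power_pos: "0 < 1 - q ^ Suc n"
  using one_minus_power_ge[of n] q_less_1 by linarith

section \<open>The Gauss binomial formula\<close>

definition gauss_coeff :: "nat \<Rightarrow> nat \<Rightarrow> real" where
  "gauss_coeff n i = (-1) ^ i * q ^ (i * (i - 1) div 2) / (qpoch_q i * qpoch_q (n - i))"

lemma tri_Suc: "Suc i * (Suc i - 1) div 2 = i * (i - 1) div 2 + i"
proof (cases i)
  case (Suc j)
  have "Suc i * (Suc i - 1) = i * (i - 1) + 2 * i" unfolding Suc by (simp add: algebra_simps)
  then show ?thesis by simp
qed simp

text \<open>
  Splitting \<open>1 - q^(n+1) = (1 - q^(n+1-i)) + q^(n+1-i) (1 - q^i)\<close> in the \<open>i\<close>-th summand cancels one factor in one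
  of the two q-factorials of the denominator.  So \<open>1 - q^(n+1)\<close> times the sum of degree \<open>n + 1\<close> is
  \<open>x - a q^n\<close> times the sum of degree \<open>n\<close>.
\<close>
theorem gauss_binomial:
  fixes x a :: "'a::real_field"
  shows "(\<Prod>j<n. x - a * of_real q ^ j) =
    of_real (qpoch_q n) * (\<Sum>i\<le>n. of_real (gauss_coeff n i) * a ^ i * x ^ (n - i))"
proof (induction n)
  case 0 show ?case by (simp add: gauss_coeff_def qpoch_q_0)
next
  case (Suc n)
  let ?t = "\<lambda>n i. of_real (gauss_coeff n i) * a ^ i * x ^ (n - i)"
  have qfn: "qpoch_q n \<noteq> 0" for n using qpoch_q_pos[of n] by simp
  have nz: "1 - q ^ Suc n \<noteq> 0" for n using one_minus_power_pos[of n] by simp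
  have split: "(1 - q ^ Suc n) * gauss_coeff (Suc n) i =
      (1 - q ^ (Suc n - i)) * gauss_coeff (Suc n) i + q ^ (Suc n - i) * (1 - q ^ i) * gauss_coeff (Suc n) i"
    if "i \<le> Suc n" for i
  proof -
    have "q ^ (Suc n - i) * q ^ i = q ^ Suc n" using that by (simp flip: power_add)
    then show ?thesis by (simp add: algebra_simps)
  qed
  \<comment> \<open>the two parts of the splitting, each reduced to a coefficient of degree \<open>n\<close>\<close>
  have 1: "(1 - q ^ (Suc n - i)) * gauss_coeff (Suc n) i = gauss_coeff n i" if "i \<le> n" for i
    using that nz[of "n - i"] qfn by (simp add: gauss_coeff_def Suc_diff_le qpoch_q_Suc del: power_Suc)
  have 2: "q ^ (Suc n - Suc i) * (1 - q ^ Suc i) * gauss_coeff (Suc n) (Suc i) = - (q ^ n) * gauss_coeff n i"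
    if "i \<le> n" for i
  proof -
    have e: "q ^ n = q ^ (n - i) * q ^ i" using that by (simp flip: power_add)
    show ?thesis
      using nz[of i] qfn unfolding gauss_coeff_def tri_Suc diff_Suc_Suc power_add qpoch_q_Suc e
      by (simp add: field_simps)
  qed
  have "of_real (1 - q ^ Suc n) * (\<Sum>i\<le>Suc n. ?t (Suc n) i)
      = (\<Sum>i\<le>Suc n. of_real ((1 - q ^ Suc n) * gauss_coeff (Suc n) i) * a ^ i * x ^ (Suc n - i))"
    by (simp add: sum_distrib_left mult.assoc del: sum.atMost_Suc)
  also have "\<dots> = (\<Sum>i\<le>Suc n. of_real ((1 - q ^ (Suc n - i)) * gauss_coeff (Suc n) i) * a ^ i * x ^ (Suc n - i)
      + of_real (q ^ (Suc n - i) * (1 - q ^ i) * gauss_coeff (Suc n) i) * a ^ i * x ^ (Suc n - i))"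
    by (rule sum.cong[OF refl]) (simp only: split of_real_add distrib_right atMost_iff)
  also have "\<dots> = (\<Sum>i\<le>Suc n. of_real ((1 - q ^ (Suc n - i)) * gauss_coeff (Suc n) i) * a ^ i * x ^ (Suc n - i))
      + (\<Sum>i\<le>Suc n. of_real (q ^ (Suc n - i) * (1 - q ^ i) * gauss_coeff (Suc n) i) * a ^ i * x ^ (Suc n - i))"
    by (rule sum.distrib)
  also have "(\<Sum>i\<le>Suc n. of_real ((1 - q ^ (Suc n - i)) * gauss_coeff (Suc n) i) * a ^ i * x ^ (Suc n - i))
      = (\<Sum>i\<le>n. of_real ((1 - q ^ (Suc n - i)) * gauss_coeff (Suc n) i) * a ^ i * x ^ (Suc n - i))"
    by simp
  also have "\<dots> = x * (\<Sum>i\<le>n. ?t n i)"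
    unfolding sum_distrib_left by (rule sum.cong[OF refl]) (simp only: 1 atMost_iff, simp add: Suc_diff_le)
  also have "(\<Sum>i\<le>Suc n. of_real (q ^ (Suc n - i) * (1 - q ^ i) * gauss_coeff (Suc n) i) * a ^ i * x ^ (Suc n - i))
      = (\<Sum>i\<le>n. of_real (q ^ (Suc n - Suc i) * (1 - q ^ Suc i) * gauss_coeff (Suc n) (Suc i)) * a ^ Suc i * x ^ (Suc n - Suc i))"
    by (subst sum.atMost_Suc_shift) simp
  also have "\<dots> = - (a * of_real q ^ n) * (\<Sum>i\<le>n. ?t n i)"
    unfolding sum_distrib_left by (rule sum.cong) (auto simp only: 2 atMost_iff, simp add: algebra_simps)
  finally have "of_real (1 - q ^ Suc n) * (\<Sum>i\<le>Suc n. ?t (Suc n) i) = (x - a * of_real q ^ n) * (\<Sum>i\<le>n. ?t n i)"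
    by (simp add: algebra_simps del: sum.atMost_Suc)
  then show ?case
    by (simp add: Suc qpoch_q_Suc mult.assoc mult.left_commute mult.commute del: power_Suc sum.atMost_Suc)
qed

lemma prod_lessThan_add:
  fixes f :: "nat \<Rightarrow> 'b::comm_monoid_mult" and m n :: nat
  shows "(\<Prod>j<m + n. f j) = (\<Prod>j<m. f j) * (\<Prod>j<n. f (m + j))"
  by (induction n) (simp_all add: mult.assoc)

text \<open>
  Reversing the order of the factors.  Together with \<open>prod_shift\<close> this writes the two-sided products
  of the kernel and of the zero function as one product to which \<open>gauss_binomial\<close> applies.
\<close>
lemma prod_reflect:
  fixes x y :: "'a::real_field"
  shows "(\<Prod>j<k. x * of_real q ^ k - y * of_real q ^ j)
    = of_real ((-1) ^ k * q ^ (k * (k - 1) div 2)) * (\<Prod>j<k. y - x * of_real q ^ Suc j)"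
proof (induction k)
  case (Suc k)
  have "(\<Prod>j<Suc k. x * of_real q ^ Suc k - y * of_real q ^ j)
      = (x * of_real q ^ Suc k - y) * (\<Prod>j<k. of_real q * (x * of_real q ^ k - y * of_real q ^ j))"
    by (subst prod.lessThan_Suc_shift) (simp add: algebra_simps)
  also have "\<dots> = (x * of_real q ^ Suc k - y) * of_real q ^ k * (\<Prod>j<k. x * of_real q ^ k - y * of_real q ^ j)"
    by (simp add: prod.distrib)
  finally show ?case unfolding Suc tri_Suc power_add by (simp add: algebra_simps)
qed simp

lemma prod_shift:
  fixes x y :: "'a::real_field"
  shows "(\<Prod>j<m. x * of_real q ^ k - y * of_real q ^ (k + j)) = of_real (q ^ (k * m)) * (\<Prod>j<m. x - y * of_real q ^ j)"
proof -
  have "(\<Prod>j<m. x * of_real q ^ k - y * of_real q ^ (k + j)) = (\<Prod>j<m. of_real q ^ k * (x - y * of_real q ^ j))"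
    by (simp add: power_add algebra_simps)
  then show ?thesis by (simp add: prod.distrib power_mult)
qed

section \<open>Homogeneous parts of the addition formulas\<close>

definition qcos_coeff :: "nat \<Rightarrow> real" where
  "qcos_coeff k = (-1) ^ k * q ^ (k * (k - 1)) / qpoch_q (2 * k)"
definition qsin_coeff :: "nat \<Rightarrow> real" where
  "qsin_coeff k = (-1) ^ k * q ^ (k * k) / qpoch_q (Suc (2 * k))"

lemma tri_even: "(2 * b) * (2 * b - 1) div 2 = b * (2 * b - 1)" for b :: nat
  by (simp add: mult.assoc)
lemma tri_odd: "Suc (2 * b) * (Suc (2 * b) - 1) div 2 = (2 * b + 1) * b" for b :: nat
proof -
  have "Suc (2 * b) * (Suc (2 * b) - 1) = 2 * ((2 * b + 1) * b)" by simp
  then show ?thesis by simp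
qed

lemma minus_one_sq: "(-1) ^ b * (-1) ^ b = (1::real)"
  by (simp flip: power_mult_distrib)

lemma qnz: "q \<noteq> 0" using q_pos by simp
lemma qpoch_q_nz: "qpoch_q n \<noteq> 0" using qpoch_q_pos[of n] by simp

text \<open>
  The quadratic form in the exponent of the centred Gauss binomial separates into a part depending on \<open>a\<close> and one
  depending on \<open>b\<close>, which are the exponents of the q-sine and of the q-cosine.
\<close>
lemma odd_coeffs:
  fixes a b :: nat
  defines "k \<equiv> a + b"
  shows "(-1) ^ k / q ^ (k * Suc k) * (gauss_coeff (Suc (2 * k)) (2 * b) * q ^ (k * (Suc (2 * a))))
           = qcos_coeff b * qsin_coeff a" (is ?A)
    and "(-1) ^ k / q ^ (k * Suc k) * (gauss_coeff (Suc (2 * k)) (Suc (2 * b)) * q ^ (k * (2 * a)))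
           = - (qsin_coeff b * qcos_coeff a)" (is ?B)
proof -
  have d: "Suc (2 * k) - 2 * b = Suc (2 * a)" "Suc (2 * k) - Suc (2 * b) = 2 * a"
    by (auto simp: k_def)
  have "b * (2 * b - 1) + k * Suc (2 * a) = k * Suc k + (b * (b - 1) + a * a)"
    by (cases b) (simp_all add: k_def algebra_simps)
  then have e: "q ^ (b * (2 * b - 1)) * q ^ (k * Suc (2 * a)) = q ^ (k * Suc k) * (q ^ (b * (b - 1)) * q ^ (a * a))"
    by (simp only: power_add[symmetric])
  have "gauss_coeff (Suc (2 * k)) (2 * b) * q ^ (k * (Suc (2 * a)))
     = (q ^ (b * (2 * b - 1)) * q ^ (k * Suc (2 * a))) / (qpoch_q (2 * b) * qpoch_q (Suc (2 * a)))"
    unfolding gauss_coeff_def tri_even d by simp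
  then show ?A unfolding e qcos_coeff_def qsin_coeff_def
    using qnz qpoch_q_nz by (simp add: k_def power_add)
  have "(2 * b + 1) * b + k * (2 * a) = k * Suc k + (a * (a - 1) + b * b)"
    by (cases a) (simp_all add: k_def algebra_simps)
  then have e: "q ^ ((2 * b + 1) * b) * q ^ (k * (2 * a)) = q ^ (k * Suc k) * (q ^ (a * (a - 1)) * q ^ (b * b))"
    by (simp only: power_add[symmetric])
  have "gauss_coeff (Suc (2 * k)) (Suc (2 * b)) * q ^ (k * (2 * a))
     = - (q ^ ((2 * b + 1) * b) * q ^ (k * (2 * a))) / (qpoch_q (Suc (2 * b)) * qpoch_q (2 * a))"
    unfolding gauss_coeff_def tri_odd d by simp
  then show ?B unfolding e qcos_coeff_def qsin_coeff_def
    using qnz qpoch_q_nz by (simp add: k_def power_add)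
qed

text \<open>
  As in \<open>odd_coeffs\<close>, for an even number of factors.  The extra \<open>q^a\<close> amounts to replacing the argument
  \<open>u\<close> by \<open>sqrt q u\<close> in one of the two series.
\<close>
lemma even_coeffs:
  fixes a b :: nat
  shows "k = a + b \<Longrightarrow> (-1) ^ k / q ^ (k * k) * (gauss_coeff (2 * k) (2 * b) * q ^ (k * (2 * a)))
           = qcos_coeff b * (qcos_coeff a * q ^ a)"
    and "k = Suc (a + b) \<Longrightarrow> (-1) ^ k / q ^ (k * k) * (gauss_coeff (2 * k) (Suc (2 * b)) * q ^ (k * Suc (2 * a)))
           = qsin_coeff b * (qsin_coeff a * q ^ a)"
proof -
  assume k: "k = a + b"
  have d: "2 * k - 2 * b = 2 * a" by (auto simp: k)
  have "b * (2 * b - 1) + k * (2 * a) = k * k + (b * (b - 1) + (a * (a - 1) + a))"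
    by (cases b; cases a) (simp_all add: k algebra_simps)
  then have e: "q ^ (b * (2 * b - 1)) * q ^ (k * (2 * a)) = q ^ (k * k) * (q ^ (b * (b - 1)) * (q ^ (a * (a - 1)) * q ^ a))"
    by (simp only: power_add[symmetric])
  have "gauss_coeff (2 * k) (2 * b) * q ^ (k * (2 * a))
     = (q ^ (b * (2 * b - 1)) * q ^ (k * (2 * a))) / (qpoch_q (2 * b) * qpoch_q (2 * a))"
    unfolding gauss_coeff_def tri_even d by simp
  then show "(-1) ^ k / q ^ (k * k) * (gauss_coeff (2 * k) (2 * b) * q ^ (k * (2 * a)))
           = qcos_coeff b * (qcos_coeff a * q ^ a)" unfolding e qcos_coeff_def
    using qnz qpoch_q_nz by (simp add: k power_add)
next
  assume k: "k = Suc (a + b)"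
  have d: "2 * k - Suc (2 * b) = Suc (2 * a)" by (auto simp: k)
  have "(2 * b + 1) * b + k * Suc (2 * a) = k * k + (b * b + (a * a + a))"
    by (simp_all add: k algebra_simps)
  then have e: "q ^ ((2 * b + 1) * b) * q ^ (k * Suc (2 * a)) = q ^ (k * k) * (q ^ (b * b) * (q ^ (a * a) * q ^ a))"
    by (simp only: power_add[symmetric])
  have "gauss_coeff (2 * k) (Suc (2 * b)) * q ^ (k * Suc (2 * a))
     = - (q ^ ((2 * b + 1) * b) * q ^ (k * Suc (2 * a))) / (qpoch_q (Suc (2 * b)) * qpoch_q (Suc (2 * a)))"
    unfolding gauss_coeff_def tri_odd d by simp
  then show "(-1) ^ k / q ^ (k * k) * (gauss_coeff (2 * k) (Suc (2 * b)) * q ^ (k * Suc (2 * a)))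
           = qsin_coeff b * (qsin_coeff a * q ^ a)" unfolding e qsin_coeff_def
    using qnz qpoch_q_nz by (simp add: k power_add)
qed

abbreviation c_term :: "'a::real_field \<Rightarrow> nat \<Rightarrow> 'a" where
  "c_term z k \<equiv> of_real (qcos_coeff k) * z ^ (2 * k)"
abbreviation s_term :: "'a::real_field \<Rightarrow> nat \<Rightarrow> 'a" where
  "s_term z k \<equiv> of_real (qsin_coeff k) * z ^ Suc (2 * k)"

text \<open>
  On the diagonal these are the summands of \<open>weight_fun\<close> divided by \<open>1 - q\<close>.  The second variable is introduced
  because the identification with the kernel goes through \<open>z - w\<close> times the sum.
\<close>
definition kern_term :: "'a::real_field \<Rightarrow> 'a \<Rightarrow> nat \<Rightarrow> 'a" where
  "kern_term z w k = of_real (q ^ (k * (k - 1) div 2) / qpoch_q (Suc (2 * k)))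
      * (\<Prod>j<k. (z - w * of_real q ^ Suc j) * (w - z * of_real q ^ Suc j))"

text \<open>
  The right-hand side is the homogeneous part of degree \<open>2 k + 1\<close> of \<open>qsin z qcos w - qcos z qsin w\<close>.
\<close>
lemma kern_term_expand:
  fixes z w :: "'a::real_field"
  shows "(z - w) * kern_term z w k
    = (\<Sum>b\<le>k. c_term w b * s_term z (k - b)) - (\<Sum>b\<le>k. s_term w b * c_term z (k - b))"
proof -
  let ?c = "of_real ((-1) ^ k / q ^ (k * Suc k)) :: 'a"
  let ?A = "\<Prod>j<k. w - z * of_real q ^ Suc j" and ?B = "\<Prod>j<Suc k. z - w * of_real q ^ j"
  let ?g = "\<lambda>i. of_real (gauss_coeff (Suc (2 * k)) i) * w ^ i * (z * of_real q ^ k) ^ (Suc (2 * k) - i)"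
  \<comment> \<open>With \<open>x = z q^k\<close> the product of \<open>gauss_binomial\<close> contains, up to powers of \<open>q\<close>, exactly the factors of
    \<open>(z - w) * kern_term z w k\<close>.\<close>
  have n: "Suc (2 * k) = k + Suc k" by simp
  have "(\<Prod>j<Suc (2 * k). z * of_real q ^ k - w * of_real q ^ j)
     = of_real ((-1) ^ k * q ^ (k * (k - 1) div 2)) * ?A * (of_real (q ^ (k * Suc k)) * ?B)"
    unfolding n prod_lessThan_add prod_reflect prod_shift ..
  then have "?c * (\<Prod>j<Suc (2 * k). z * of_real q ^ k - w * of_real q ^ j)
     = of_real (((-1) ^ k / q ^ (k * Suc k)) * ((-1) ^ k * q ^ (k * (k - 1) div 2)) * q ^ (k * Suc k)) * ?A * ?B"
    by (simp only: of_real_mult mult_ac)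
  also have "((-1) ^ k / q ^ (k * Suc k)) * ((-1) ^ k * q ^ (k * (k - 1) div 2)) * q ^ (k * Suc k) = q ^ (k * (k - 1) div 2)"
    using qnz by (simp flip: power_mult_distrib)
  finally have 1: "of_real (q ^ (k * (k - 1) div 2)) * ?A * ?B
      = ?c * (of_real (qpoch_q (Suc (2 * k))) * (\<Sum>i\<le>Suc (2 * k). ?g i))"
    unfolding gauss_binomial by simp
  have B: "?B = (z - w) * (\<Prod>j<k. z - w * of_real q ^ Suc j)"
    by (subst prod.lessThan_Suc_shift) simp
  have "(z - w) * kern_term z w k = of_real (1 / qpoch_q (Suc (2 * k))) * (of_real (q ^ (k * (k - 1) div 2)) * ?A * ?B)"
    unfolding kern_term_def B prod.distrib by (simp add: mult_ac)
  also have "\<dots> = ?c * (\<Sum>i\<le>Suc (2 * k). ?g i)"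
    unfolding 1 using qpoch_q_nz by simp
  also have "\<dots> = (\<Sum>b\<le>k. ?c * ?g (2 * b) + ?c * ?g (Suc (2 * b)))"
    by (simp only: sum.in_pairs_0 sum_distrib_left ring_distribs)
  also have "\<dots> = (\<Sum>b\<le>k. c_term w b * s_term z (k - b) - s_term w b * c_term z (k - b))"
  proof (rule sum.cong[OF refl])
    fix b assume "b \<in> {..k}"
    then obtain a where k: "k = a + b" by (metis atMost_iff le_iff_add add.commute)
    have d: "Suc (2 * k) - 2 * b = Suc (2 * a)" "Suc (2 * k) - Suc (2 * b) = 2 * a" "k - b = a"
      by (auto simp: k)
    have "?c * ?g (2 * b) = of_real ((-1) ^ k / q ^ (k * Suc k) * (gauss_coeff (Suc (2 * k)) (2 * b) * q ^ (k * (Suc (2 * a)))))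
       * w ^ (2 * b) * z ^ Suc (2 * a)"
      unfolding d power_mult_distrib power_mult[symmetric] of_real_mult of_real_power by (simp only: mult_ac)
    moreover have "?c * ?g (Suc (2 * b)) = of_real ((-1) ^ k / q ^ (k * Suc k) * (gauss_coeff (Suc (2 * k)) (Suc (2 * b)) * q ^ (k * (2 * a))))
       * w ^ Suc (2 * b) * z ^ (2 * a)"
      unfolding d power_mult_distrib power_mult[symmetric] of_real_mult of_real_power by (simp only: mult_ac)
    ultimately show "?c * ?g (2 * b) + ?c * ?g (Suc (2 * b)) = c_term w b * s_term z (k - b) - s_term w b * c_term z (k - b)"
      unfolding d odd_coeffs[of a b, folded k] by (simp add: algebra_simps)
  qed
  finally show ?thesis by (simp only: sum_subtractf)
qed

text \<open>
  The summands of \<open>zero_fun\<close>; their denominators combine to \<open>(q; q)\<^bsub>2k\<^esub>\<close>.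
\<close>
definition shift_term :: "'a::real_field \<Rightarrow> 'a \<Rightarrow> nat \<Rightarrow> 'a" where
  "shift_term u z k = of_real (q ^ (k * (k - 1) div 2) / qpoch_q (2 * k))
      * (\<Prod>j<k. (u - z * of_real q ^ j) * (z - u * of_real q ^ Suc j))"

lemma sum_even_odd:
  fixes f :: "nat \<Rightarrow> 'b::ab_group_add"
  shows "(\<Sum>i\<le>2 * k. f i) = (\<Sum>b\<le>k. f (2 * b)) + (\<Sum>b<k. f (Suc (2 * b)))"
  by (induction k) (simp_all add: algebra_simps)

text \<open>
  The right-hand side is the homogeneous part of degree \<open>2 k\<close> of the Cauchy products for
  \<open>qcos z qcos (r u)\<close> and \<open>qsin z qsin (r u) / r\<close>.
\<close>
lemma shift_term_expand:
  fixes u z :: "'a::real_field"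
  shows "shift_term u z k
    = (\<Sum>b\<le>k. c_term z b * (of_real (q ^ (k - b)) * c_term u (k - b)))
      + (\<Sum>b<k. s_term z b * (of_real (q ^ (k - Suc b)) * s_term u (k - Suc b)))"
proof -
  let ?c = "of_real ((-1) ^ k / q ^ (k * k)) :: 'a"
  let ?A = "\<Prod>j<k. z - u * of_real q ^ Suc j" and ?B = "\<Prod>j<k. u - z * of_real q ^ j"
  let ?g = "\<lambda>i. of_real (gauss_coeff (2 * k) i) * z ^ i * (u * of_real q ^ k) ^ (2 * k - i)"
  have n: "2 * k = k + k" by simp
  have "(\<Prod>j<2 * k. u * of_real q ^ k - z * of_real q ^ j)
     = of_real ((-1) ^ k * q ^ (k * (k - 1) div 2)) * ?A * (of_real (q ^ (k * k)) * ?B)"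
    unfolding n prod_lessThan_add prod_reflect prod_shift ..
  then have "?c * (\<Prod>j<2 * k. u * of_real q ^ k - z * of_real q ^ j)
     = of_real (((-1) ^ k / q ^ (k * k)) * ((-1) ^ k * q ^ (k * (k - 1) div 2)) * q ^ (k * k)) * ?A * ?B"
    by (simp only: of_real_mult mult_ac)
  also have "((-1) ^ k / q ^ (k * k)) * ((-1) ^ k * q ^ (k * (k - 1) div 2)) * q ^ (k * k) = q ^ (k * (k - 1) div 2)"
    using qnz by (simp flip: power_mult_distrib)
  finally have 1: "of_real (q ^ (k * (k - 1) div 2)) * ?A * ?B
      = ?c * (of_real (qpoch_q (2 * k)) * (\<Sum>i\<le>2 * k. ?g i))"
    unfolding gauss_binomial by simp
  have "shift_term u z k = of_real (1 / qpoch_q (2 * k)) * (of_real (q ^ (k * (k - 1) div 2)) * ?A * ?B)"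
    unfolding shift_term_def prod.distrib by (simp add: mult_ac)
  also have "\<dots> = ?c * (\<Sum>i\<le>2 * k. ?g i)"
    unfolding 1 using qpoch_q_nz by simp
  also have "\<dots> = (\<Sum>b\<le>k. ?c * ?g (2 * b)) + (\<Sum>b<k. ?c * ?g (Suc (2 * b)))"
    by (simp only: sum_even_odd sum_distrib_left ring_distribs)
  also have "(\<Sum>b\<le>k. ?c * ?g (2 * b)) = (\<Sum>b\<le>k. c_term z b * (of_real (q ^ (k - b)) * c_term u (k - b)))"
  proof (rule sum.cong[OF refl])
    fix b assume "b \<in> {..k}"
    then obtain a where k: "k = a + b" by (metis atMost_iff le_iff_add add.commute)
    have d: "2 * k - 2 * b = 2 * a" "k - b = a" by (auto simp: k)
    have "?c * ?g (2 * b) = of_real ((-1) ^ k / q ^ (k * k) * (gauss_coeff (2 * k) (2 * b) * q ^ (k * (2 * a))))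
       * z ^ (2 * b) * u ^ (2 * a)"
      unfolding d power_mult_distrib power_mult[symmetric] of_real_mult of_real_power by (simp only: mult_ac)
    then show "?c * ?g (2 * b) = c_term z b * (of_real (q ^ (k - b)) * c_term u (k - b))"
      unfolding d even_coeffs(1)[OF k] by (simp add: mult_ac)
  qed
  also have "(\<Sum>b<k. ?c * ?g (Suc (2 * b))) = (\<Sum>b<k. s_term z b * (of_real (q ^ (k - Suc b)) * s_term u (k - Suc b)))"
  proof (rule sum.cong[OF refl])
    fix b assume "b \<in> {..<k}"
    then obtain a where k: "k = Suc (a + b)" by (metis lessThan_iff less_iff_Suc_add add.commute)
    have d: "2 * k - Suc (2 * b) = Suc (2 * a)" "k - Suc b = a" by (auto simp: k)
    have "?c * ?g (Suc (2 * b)) = of_real ((-1) ^ k / q ^ (k * k) * (gauss_coeff (2 * k) (Suc (2 * b)) * q ^ (k * Suc (2 * a))))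
       * z ^ Suc (2 * b) * u ^ Suc (2 * a)"
      unfolding d power_mult_distrib power_mult[symmetric] of_real_mult of_real_power by (simp only: mult_ac)
    then show "?c * ?g (Suc (2 * b)) = s_term z b * (of_real (q ^ (k - Suc b)) * s_term u (k - Suc b))"
      unfolding d even_coeffs(2)[OF k] by (simp add: mult_ac)
  qed
  finally show ?thesis .
qed

section \<open>The q-trigonometric functions\<close>

lemma summable_superexp:
  assumes "0 \<le> M"
  shows "summable (\<lambda>k. q ^ (k * (k - 1) div 2) * M ^ k)"
proof -
  have "(\<lambda>k. q ^ k * M) \<longlonglongrightarrow> 0 * M"
    using q_pos q_less_1 by (intro tendsto_mult LIMSEQ_realpow_zero tendsto_const) auto
  then have "eventually (\<lambda>k. q ^ k * M < 1 / 2) sequentially"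
    by (rule order_tendstoD) simp
  then obtain N where N: "\<And>k. k \<ge> N \<Longrightarrow> q ^ k * M < 1 / 2"
    by (auto simp: eventually_sequentially)
  show ?thesis
  proof (rule summable_ratio_test[of "1/2" N])
    fix k assume "N \<le> k"
    have "q ^ (Suc k * (Suc k - 1) div 2) * M ^ Suc k = (q ^ k * M) * (q ^ (k * (k - 1) div 2) * M ^ k)"
      unfolding tri_Suc power_add by simp
    also have "\<dots> \<le> 1 / 2 * (q ^ (k * (k - 1) div 2) * M ^ k)"
      using N[OF \<open>N \<le> k\<close>] q_pos assms by (intro mult_right_mono) auto
    finally show "norm (q ^ (Suc k * (Suc k - 1) div 2) * M ^ Suc k) \<le> 1 / 2 * norm (q ^ (k * (k - 1) div 2) * M ^ k)"
      using q_pos assms by simp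
  qed simp
qed

lemma inverse_qpoch_q_le: "1 / qpoch_q n \<le> 1 / (1 - q) ^ n"
  using qpoch_q_ge[of n] q_less_1 by (intro divide_left_mono) (auto intro!: mult_pos_pos qpoch_q_pos)

lemma q_power_mono: "m \<le> n \<Longrightarrow> q ^ n \<le> q ^ m"
  using q_pos q_less_1 by (simp add: power_decreasing)

lemma abs_qcos_coeff_le: "\<bar>qcos_coeff k\<bar> \<le> q ^ (k * (k - 1) div 2) * (1 / (1 - q)\<^sup>2) ^ k"
proof -
  have "\<bar>qcos_coeff k\<bar> = q ^ (k * (k - 1)) * (1 / qpoch_q (2 * k))"
    using q_pos qpoch_q_pos[of "2*k"] by (simp add: qcos_coeff_def abs_mult)
  also have "\<dots> \<le> q ^ (k * (k - 1) div 2) * (1 / (1 - q) ^ (2 * k))"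
    using q_pos qpoch_q_pos[of "2*k"] by (intro mult_mono q_power_mono inverse_qpoch_q_le) (auto intro: less_imp_le)
  finally show ?thesis by (simp add: power_mult power_one_over)
qed

lemma abs_qsin_coeff_le: "\<bar>qsin_coeff k\<bar> \<le> 1 / (1 - q) * (q ^ (k * (k - 1) div 2) * (1 / (1 - q)\<^sup>2) ^ k)"
proof -
  have "\<bar>qsin_coeff k\<bar> = q ^ (k * k) * (1 / qpoch_q (Suc (2 * k)))"
    using q_pos qpoch_q_pos[of "Suc (2*k)"] by (simp add: qsin_coeff_def abs_mult)
  also have "k * (k - 1) div 2 \<le> k * k" by (rule order_trans[OF div_le_dividend]) simp
  then have "q ^ (k * k) * (1 / qpoch_q (Suc (2 * k))) \<le> q ^ (k * (k - 1) div 2) * (1 / (1 - q) ^ (Suc (2 * k)))"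
    using q_pos qpoch_q_pos[of "Suc (2*k)"] by (intro mult_mono q_power_mono inverse_qpoch_q_le) (auto intro: less_imp_le)
  finally show ?thesis by (simp add: power_mult power_one_over)
qed

lemma qcos_coeff_summable_norm:
  "summable (\<lambda>k. norm (of_real (qcos_coeff k) * x ^ k :: 'a::{real_normed_field,banach}))"
proof (rule summable_comparison_test'[OF summable_superexp])
  fix k :: nat
  have "norm (norm (of_real (qcos_coeff k) * x ^ k)) = \<bar>qcos_coeff k\<bar> * norm x ^ k"
    by (simp add: norm_mult norm_power)
  also have "\<dots> \<le> (q ^ (k * (k - 1) div 2) * (1 / (1 - q)\<^sup>2) ^ k) * norm x ^ k"
    by (intro mult_right_mono abs_qcos_coeff_le) simp
  finally show "norm (norm (of_real (qcos_coeff k) * x ^ k)) \<le> q ^ (k * (k - 1) div 2) * (1 / (1 - q)\<^sup>2 * norm x) ^ k"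
    by (simp add: power_mult_distrib power_divide)
qed simp

lemma qsin_coeff_summable_norm:
  "summable (\<lambda>k. norm (of_real (qsin_coeff k) * x ^ k :: 'a::{real_normed_field,banach}))"
proof (rule summable_comparison_test'[OF summable_mult[OF summable_superexp]])
  fix k :: nat
  have "norm (norm (of_real (qsin_coeff k) * x ^ k)) = \<bar>qsin_coeff k\<bar> * norm x ^ k"
    by (simp add: norm_mult norm_power)
  also have "\<dots> \<le> 1 / (1 - q) * (q ^ (k * (k - 1) div 2) * (1 / (1 - q)\<^sup>2) ^ k) * norm x ^ k"
    by (intro mult_right_mono abs_qsin_coeff_le) simp
  finally show "norm (norm (of_real (qsin_coeff k) * x ^ k)) \<le> 1 / (1 - q) * (q ^ (k * (k - 1) div 2) * (1 / (1 - q)\<^sup>2 * norm x) ^ k)"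
    by (simp add: power_mult_distrib power_divide)
qed simp

text \<open>
  Analogues of cosine and sine in the sense of the addition formulas \<open>kern_term_sums\<close> and \<open>shift_term_sums\<close>.  They
  will turn out to be \<open>- B\<close> and \<open>D\<close>.
\<close>
definition qcos :: "'a::{real_normed_field,banach} \<Rightarrow> 'a" where "qcos z = (\<Sum>k. c_term z k)"
definition qsin :: "'a::{real_normed_field,banach} \<Rightarrow> 'a" where "qsin z = (\<Sum>k. s_term z k)"

lemma c_term_summable_norm: "summable (\<lambda>k. norm (c_term z k :: 'a::{real_normed_field,banach}))"
  using qcos_coeff_summable_norm[of "z\<^sup>2"] by (simp add: power_mult)

lemma s_term_eq: "s_term z k = z * (of_real (qsin_coeff k) * (z\<^sup>2) ^ k)"
  by (simp add: power_mult)

lemma s_term_summable_norm: "summable (\<lambda>k. norm (s_term z k :: 'a::{real_normed_field,banach}))"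
  unfolding s_term_eq norm_mult[of z] by (rule summable_mult[OF qsin_coeff_summable_norm])

lemma c_term_sums: "c_term z sums qcos (z :: 'a::{real_normed_field,banach})"
  unfolding qcos_def by (rule summable_sums[OF summable_norm_cancel[OF c_term_summable_norm]])
lemma s_term_sums: "s_term z sums qsin (z :: 'a::{real_normed_field,banach})"
  unfolding qsin_def by (rule summable_sums[OF summable_norm_cancel[OF s_term_summable_norm]])

lemma qcos_isCont: "isCont (qcos :: 'a \<Rightarrow> 'a::{real_normed_field,banach}) z"
proof -
  have e: "qcos = (\<lambda>z::'a. \<Sum>k. of_real (qcos_coeff k) * (z\<^sup>2) ^ k)"
    unfolding qcos_def by (simp add: power_mult)
  have "isCont (\<lambda>x::'a. \<Sum>k. of_real (qcos_coeff k) * x ^ k) (z\<^sup>2)"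
    by (rule isCont_powser_converges_everywhere) (rule summable_norm_cancel[OF qcos_coeff_summable_norm])
  then show ?thesis unfolding e
    by (rule isCont_o2[rotated]) (intro continuous_intros)
qed

lemma qsin_isCont: "isCont (qsin :: 'a \<Rightarrow> 'a::{real_normed_field,banach}) z"
proof -
  have e: "qsin = (\<lambda>z::'a. z * (\<Sum>k. of_real (qsin_coeff k) * (z\<^sup>2) ^ k))"
    unfolding qsin_def s_term_eq
    by (rule ext, rule suminf_mult) (rule summable_norm_cancel[OF qsin_coeff_summable_norm])
  have "isCont (\<lambda>x::'a. \<Sum>k. of_real (qsin_coeff k) * x ^ k) (z\<^sup>2)"
    by (rule isCont_powser_converges_everywhere) (rule summable_norm_cancel[OF qsin_coeff_summable_norm])
  then have "isCont (\<lambda>z::'a. \<Sum>k. of_real (qsin_coeff k) * (z\<^sup>2) ^ k) z"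
    by (rule isCont_o2[rotated]) (intro continuous_intros)
  then show ?thesis unfolding e by (intro continuous_intros)
qed

lemma qcos_0: "qcos (0::'a::{real_normed_field,banach}) = 1"
  unfolding qcos_def by (subst suminf_finite[of "{0}"]) (auto simp: qcos_coeff_def qpoch_q_0)

lemma qsin_0: "qsin (0::'a::{real_normed_field,banach}) = 0"
  unfolding qsin_def by simp

lemma qcos_of_real: "qcos (of_real x :: 'a::{real_normed_field,banach}) = of_real (qcos x)"
  using sums_of_real[OF c_term_sums[of x], where 'a = 'a] c_term_sums[of "of_real x :: 'a"]
  by (simp add: sums_unique2)

lemma qsin_of_real: "qsin (of_real x :: 'a::{real_normed_field,banach}) = of_real (qsin x)"
  using sums_of_real[OF s_term_sums[of x], where 'a = 'a] s_term_sums[of "of_real x :: 'a"]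
  by (simp add: sums_unique2)

lemma qsin_odd: "qsin (- z) = - qsin (z::'a::{real_normed_field,banach})"
  using sums_minus[OF s_term_sums[of z]] s_term_sums[of "- z"] by (simp add: sums_unique2)

lemma qcos_cnj: "qcos (cnj z) = cnj (qcos z)"
  using sums_cnj[THEN iffD2, OF c_term_sums[of z]] c_term_sums[of "cnj z"] by (simp add: sums_unique2)

lemma qsin_cnj: "qsin (cnj z) = cnj (qsin z)"
  using sums_cnj[THEN iffD2, OF s_term_sums[of z]] s_term_sums[of "cnj z"] by (simp add: sums_unique2)

lemma r_of_real_mult: "(of_real r * u) ^ (2 * k) = of_real (q ^ k) * (u :: 'a::real_field) ^ (2 * k)"
proof -
  have rr: "(of_real r :: 'a) * of_real r = of_real q"
    unfolding of_real_mult[symmetric] r_sq ..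
  have "(of_real r * u) ^ (2 * k) = ((of_real r * of_real r) * u ^ 2) ^ k"
    unfolding power_mult power2_eq_square by (simp only: mult_ac)
  then show ?thesis unfolding rr power_mult_distrib power_mult by simp
qed

lemma c_term_shift: "c_term (of_real r * u) k = of_real (q ^ k) * c_term (u :: 'a::real_field) k"
  unfolding r_of_real_mult by (simp only: mult_ac)

lemma s_term_shift: "s_term (of_real r * u) k = of_real r * (of_real (q ^ k) * s_term (u :: 'a::real_field) k)"
  unfolding power_Suc r_of_real_mult by (simp only: mult_ac)

text \<open>
  So the zeros of \<open>S_fun q\<close> are those of \<open>D\<close> divided by \<open>r\<close>.
\<close>
lemma S_fun_eq: "S_fun q x = qsin (r * x) / r"
proof -
  have "(\<lambda>k. s_term (r * x) k / r) sums (qsin (r * x) / r)"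
    by (rule sums_divide[OF s_term_sums])
  moreover have "s_term (r * x) k / r = (-1) ^ k * q ^ (k * (k + 1)) / qpoch q q (2 * k + 1) * x ^ (2 * k + 1)" for k
    using s_term_shift[where u = x and k = k] r_pos by (simp add: qsin_coeff_def qpoch_q_def power_add)
  ultimately show ?thesis unfolding S_fun_def by (simp add: sums_iff)
qed

section \<open>Addition formulas\<close>

text \<open>
  The subtraction formula of the q-sine.  It holds because the two sides have the same homogeneous parts.
\<close>
lemma kern_term_sums:
  fixes z w :: "'a::{real_normed_field,banach}"
  shows "(\<lambda>k. (z - w) * kern_term z w k) sums (qsin z * qcos w - qcos z * qsin w)"
proof -
  have 1: "(\<lambda>k. \<Sum>b\<le>k. c_term w b * s_term z (k - b)) sums (qcos w * qsin z)"
    unfolding qcos_def qsin_def by (rule Cauchy_product_sums[OF c_term_summable_norm s_term_summable_norm])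
  have 2: "(\<lambda>k. \<Sum>b\<le>k. s_term w b * c_term z (k - b)) sums (qsin w * qcos z)"
    unfolding qcos_def qsin_def by (rule Cauchy_product_sums[OF s_term_summable_norm c_term_summable_norm])
  show ?thesis unfolding kern_term_expand using sums_diff[OF 1 2] by (simp only: mult_ac)
qed

text \<open>
  The analogue of \<open>cos (z - u) = cos z cos u + sin z sin u\<close>, in which \<open>u\<close> enters with the rescaled argument \<open>r u\<close>.
\<close>
lemma shift_term_sums:
  fixes u z :: "'a::{real_normed_field,banach}"
  shows "shift_term u z sums (qcos z * qcos (of_real r * u) + qsin z * (qsin (of_real r * u) / of_real r))"
proof -
  let ?ch = "\<lambda>k. of_real (q ^ k) * c_term u k" and ?sh = "\<lambda>k. of_real (q ^ k) * s_term u k"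
  have rnz: "(of_real r :: 'a) \<noteq> 0" using r_pos by simp
  have sh: "?sh = (\<lambda>k. s_term (of_real r * u) k / of_real r)"
    using rnz unfolding s_term_shift by simp
  have shs: "?sh sums (qsin (of_real r * u) / of_real r)"
    unfolding sh by (rule sums_divide[OF s_term_sums])
  have shn: "summable (\<lambda>k. norm (?sh k))"
    unfolding fun_cong[OF sh] norm_divide by (rule summable_divide[OF s_term_summable_norm])
  have 1: "(\<lambda>k. \<Sum>b\<le>k. c_term z b * ?ch (k - b)) sums (qcos z * qcos (of_real r * u))"
    unfolding c_term_shift[symmetric] qcos_def by (rule Cauchy_product_sums[OF c_term_summable_norm c_term_summable_norm])
  have "(\<lambda>k. \<Sum>b\<le>k. s_term z b * ?sh (k - b)) sums (qsin z * (qsin (of_real r * u) / of_real r))"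
    using Cauchy_product_sums[OF s_term_summable_norm shn, of z] shs by (simp only: qsin_def[of z] sums_iff)
  then have "(\<lambda>k. \<Sum>b<Suc k. s_term z b * ?sh (Suc k - Suc b)) sums (qsin z * (qsin (of_real r * u) / of_real r))"
    by (simp only: lessThan_Suc_atMost diff_Suc_Suc)
  then have 2: "(\<lambda>k. \<Sum>b<k. s_term z b * ?sh (k - Suc b)) sums (qsin z * (qsin (of_real r * u) / of_real r))"
    by (subst (asm) sums_Suc_iff) simp
  show ?thesis
    using sums_add[OF 1 2] by (simp only: shift_term_expand[abs_def])
qed

lemma zero_fun_eq:
  "zero_fun q u z = qcos z * of_real (qcos (r * u)) + qsin z * of_real (S_fun q u)"
proof -
  have qp: "qpoch (of_real r) (of_real q) k * qpoch (- of_real r) (of_real q) k * qpoch (- of_real q) (of_real q) k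
     * qpoch (of_real q) (of_real q) k = (of_real (qpoch_q (2 * k)) :: complex)" for k
  proof (induction k)
    case 0 show ?case by (simp add: qpoch_q_0 qpoch_def)
  next
    case (Suc k)
    have "(1 - of_real r * of_real q ^ k) * (1 - - of_real r * of_real q ^ k) * (1 - - of_real q * of_real q ^ k) * (1 - of_real q * of_real q ^ k)
       = (1 - (of_real r * of_real r) * (of_real q ^ k * of_real q ^ k)) * (1 - (of_real q * of_real q ^ k) * (of_real q * of_real q ^ k) :: complex)"
      by (simp add: algebra_simps)
    also have "(of_real r * of_real r :: complex) = of_real q"
      unfolding of_real_mult[symmetric] r_sq ..
    also have "(1 - of_real q * (of_real q ^ k * of_real q ^ k)) * (1 - (of_real q * of_real q ^ k) * (of_real q * of_real q ^ k) :: complex)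
      = of_real ((1 - q ^ Suc (2 * k)) * (1 - q ^ Suc (Suc (2 * k))))"
      by (simp add: mult_2 power_add)
    finally show ?case using Suc
      unfolding mult_Suc_right add_2_eq_Suc qpoch_q_Suc
      by (simp add: qpoch_def mult_ac del: power_Suc)
  qed
  have "zero_fun q u z = (\<Sum>k. shift_term (of_real u) z k)"
    unfolding zero_fun_def Let_def shift_term_def qp
  proof (rule arg_cong[where f = suminf], rule ext)
    fix k :: nat
    have m: "(-1) ^ k * (-1) ^ k = (1::complex)" by (simp flip: power_mult_distrib)
    have "1 * A / B * M * C * M = (M * M) * (C / B * A)" for A B C M :: complex by simp
    then show "qpoch 0 (of_real q) k * (\<Prod>j<k. (of_real u - z * of_real q ^ j) * (z - of_real u * of_real q ^ (j + 1)))
        / of_real (qpoch_q (2 * k)) * (-1) ^ k * of_real q ^ (k * (k - 1) div 2) * (-1) ^ k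
      = of_real (q ^ (k * (k - 1) div 2) / qpoch_q (2 * k))
        * (\<Prod>j<k. (of_real u - z * of_real q ^ j) * (z - of_real u * of_real q ^ Suc j))"
      using m by (simp add: qpoch_def)
  qed
  also have "\<dots> = qcos z * qcos (of_real r * of_real u) + qsin z * (qsin (of_real r * of_real u) / of_real r)"
    using shift_term_sums by (rule sums_unique[symmetric])
  finally show ?thesis
    unfolding S_fun_eq of_real_mult[symmetric] qcos_of_real qsin_of_real of_real_divide by simp
qed

section \<open>Limits of the rescaled polynomials\<close>

lemma P_at_0: "P (2 * m) (0::'a::real_field) = of_real ((-1) ^ m * r ^ m)" "P (Suc (2 * m)) (0::'a) = 0"
proof -
  have "P (2 * m) (0::'a) = of_real ((-1) ^ m * r ^ m) \<and> P (Suc (2 * m)) (0::'a) = 0"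
  proof (induction m)
    case (Suc m)
    have h: "P (Suc (Suc n)) (0::'a) = - of_real r * P n 0" for n
      using solves_P[of "0::'a"] unfolding solves_def by simp
    show ?case unfolding mult_Suc_right add_2_eq_Suc h using Suc by simp
  qed simp
  then show "P (2 * m) (0::'a) = of_real ((-1) ^ m * r ^ m)" "P (Suc (2 * m)) (0::'a) = 0" by auto
qed

lemma Q_at_0: "Q (2 * m) (0::'a::real_field) = 0" "Q (Suc (2 * m)) (0::'a) = of_real ((-1) ^ m * r ^ m)"
proof -
  have "Q (2 * m) (0::'a) = 0 \<and> Q (Suc (2 * m)) (0::'a) = of_real ((-1) ^ m * r ^ m)"
  proof (induction m)
    case (Suc m)
    have h: "Q (Suc (Suc n)) (0::'a) = - of_real r * Q n 0" for n
      using solves_Q[of "0::'a"] unfolding solves_def by simp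
    show ?case unfolding mult_Suc_right add_2_eq_Suc h using Suc by simp
  qed simp
  then show "Q (2 * m) (0::'a) = 0" "Q (Suc (2 * m)) (0::'a) = of_real ((-1) ^ m * r ^ m)" by auto
qed

text \<open>
  Along even and odd indices \<open>P\<^sub>n\<close> behaves like \<open>(-1)^m r^m\<close> times a function of \<open>z\<close>; the factor is divided out.
  In this normalization the two polynomials are, up to sign, the approximants of \<open>B\<close> and \<open>D\<close> with even index.
\<close>
definition even_P :: "nat \<Rightarrow> 'a::real_field \<Rightarrow> 'a" where "even_P m z = of_real ((-1) ^ m / r ^ m) * P (2 * m) z"
definition odd_P :: "nat \<Rightarrow> 'a::real_field \<Rightarrow> 'a" where "odd_P m z = of_real ((-1) ^ m / r ^ m) * P (Suc (2 * m)) z"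

lemma r_even_power: "r ^ (2 * m) = q ^ m"
  using q_pos by (simp add: power_mult)

lemma even_P_0: "even_P 0 z = 1" and odd_P_0: "odd_P 0 z = z"
  by (simp_all add: even_P_def odd_P_def)

lemma even_P_Suc: "even_P (Suc m) z = even_P m z - of_real (q ^ m) * z * odd_P m (z::'a::real_field)"
proof -
  have c: "(-1) ^ Suc m / r ^ Suc m * r ^ Suc (2 * m) = - (q ^ m * ((-1) ^ m / r ^ m))"
    using r_pos by (simp add: r_even_power[symmetric] power_add)
  have d: "(-1) ^ Suc m / r ^ Suc m * r = - ((-1) ^ m / r ^ m)"
    using r_pos by simp
  have h: "P (2 * Suc m) z = of_real (r ^ Suc (2 * m)) * z * P (Suc (2 * m)) z - of_real r * P (2 * m) z"
    using solves_P[of z] by (simp add: solves_def)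
  have "even_P (Suc m) z = of_real ((-1) ^ Suc m / r ^ Suc m * r ^ Suc (2 * m)) * z * P (Suc (2 * m)) z
      - of_real ((-1) ^ Suc m / r ^ Suc m * r) * P (2 * m) z"
    unfolding even_P_def of_real_mult h by (simp only: right_diff_distrib mult_ac)
  then show ?thesis unfolding c d even_P_def odd_P_def by (simp add: algebra_simps)
qed

lemma odd_P_Suc: "odd_P (Suc m) z = of_real (q ^ Suc m) * z * even_P (Suc m) z + odd_P m (z::'a::real_field)"
proof -
  have c: "(-1) ^ Suc m / r ^ Suc m * r ^ Suc (Suc (2 * m)) = q ^ Suc m * ((-1) ^ Suc m / r ^ Suc m)"
    unfolding r_even_power[symmetric] by simp
  have d: "(-1) ^ Suc m / r ^ Suc m * r = - ((-1) ^ m / r ^ m)"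
    using r_pos by simp
  have h: "P (Suc (2 * Suc m)) z = of_real (r ^ Suc (Suc (2 * m))) * z * P (2 * Suc m) z - of_real r * P (Suc (2 * m)) z"
    using solves_P[of z] unfolding solves_def mult_Suc_right add_2_eq_Suc by blast
  have "odd_P (Suc m) z = of_real ((-1) ^ Suc m / r ^ Suc m * r ^ Suc (Suc (2 * m))) * z * P (2 * Suc m) z
      - of_real ((-1) ^ Suc m / r ^ Suc m * r) * P (Suc (2 * m)) z"
    unfolding odd_P_def of_real_mult h by (simp only: right_diff_distrib mult_ac)
  then show ?thesis unfolding c d even_P_def odd_P_def by (simp add: algebra_simps)
qed

lemma r_cancel: "1 / r ^ (2 * m) * ((-1) ^ m * r ^ m) = (-1) ^ m / r ^ m"
  using r_pos by (simp add: field_simps power_mult power2_eq_square power_mult_distrib[symmetric] mult_2 power_add)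

lemma casorati_P0_even: "casorati (\<lambda>n. P n z) (\<lambda>n. P n 0) (2 * m) = odd_P m (z::'a::real_field)"
  unfolding casorati_def beta_eq P_at_0 odd_P_def r_cancel[symmetric] of_real_mult by simp

lemma casorati_Q0_even: "casorati (\<lambda>n. P n z) (\<lambda>n. Q n 0) (2 * m) = - even_P m (z::'a::real_field)"
  unfolding casorati_def beta_eq Q_at_0 even_P_def r_cancel[symmetric] of_real_mult by simp

lemma casorati_P0_LIM: "(\<lambda>N. casorati (\<lambda>n. P n z) (\<lambda>n. P n 0) N) \<longlonglongrightarrow> z * kern z (0::'a::{real_normed_field,banach})"
  unfolding casorati_PP by (intro tendsto_mult tendsto_const kern_LIM) simp

lemma casorati_Q0_LIM:
  "(\<lambda>N. casorati (\<lambda>n. P n z) (\<lambda>n. Q n 0) N) \<longlonglongrightarrow> - 1 + z * (\<Sum>k. P k z * Q k (0::'a::{real_normed_field,banach}))"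
proof -
  have "(\<lambda>k. P k z * Q k (0::'a)) sums (\<Sum>k. P k z * Q k (0::'a))"
    by (rule summable_sums[OF summable_norm_cancel[OF bilinear_series_summable[where U = P and V = Q, OF norm_P_le norm_Q_le]]])
  then have "(\<lambda>N. \<Sum>k\<le>N. P k z * Q k (0::'a)) \<longlonglongrightarrow> (\<Sum>k. P k z * Q k (0::'a))"
    by (simp add: sums_def_le)
  then show ?thesis unfolding casorati_PQ diff_0_right by (intro tendsto_add tendsto_mult tendsto_const)
qed

lemma subseq_even: "filterlim (\<lambda>m. 2 * m :: nat) sequentially sequentially"
  by (rule filterlim_subseq) (simp add: strict_mono_def)

text \<open>
  The rescaled polynomials satisfy a recurrence whose step \<open>m\<close> depends only on \<open>q^m z\<close>.  If \<open>(X, Y)\<close> solves the adjoint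
  q-difference equation, then \<open>X (q^m z) p\<^sub>m + Y (q^m z) p'\<^sub>m\<close>, with the even polynomials \<open>p\<^sub>m\<close> and the preceding odd ones
  \<open>p'\<^sub>m\<close>, does not depend on \<open>m\<close>.  It equals \<open>X z\<close> at the start, and in the limit only \<open>X 0\<close> and \<open>Y 0\<close> survive.
\<close>
lemma invariant_limit:
  fixes X Y :: "'a::{real_normed_field,banach} \<Rightarrow> 'a"
  assumes Y: "\<And>w. Y w = Y (of_real q * w) - w * X (of_real q * w)"
    and X: "\<And>w. X w = X (of_real q * w) + w * Y w"
    and cont: "isCont X 0" "isCont Y 0"
    and even_P: "(\<lambda>m. even_P m z) \<longlonglongrightarrow> a" and odd_P: "(\<lambda>m. odd_P m z) \<longlonglongrightarrow> b"
  shows "X z = X 0 * a + Y 0 * b"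
proof -
  let ?y = "\<lambda>m. of_real (q ^ m) * z"
  have inv: "X (?y (Suc m)) * even_P (Suc m) z + Y (?y (Suc m)) * odd_P m z = X z" for m
  proof (induction m)
    case 0
    have "X (?y 1) * even_P 1 z + Y (?y 1) * odd_P 0 z = X (of_real q * z) + z * (Y (of_real q * z) - z * X (of_real q * z))"
      unfolding One_nat_def even_P_Suc[of 0 z] by (simp add: even_P_0 odd_P_0 algebra_simps)
    then show ?case using X[of z] Y[of z] by simp
  next
    case (Suc m)
    define y where "y = ?y (Suc m)"
    have y': "?y (Suc (Suc m)) = of_real q * y" by (simp add: y_def)
    have e: "even_P (Suc (Suc m)) z = even_P (Suc m) z - y * odd_P (Suc m) z"
      and o: "odd_P m z = odd_P (Suc m) z - y * even_P (Suc m) z"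
      using even_P_Suc[of "Suc m" z] odd_P_Suc[of m z] by (simp_all add: y_def)
    have "X y * even_P (Suc m) z + Y y * odd_P m z = X (of_real q * y) * even_P (Suc m) z + Y y * odd_P (Suc m) z"
      unfolding o X[of y] by (simp add: algebra_simps)
    also have "\<dots> = X (of_real q * y) * even_P (Suc m) z + (Y (of_real q * y) - y * X (of_real q * y)) * odd_P (Suc m) z"
      using Y[of y] by simp
    also have "\<dots> = X (of_real q * y) * even_P (Suc (Suc m)) z + Y (of_real q * y) * odd_P (Suc m) z"
      unfolding e by (simp add: algebra_simps)
    finally show ?case
      using Suc unfolding y' y_def[symmetric] by simp
  qed
  have "(\<lambda>m. q ^ Suc m) \<longlonglongrightarrow> 0"
    using q_pos q_less_1 by (intro LIMSEQ_Suc LIMSEQ_realpow_zero) auto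
  then have "(\<lambda>m. ?y (Suc m)) \<longlonglongrightarrow> of_real 0 * z"
    by (intro tendsto_mult tendsto_of_real tendsto_const)
  then have y0: "(\<lambda>m. ?y (Suc m)) \<longlonglongrightarrow> 0" by simp
  have "(\<lambda>m. X (?y (Suc m)) * even_P (Suc m) z + Y (?y (Suc m)) * odd_P m z) \<longlonglongrightarrow> X 0 * a + Y 0 * b"
    by (intro tendsto_add tendsto_mult odd_P LIMSEQ_Suc[OF even_P] isCont_tendsto_compose[OF cont(1) y0] isCont_tendsto_compose[OF cont(2) y0])
  then show ?thesis unfolding inv by (simp add: LIMSEQ_const_iff)
qed

lemma qsin_shift_diff: "qsin w - qsin (of_real q * w) = w * qcos (of_real r * (w::'a::{real_normed_field,banach}))"
proof -
  have "s_term w k - s_term (of_real q * w) k = w * c_term (of_real r * w) k" for k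
  proof -
    have "qsin_coeff k * (1 - q ^ Suc (2 * k)) = qcos_coeff k * q ^ k"
    proof -
      have "q ^ (k * k) = q ^ (k * (k - 1)) * q ^ k"
        unfolding power_add[symmetric] by (cases k) (simp_all add: algebra_simps)
      then show ?thesis using qpoch_q_nz[of "Suc (2 * k)"]
        unfolding qsin_coeff_def qcos_coeff_def qpoch_q_Suc by simp
    qed
    then have "(of_real (qsin_coeff k) :: 'a) * (1 - of_real q ^ Suc (2 * k)) = of_real (qcos_coeff k) * of_real (q ^ k)"
      by (metis of_real_1 of_real_diff of_real_mult of_real_power)
    then have "(of_real (qsin_coeff k) * (1 - of_real q ^ Suc (2 * k))) * w ^ Suc (2 * k) = of_real (qcos_coeff k) * of_real (q ^ k) * w ^ Suc (2 * k)"
      by simp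
    then show ?thesis unfolding r_of_real_mult unfolding power_mult_distrib by (simp add: algebra_simps)
  qed
  then have "(\<lambda>k. w * c_term (of_real r * w) k) sums (qsin w - qsin (of_real q * w))"
    using sums_diff[OF s_term_sums[of w] s_term_sums[of "of_real q * w"]] by simp
  then show ?thesis using sums_mult[OF c_term_sums[of "of_real r * w"], of w] sums_unique2 by blast
qed

lemma qcos_shift_diff: "qcos w - qcos (of_real q * w) = - w * (qsin (of_real r * w) / of_real r)"
  for w :: "'a::{real_normed_field,banach}"
proof -
  have c: "c_term w (Suc k) - c_term (of_real q * w) (Suc k) = - w * (s_term (of_real r * w) k / of_real r)" for k
  proof -
    have "qcos_coeff (Suc k) * (1 - q ^ (2 * Suc k)) = - (qsin_coeff k * q ^ k)"
    proof -
      have "Suc k * (Suc k - 1) = k * k + k" by simp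
      then show ?thesis using qpoch_q_nz[of "Suc (Suc (2 * k))"]
        unfolding qsin_coeff_def qcos_coeff_def mult_Suc_right[of 2] add_2_eq_Suc qpoch_q_Suc
        by (simp add: power_add)
    qed
    then have "(of_real (qcos_coeff (Suc k)) :: 'a) * (1 - of_real q ^ (2 * Suc k)) = - (of_real (qsin_coeff k) * of_real (q ^ k))"
      by (metis of_real_1 of_real_diff of_real_minus of_real_mult of_real_power)
    then have "(of_real (qcos_coeff (Suc k)) * (1 - of_real q ^ (2 * Suc k))) * w ^ (2 * Suc k) = - (of_real (qsin_coeff k) * of_real (q ^ k)) * w ^ (2 * Suc k)"
      by simp
    moreover have "s_term (of_real r * w) k / of_real r = of_real (q ^ k) * s_term w k"
      unfolding s_term_shift using r_pos by simp
    ultimately show ?thesis unfolding power_mult_distrib by (simp add: algebra_simps)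
  qed
  have "(\<lambda>k. c_term w k - c_term (of_real q * w) k) sums (qcos w - qcos (of_real q * w))"
    by (rule sums_diff[OF c_term_sums c_term_sums])
  then have "(\<lambda>k. c_term w (Suc k) - c_term (of_real q * w) (Suc k)) sums (qcos w - qcos (of_real q * w))"
    by (subst sums_Suc_iff) simp
  then have "(\<lambda>k. - w * (s_term (of_real r * w) k / of_real r)) sums (qcos w - qcos (of_real q * w))"
    unfolding c .
  then show ?thesis
    using sums_mult[OF sums_divide[OF s_term_sums[of "of_real r * w"]], of "- w" "of_real r"] sums_unique2 by blast
qed

lemma rr_of_real: "(of_real r :: 'a::real_field) * (of_real r * x) = of_real q * x"
  unfolding mult.assoc[symmetric] of_real_mult[symmetric] r_sq ..

text \<open>
  Existence of the limits is known from the convergence of the kernel series; their values come from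
  \<open>invariant_limit\<close>, applied to the solutions of the q-difference equation with \<open>(X 0, Y 0) = (1, 0)\<close> and \<open>(0, 1)\<close>.
\<close>

lemma
  fixes z :: "'a::{real_normed_field,banach}"
  shows even_P_LIM: "(\<lambda>m. even_P m z) \<longlonglongrightarrow> qcos z" and odd_P_LIM: "(\<lambda>m. odd_P m z) \<longlonglongrightarrow> qsin z"
proof -
  obtain a where "(\<lambda>m. - even_P m z) \<longlonglongrightarrow> a"
    using filterlim_compose[OF casorati_Q0_LIM[of z] subseq_even] unfolding casorati_Q0_even by blast
  then have a: "(\<lambda>m. even_P m z) \<longlonglongrightarrow> - a" using tendsto_minus by fastforce
  obtain b where b: "(\<lambda>m. odd_P m z) \<longlonglongrightarrow> b"
    using filterlim_compose[OF casorati_P0_LIM[of z] subseq_even] unfolding casorati_P0_even by blast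
  have rnz: "(of_real r :: 'a) \<noteq> 0" using r_pos by simp
  have scale: "isCont (\<lambda>w. f (of_real r * w)) (0::'a)" if "\<And>w. isCont f w" for f :: "'a \<Rightarrow> 'a"
    by (rule isCont_o2[OF _ that]) (intro continuous_intros)
  have s2: "qsin (of_real r * w) - qsin (of_real q * (of_real r * w)) = of_real r * w * qcos (of_real q * w)" for w :: 'a
    using qsin_shift_diff[of "of_real r * w"] by (simp add: rr_of_real mult.assoc)
  have "qcos z = qcos 0 * - a + - (qsin (of_real r * 0) / of_real r) * b"
  proof (rule invariant_limit[OF _ _ qcos_isCont _ a b, where Y = "\<lambda>w. - (qsin (of_real r * w) / of_real r)"])
    show "- (qsin (of_real r * w) / of_real r) = - (qsin (of_real r * (of_real q * w)) / of_real r) - w * qcos (of_real q * w)" for w :: 'a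
      using s2[of w] rnz by (simp add: field_simps)
    show "qcos w = qcos (of_real q * w) + w * - (qsin (of_real r * w) / of_real r)" for w :: 'a
      using qcos_shift_diff[of w] by (simp add: algebra_simps)
    show "isCont (\<lambda>w. - (qsin (of_real r * w) / of_real r)) (0::'a)"
      by (intro continuous_intros scale qsin_isCont rnz)
  qed
  then show "(\<lambda>m. even_P m z) \<longlonglongrightarrow> qcos z" using a by (simp add: qcos_0 qsin_0)
  have "qsin z = qsin 0 * - a + qcos (of_real r * 0) * b"
  proof (rule invariant_limit[OF _ _ qsin_isCont _ a b, where Y = "\<lambda>w. qcos (of_real r * w)"])
    show "qcos (of_real r * w) = qcos (of_real r * (of_real q * w)) - w * qsin (of_real q * w)" for w :: 'a
      using qcos_shift_diff[of "of_real r * w", unfolded rr_of_real] rnz by (simp add: field_simps)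
    show "qsin w = qsin (of_real q * w) + w * qcos (of_real r * w)" for w :: 'a
      using qsin_shift_diff[of w] by (simp add: algebra_simps)
    show "isCont (\<lambda>w. qcos (of_real r * w)) (0::'a)"
      by (intro scale qcos_isCont)
  qed
  then show "(\<lambda>m. odd_P m z) \<longlonglongrightarrow> qsin z" using b by (simp add: qcos_0 qsin_0)
qed

lemma qsin_eq_kern: "qsin z = z * kern z (0::'a::{real_normed_field,banach})"
  using filterlim_compose[OF casorati_P0_LIM[of z] subseq_even] unfolding casorati_P0_even
  by (rule LIMSEQ_unique[OF odd_P_LIM])

lemma qcos_eq_series: "- qcos z = - 1 + z * (\<Sum>k. P k z * Q k (0::'a::{real_normed_field,banach}))"
  using filterlim_compose[OF casorati_Q0_LIM[of z] subseq_even] unfolding casorati_Q0_even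
  by (rule LIMSEQ_unique[OF tendsto_minus[OF even_P_LIM]])

lemma casorati_QP_0: "casorati (\<lambda>n. Q n 0) (\<lambda>n. P n (0::'a::real_field)) N = 1"
  unfolding casorati_QP by simp

text \<open>
  The Christoffel-Darboux formula in the limit, with \<open>B = - qcos\<close> and \<open>D = qsin\<close>.
\<close>
lemma kern_trig:
  fixes z w :: "'a::{real_normed_field,banach}"
  shows "(z - w) * kern z w = qsin z * qcos w - qcos z * qsin w"
proof -
  let ?B = "\<lambda>z::'a. casorati (\<lambda>n. P n z) (\<lambda>n. Q n 0)" and ?D = "\<lambda>z::'a. casorati (\<lambda>n. P n z) (\<lambda>n. P n 0)"
  have "(\<lambda>N. ?B z N * ?D w N - ?D z N * ?B w N) \<longlonglongrightarrow> (- qcos z) * qsin w - qsin z * (- qcos w)"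
    unfolding qsin_eq_kern qcos_eq_series by (intro tendsto_diff tendsto_mult casorati_Q0_LIM casorati_P0_LIM)
  moreover have "?B z N * ?D w N - ?D z N * ?B w N = (z - w) * (\<Sum>k\<le>N. P k z * P k w)" for N
    using casorati_pluecker[of "\<lambda>n. P n z" "\<lambda>n. Q n 0" N "\<lambda>n. P n w" "\<lambda>n. P n 0"]
    unfolding casorati_QP_0 casorati_PP[of z w] by simp
  moreover have "(\<lambda>N. (z - w) * (\<Sum>k\<le>N. P k z * P k w)) \<longlonglongrightarrow> (z - w) * kern z w"
    by (intro tendsto_mult tendsto_const kern_LIM)
  ultimately have "(z - w) * kern z w = (- qcos z) * qsin w - qsin z * (- qcos w)"
    by (simp add: LIMSEQ_unique)
  then show ?thesis by simp
qed

section \<open>The weights\<close>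

lemma kern_continuous_left: "isCont (\<lambda>z. kern z w) (z::'a::{real_normed_field,banach})"
proof -
  have c: "isCont (\<lambda>(z, w). kern z w) (z, w)"
    using kern_continuous[where 'a = 'a] by (simp add: continuous_on_eq_continuous_at)
  show ?thesis
    using isCont_o2[where f = "\<lambda>z. (z, w)" and g = "\<lambda>(z, w). kern z w" and a = z] c by simp
qed

lemma norm_kern_term_le:
  fixes z w :: real
  assumes "\<bar>z\<bar> \<le> R" "\<bar>w\<bar> \<le> R"
  shows "\<bar>kern_term z w k\<bar> \<le> 1 / (1 - q) * (q ^ (k * (k - 1) div 2) * ((2 * R)\<^sup>2 / (1 - q)\<^sup>2) ^ k)"
proof -
  have f: "\<bar>x - y * q ^ Suc j\<bar> \<le> 2 * R" if "\<bar>x\<bar> \<le> R" "\<bar>y\<bar> \<le> R" for x y j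
  proof -
    have "\<bar>y * q ^ Suc j\<bar> \<le> \<bar>y\<bar>"
      unfolding abs_mult using q_pos q_less_1 power_le_one[of q "Suc j"]
      by (intro mult_right_le_one_le) (auto simp del: power_Suc)
    then show ?thesis using that by linarith
  qed
  have R: "0 \<le> R" using assms by linarith
  have "\<bar>\<Prod>j<k. (z - w * q ^ Suc j) * (w - z * q ^ Suc j)\<bar> = (\<Prod>j<k. \<bar>z - w * q ^ Suc j\<bar> * \<bar>w - z * q ^ Suc j\<bar>)"
    by (simp add: abs_prod abs_mult)
  also have "\<dots> \<le> (\<Prod>j<k. 2 * R * (2 * R))"
    by (intro prod_mono conjI mult_mono f assms mult_nonneg_nonneg abs_ge_zero) (use R in auto)
  also have "\<dots> = ((2 * R)\<^sup>2) ^ k" by (simp add: power2_eq_square)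
  finally have 1: "\<bar>\<Prod>j<k. (z - w * q ^ Suc j) * (w - z * q ^ Suc j)\<bar> \<le> ((2 * R)\<^sup>2) ^ k" .
  have "\<bar>kern_term z w k\<bar> = q ^ (k * (k - 1) div 2) * (1 / qpoch_q (Suc (2 * k))) * \<bar>\<Prod>j<k. (z - w * q ^ Suc j) * (w - z * q ^ Suc j)\<bar>"
    using q_pos qpoch_q_pos[of "Suc (2 * k)"] unfolding kern_term_def abs_mult by simp
  also have "\<dots> \<le> q ^ (k * (k - 1) div 2) * (1 / (1 - q) ^ Suc (2 * k)) * ((2 * R)\<^sup>2) ^ k"
    using q_pos q_less_1 less_imp_le[OF qpoch_q_pos] by (intro mult_mono 1 inverse_qpoch_q_le order_refl) auto
  also have "\<dots> = 1 / (1 - q) * (q ^ (k * (k - 1) div 2) * ((2 * R)\<^sup>2 / (1 - q)\<^sup>2) ^ k)"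
    unfolding power_divide power_Suc power_mult by simp
  finally show ?thesis .
qed

text \<open>
  For \<open>z \<noteq> x\<close> the two addition formulas give \<open>kern z x = \<Sum>\<^sub>k kern_term z x k\<close> after division by \<open>z - x\<close>.  The diagonal value
  follows since both sides are continuous in \<open>z\<close>.
\<close>
lemma kern_term_diag_sums: "kern_term x x sums kern x (x::real)"
proof -
  define R where "R = \<bar>x\<bar> + 1"
  define T where "T z = (\<Sum>k. kern_term z x k)" for z
  let ?M = "\<lambda>k. 1 / (1 - q) * (q ^ (k * (k - 1) div 2) * ((2 * R)\<^sup>2 / (1 - q)\<^sup>2) ^ k)"
  have sM: "summable ?M" by (intro summable_mult summable_superexp) simp
  have le: "norm (kern_term z x k) \<le> ?M k" if "z \<in> cball 0 R" for z k
    using norm_kern_term_le[of z R x k] that by (simp add: R_def)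
  have "uniform_limit (cball 0 R) (\<lambda>n z. \<Sum>k<n. kern_term z x k) T sequentially"
    unfolding T_def by (rule Weierstrass_m_test[OF le sM])
  then have "continuous_on (cball 0 R) T"
    by (rule uniform_limit_theorem[rotated])
       (auto intro!: always_eventually continuous_intros simp: kern_term_def qpoch_q_nz)
  then have "continuous_on (ball 0 R) T"
    by (rule continuous_on_subset) auto
  then have "isCont T x" by (simp add: continuous_on_eq_continuous_at R_def)
  then have 1: "(T \<longlongrightarrow> T x) (at x)" by (simp add: isCont_def)
  have 2: "((\<lambda>z. kern z x) \<longlongrightarrow> kern x x) (at x)"
    using kern_continuous_left[of x x] by (simp add: isCont_def)
  have eq: "kern z x = T z" if "z \<noteq> x" for z
  proof -
    have "(\<lambda>k. (z - x) * kern_term z x k) sums ((z - x) * kern z x)"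
      using kern_term_sums[of z x] kern_trig[of z x] by simp
    then have "kern_term z x sums kern z x" using that by (simp add: sums_mult_iff)
    then show ?thesis by (simp add: T_def sums_unique)
  qed
  have "eventually (\<lambda>z. kern z x = T z) (at x)" by (simp add: eventually_at_filter eq)
  then have "(T \<longlongrightarrow> kern x x) (at x)" using 2 by (rule Lim_transform_eventually[rotated])
  then have "T x = kern x x" using 1 LIM_unique by blast
  moreover have "summable (kern_term x x)"
    by (rule summable_comparison_test'[OF sM]) (rule le, simp add: R_def)
  ultimately show ?thesis by (simp add: T_def sums_iff)
qed

lemma weight_fun_eq: "weight_fun q x = (1 - q) * kern x x"
proof -
  define t where "t = q powr (3/2)"
  have "t * t = q powr 3" unfolding t_def by (simp flip: powr_add)
  then have tt: "t * t = q ^ 3" using q_pos by (simp add: powr_numeral)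
  have qp: "qpoch t q k * qpoch (- t) q k * qpoch (- q) q k * qpoch q q k = qpoch_q (Suc (2 * k)) / (1 - q)" for k
  proof (induction k)
    case 0 show ?case using q_less_1 by (simp add: qpoch_q_0 qpoch_q_Suc qpoch_def)
  next
    case (Suc k)
    have "(1 - t * q ^ k) * (1 - - t * q ^ k) * (1 - - q * q ^ k) * (1 - q * q ^ k)
       = (1 - (t * t) * (q ^ k * q ^ k)) * (1 - (q * q ^ k) * (q * q ^ k))"
      by (simp add: algebra_simps)
    also have "\<dots> = (1 - q ^ Suc (Suc (2 * k))) * (1 - q ^ Suc (Suc (Suc (2 * k))))"
      unfolding tt by (simp add: mult_2 power_add power3_eq_cube, simp only: mult_ac)
    finally show ?case using Suc
      unfolding mult_Suc_right add_2_eq_Suc qpoch_q_Suc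
      by (simp add: qpoch_def mult_ac del: power_Suc)
  qed
  have t: "qpoch 0 q k * qpoch q q k * qpoch q q k
           / (qpoch t q k * qpoch (- t) q k * qpoch (- q) q k * qpoch q q k)
           * (-1) ^ k * q ^ (k * (k - 1) div 2) * (- (x ^ 2)) ^ k = (1 - q) * kern_term x x k" for k
  proof -
    have "(\<Prod>j<k. (x - x * q ^ Suc j) * (x - x * q ^ Suc j)) = (\<Prod>j<k. x\<^sup>2 * ((1 - q * q ^ j) * (1 - q * q ^ j)))"
      by (simp add: algebra_simps power2_eq_square)
    also have "\<dots> = (x\<^sup>2) ^ k * (qpoch_q k * qpoch_q k)"
      by (simp add: prod.distrib qpoch_q_def qpoch_def)
    finally have p: "(\<Prod>j<k. (x - x * q ^ Suc j) * (x - x * q ^ Suc j)) = (x\<^sup>2) ^ k * (qpoch_q k * qpoch_q k)" .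
    have m: "(- (x ^ 2)) ^ k = (-1) ^ k * (x\<^sup>2) ^ k" by (rule power_minus)
    have "1 * A * A / (B / C) * M * E * (M * X) = (M * M) * (C * (E / B * (X * (A * A))))" for A B C M E X :: real
      by simp
    then show ?thesis
      unfolding qp m kern_term_def of_real_eq_id id_apply p
      using minus_one_sq[of k] by (simp add: qpoch_q_def qpoch_def)
  qed
  have "weight_fun q x = (\<Sum>k. (1 - q) * kern_term x x k)"
    unfolding weight_fun_def phi33_def t_def[symmetric] t ..
  then show ?thesis
    using sums_mult[OF kern_term_diag_sums, of "1 - q" x] by (simp add: sums_iff)
qed

section \<open>Finite quadrature\<close>

lemma P_degree: "coeff (P_poly q n :: 'a::real_field poly) n \<noteq> 0 \<and> (\<forall>m>n. coeff (P_poly q n :: 'a poly) m = 0)"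
proof (induction n rule: less_induct)
  case (less n)
  consider "n = 0" | "n = Suc 0" | m where "n = Suc (Suc m)"
    by (metis not0_implies_Suc)
  then show ?case
  proof cases
    case 2 then show ?thesis by (auto simp: coeff_pCons split: nat.split)
  next
    case 3
    have b: "beta q k \<noteq> 0" for k using beta_pos[OF q_pos, of k] by simp
    show ?thesis using less[of "Suc m"] less[of m] b unfolding 3
      by (auto simp: coeff_pCons split: nat.split)
  qed auto
qed

text \<open>
  The coefficient of highest degree comes from the last polynomial alone.
\<close>
lemma P_independent:
  fixes c :: "nat \<Rightarrow> 'a::real_field"
  assumes "(\<Sum>k\<le>N. smult (c k) (P_poly q k)) = 0" and "k \<le> N"
  shows "c k = 0"
  using assms
proof (induction N)
  case 0 then show ?case by (simp add: smult_one)
next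
  case (Suc N)
  have "coeff (\<Sum>k\<le>Suc N. smult (c k) (P_poly q k)) (Suc N) = c (Suc N) * coeff (P_poly q (Suc N)) (Suc N)"
    using P_degree[where 'a = 'a] by (simp add: coeff_sum del: P_poly.simps)
  then have "c (Suc N) * coeff (P_poly q (Suc N)) (Suc N) = 0"
    by (simp only: Suc.prems(1) coeff_0)
  then have "c (Suc N) = 0" using P_degree[of "Suc N", where 'a = 'a] by simp
  then show ?case using Suc by (auto simp: le_Suc_eq)
qed

lemma P_cnj: "P n (cnj z) = cnj (P n z)"
proof (induction n rule: less_induct)
  case (less n)
  consider "n = 0" | "n = Suc 0" | m where "n = Suc (Suc m)"
    by (metis not0_implies_Suc)
  then show ?case
  proof cases
    case 3
    then show ?thesis using less[of "Suc m"] less[of m] by simp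
  qed simp_all
qed

definition kern_sum :: "nat \<Rightarrow> 'a::real_field \<Rightarrow> 'a \<Rightarrow> 'a" where
  "kern_sum N z w = (\<Sum>k\<le>N. P k z * P k w)"

lemma kern_sum_ge_1: "1 \<le> kern_sum N x (x::real)"
proof -
  have "(\<Sum>k\<in>{0}. P k x * P k x) \<le> kern_sum N x x"
    unfolding kern_sum_def by (rule sum_mono2) auto
  then show ?thesis by simp
qed

lemma kern_sum_cnj: "kern_sum N (cnj z) z \<noteq> 0"
proof -
  have "Re (kern_sum N (cnj z) z) = (\<Sum>k\<le>N. (cmod (P k z))\<^sup>2)"
    unfolding kern_sum_def P_cnj by (simp add: mult.commute complex_mult_cnj cmod_power2)
  also have "\<dots> \<ge> (\<Sum>k\<in>{0}. (cmod (P k z))\<^sup>2)"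
    by (rule sum_mono2) auto
  finally show ?thesis by auto
qed

text \<open>
  Gauss quadrature at the zeros of the quasi-orthogonal polynomial \<open>\<tau> P\<^bsub>N+1\<^esub> - \<sigma> P\<^sub>N\<close>.  The assumption \<open>\<tau> \<noteq> 0\<close>
  makes its degree \<open>N + 1\<close>, so that there are as many nodes as polynomials \<open>P\<^sub>0, \<dots>, P\<^sub>N\<close>.
\<close>

context
  fixes \<tau> \<sigma> :: real and N :: nat
  assumes tau: "\<tau> \<noteq> 0"
begin

definition quasi_poly :: "'a::real_field poly" where
  "quasi_poly = smult (of_real \<tau>) (P_poly q (Suc N)) - smult (of_real \<sigma>) (P_poly q N)"

text \<open>
  At a root \<open>z\<close> the pair of the two coefficients is proportional to \<open>(P\<^sub>N(z), P\<^bsub>N+1\<^esub>(z))\<close>, so the polynomial is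
  proportional to the Casorati determinant with \<open>P(z)\<close>.
\<close>
lemma quasi_poly_kern:
  assumes "poly quasi_poly (z::'a::real_field) = 0"
  shows "P N z * poly quasi_poly w = of_real (\<tau> / beta q N) * ((w - z) * kern_sum N w z)"
proof -
  have b: "beta q N \<noteq> 0" using beta_pos[OF q_pos, of N] by simp
  have z: "of_real \<sigma> * P N z = of_real \<tau> * P (Suc N) z"
    using assms by (simp add: quasi_poly_def del: P_poly.simps)
  have "P N z * poly quasi_poly w = of_real \<tau> * P (Suc N) w * P N z - (of_real \<sigma> * P N z) * P N w"
    by (simp add: quasi_poly_def algebra_simps del: P_poly.simps)
  also have "\<dots> = of_real (\<tau> / beta q N) * casorati (\<lambda>n. P n w) (\<lambda>n. P n z) N"
    unfolding z casorati_def using b by (simp add: algebra_simps del: P_poly.simps)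
  finally show ?thesis unfolding casorati_PP kern_sum_def .
qed

lemma quasi_poly_cnj: "poly quasi_poly (cnj z) = cnj (poly quasi_poly z)"
  by (simp add: quasi_poly_def P_cnj del: P_poly.simps)

lemma quasi_poly_of_real: "poly quasi_poly (of_real x :: 'a::real_field) = of_real (poly quasi_poly x)"
  by (simp add: quasi_poly_def P_of_real del: P_poly.simps)

text \<open>
  With \<open>z\<close> also its conjugate is a root, and \<open>kern_sum\<close> at the pair is a sum of squared moduli.
\<close>
lemma quasi_poly_real_roots:
  assumes "poly quasi_poly (z::complex) = 0" shows "z \<in> \<real>"
proof -
  have "(cnj z - z) * kern_sum N (cnj z) z = 0"
    using quasi_poly_kern[OF assms, of "cnj z"] tau beta_pos[OF q_pos, of N] by (simp add: quasi_poly_cnj assms)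
  then have "cnj z = z" using kern_sum_cnj by simp
  then show ?thesis by (simp add: Reals_cnj_iff)
qed

text \<open>
  The derivative at a root is a nonzero multiple of the kernel on the diagonal.
\<close>
lemma quasi_poly_simple:
  assumes "poly quasi_poly (z::complex) = 0" shows "poly (pderiv quasi_poly) z \<noteq> 0"
proof
  assume d: "poly (pderiv quasi_poly) z = 0"
  let ?K = "\<Sum>k\<le>N. smult (P k z) (P_poly q k)"
  let ?c = "of_real (\<tau> / beta q N) :: complex"
  have "poly (smult (P N z) quasi_poly) w = poly (smult ?c ([:- z, 1:] * ?K)) w" for w
    using quasi_poly_kern[OF assms, of w] unfolding kern_sum_def
    by (simp add: poly_sum algebra_simps del: P_poly.simps)
  then have "smult (P N z) quasi_poly = smult ?c ([:- z, 1:] * ?K)"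
    by (intro poly_eq_poly_eq_iff[THEN iffD1] ext)
  then have "poly (pderiv (smult (P N z) quasi_poly)) z = poly (pderiv (smult ?c ([:- z, 1:] * ?K))) z"
    by simp
  then have "0 = ?c * poly ?K z"
    by (simp add: d pderiv_smult pderiv_mult pderiv_pCons del: mult_pCons_left)
  moreover have "poly ?K z = kern_sum N (cnj z) z"
    using quasi_poly_real_roots[OF assms] unfolding Reals_cnj_iff kern_sum_def by (simp add: poly_sum)
  ultimately show False
    using kern_sum_cnj[of N z] tau beta_pos[OF q_pos, of N] by simp
qed

definition nodes :: "real set" where "nodes = {x. poly quasi_poly x = 0}"

lemma quasi_poly_degree: "degree (quasi_poly :: 'a::real_field poly) = Suc N"
proof (rule antisym)
  have c: "coeff (P_poly q n :: 'a poly) m = 0" if "n < m" for n m using P_degree that by blast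
  show "degree (quasi_poly :: 'a poly) \<le> Suc N"
    by (rule degree_le) (auto simp: quasi_poly_def c simp del: P_poly.simps)
  have "coeff (quasi_poly :: 'a poly) (Suc N) \<noteq> 0"
    using P_degree[of "Suc N", where 'a = 'a] tau by (simp add: quasi_poly_def c del: P_poly.simps)
  then show "Suc N \<le> degree (quasi_poly :: 'a poly)" by (rule le_degree)
qed

lemma quasi_poly_nz: "quasi_poly \<noteq> (0 :: 'a::real_field poly)"
  using quasi_poly_degree[where 'a = 'a] by auto

lemma finite_nodes: "finite nodes"
  unfolding nodes_def by (rule poly_roots_finite[OF quasi_poly_nz])

lemma card_nodes: "card nodes = Suc N"
proof -
  let ?Z = "{z::complex. poly quasi_poly z = 0}"
  have "rsquarefree (quasi_poly :: complex poly)"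
    unfolding rsquarefree_roots using quasi_poly_simple by blast
  then have "smult (lead_coeff quasi_poly) (\<Prod>z\<in>?Z. [:-z, 1:]) = (quasi_poly :: complex poly)"
    by (rule complex_poly_decompose_rsquarefree)
  then have "degree (quasi_poly :: complex poly) = degree (\<Prod>z\<in>?Z. [:-z, 1:])"
    using quasi_poly_nz[where 'a = complex] by (metis degree_smult_eq leading_coeff_0_iff)
  also have "\<dots> = card ?Z" by (subst degree_prod_sum_eq) auto
  finally have "card ?Z = Suc N" by (simp add: quasi_poly_degree)
  moreover have "?Z = of_real ` nodes"
  proof (intro equalityI subsetI)
    fix z assume z: "z \<in> ?Z"
    then obtain x where "z = of_real x" using quasi_poly_real_roots by (auto elim: Reals_cases)
    then show "z \<in> of_real ` nodes" using z by (simp add: nodes_def quasi_poly_of_real)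
  qed (auto simp: nodes_def quasi_poly_of_real)
  ultimately show ?thesis by (simp add: card_image inj_on_def)
qed

lemma nodes_kern_sum:
  assumes "x \<in> nodes" "y \<in> nodes" "x \<noteq> y" shows "kern_sum N x y = 0"
  using quasi_poly_kern[of y x] assms tau beta_pos[OF q_pos, of N] by (simp add: nodes_def)

text \<open>
  The kernel reproduces \<open>P\<^sub>l\<close> at the \<open>N + 1\<close> nodes, hence identically, since both sides have degree at most \<open>N\<close>.
  Comparing the coefficients with respect to the \<open>P\<^sub>m\<close> gives the quadrature formula.
\<close>
lemma nodes_orthogonal:
  assumes "l \<le> N" "m \<le> N"
  shows "(\<Sum>x\<in>nodes. P l x * P m x / kern_sum N x x) = (if l = m then 1 else 0)"
proof -
  define c where "c k = (if k = l then 1 else 0) - (\<Sum>x\<in>nodes. P l x * P k x / kern_sum N x x)" for k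
  define g where "g = (\<Sum>k\<le>N. smult (c k) (P_poly q k :: real poly))"
  have "poly g y = 0" if y: "y \<in> nodes" for y
  proof -
    have "poly g y = (\<Sum>k\<le>N. (if k = l then P k y else 0) - (\<Sum>x\<in>nodes. P l x * P k x / kern_sum N x x) * P k y)"
      unfolding g_def c_def poly_sum poly_smult by (rule sum.cong) (auto simp: algebra_simps)
    also have "\<dots> = P l y - (\<Sum>k\<le>N. \<Sum>x\<in>nodes. P l x * P k x / kern_sum N x x * P k y)"
      using assms by (simp add: sum_subtractf sum_distrib_right)
    also have "(\<Sum>k\<le>N. \<Sum>x\<in>nodes. P l x * P k x / kern_sum N x x * P k y)
        = (\<Sum>x\<in>nodes. P l x / kern_sum N x x * kern_sum N x y)"
      unfolding kern_sum_def[of N _ y] sum_distrib_left by (subst sum.swap) (simp add: mult_ac)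
    also have "\<dots> = (\<Sum>x\<in>{y}. P l x / kern_sum N x x * kern_sum N x y)"
      using y nodes_kern_sum by (intro sum.mono_neutral_right finite_nodes) auto
    also have "\<dots> = P l y" using kern_sum_ge_1[of N y] by simp
    finally show ?thesis by simp
  qed
  then have sub: "nodes \<subseteq> {y. poly g y = 0}" by blast
  have "g = 0"
  proof (rule ccontr)
    assume g: "g \<noteq> 0"
    have "Suc N \<le> card {y. poly g y = 0}"
      unfolding card_nodes[symmetric] by (rule card_mono[OF poly_roots_finite[OF g] sub])
    also have "\<dots> \<le> degree g" by (rule card_poly_roots_bound[OF g])
    also have "\<dots> \<le> N"
      unfolding g_def using P_degree[where 'a = real]
      by (intro degree_le allI impI) (simp add: coeff_sum)
    finally show False by simp
  qed
  then have "c m = 0" using P_independent[of c N m] assms by (simp add: g_def)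
  then show ?thesis by (auto simp: c_def split: if_splits)
qed

end

section \<open>Zero sets and the Bessel inequality\<close>

definition zeros :: "real \<Rightarrow> real \<Rightarrow> real set" where
  "zeros a b = {x. a * qcos x + b * qsin x = 0}"

text \<open>
  At two zeros of the same combination the vectors \<open>(qcos, qsin)\<close> are proportional.
\<close>
lemma zeros_kern:
  assumes "(a, b) \<noteq> (0, 0)" "x \<in> zeros a b" "y \<in> zeros a b" "x \<noteq> y"
  shows "kern x y = 0"
proof -
  let ?d = "qsin x * qcos y - qcos x * qsin y"
  have x: "a * qcos x = - (b * qsin x)" "b * qsin x = - (a * qcos x)"
    and y: "a * qcos y = - (b * qsin y)" "b * qsin y = - (a * qcos y)"
    using assms(2,3) by (auto simp: zeros_def)
  have "a * ?d = qsin x * (a * qcos y) - (a * qcos x) * qsin y" by (simp add: algebra_simps)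
  also have "\<dots> = 0" unfolding x(1) y(1) by simp
  finally have "a * ?d = 0" .
  moreover have "b * ?d = (b * qsin x) * qcos y - qcos x * (b * qsin y)" by (simp add: algebra_simps)
  then have "b * ?d = 0" unfolding x(2) y(2) by simp
  ultimately have "?d = 0" using assms(1) by auto
  then show ?thesis using kern_trig[of x y] assms(4) by simp
qed

text \<open>
  The squared distance in \<open>\<ell>\<^sup>2\<close> of the \<open>n\<close>-th unit vector from its projection onto the span of the orthogonal
  vectors \<open>(P\<^sub>k(x))\<^sub>k\<close>, \<open>x \<in> F\<close>.
\<close>
lemma bessel_identity:
  assumes ab: "(a, b) \<noteq> (0, 0)" and F: "finite F" "F \<subseteq> zeros a b"
  shows "(\<lambda>k. ((if k = n then 1 else 0) - (\<Sum>x\<in>F. P n x * P k x / kern x x))\<^sup>2)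
    sums (1 - (\<Sum>x\<in>F. (P n x)\<^sup>2 / kern x x))"
proof -
  let ?g = "\<lambda>k. \<Sum>x\<in>F. P n x * P k x / kern x x"
  have nz: "kern x x \<noteq> 0" for x :: real using kern_diag_ge_1[of x] by simp
  have 1: "(\<lambda>k. if k = n then 1 - 2 * ?g k else 0) sums (1 - 2 * ?g n)"
    by (rule sums_single)
  have "(\<lambda>k. \<Sum>x\<in>F. \<Sum>y\<in>F. (P n x / kern x x * (P n y / kern y y)) * (P k x * P k y))
     sums (\<Sum>x\<in>F. \<Sum>y\<in>F. (P n x / kern x x * (P n y / kern y y)) * kern x y)"
    by (intro sums_sum sums_mult kern_sums)
  also have "(\<lambda>k. \<Sum>x\<in>F. \<Sum>y\<in>F. (P n x / kern x x * (P n y / kern y y)) * (P k x * P k y)) = (\<lambda>k. (?g k)\<^sup>2)"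
    unfolding power2_eq_square sum_product by (simp add: mult_ac)
  also have "(\<Sum>x\<in>F. \<Sum>y\<in>F. (P n x / kern x x * (P n y / kern y y)) * kern x y) = ?g n"
  proof (rule sum.cong[OF refl])
    fix x assume x: "x \<in> F"
    have "(\<Sum>y\<in>F. (P n x / kern x x * (P n y / kern y y)) * kern x y)
       = (\<Sum>y\<in>{x}. (P n x / kern x x * (P n y / kern y y)) * kern x y)"
      using F x zeros_kern[OF ab] by (intro sum.mono_neutral_right) auto
    then show "(\<Sum>y\<in>F. (P n x / kern x x * (P n y / kern y y)) * kern x y) = P n x * P n x / kern x x"
      using nz by simp
  qed
  finally have 2: "(\<lambda>k. (?g k)\<^sup>2) sums ?g n" .
  have "((if k = n then 1 else 0) - ?g k)\<^sup>2 = (if k = n then 1 - 2 * ?g k else 0) + (?g k)\<^sup>2" for k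
    by (simp add: power2_diff)
  then show ?thesis using sums_add[OF 1 2] by (simp add: power2_eq_square)
qed

lemma bessel:
  assumes "(a, b) \<noteq> (0, 0)" "finite F" "F \<subseteq> zeros a b"
  shows "(\<Sum>x\<in>F. (P n x)\<^sup>2 / kern x x) \<le> 1"
  using sums_le[OF _ sums_zero bessel_identity[OF assms, of n]] by simp

lemma bessel_0:
  assumes "(a, b) \<noteq> (0, 0)" "finite F" "F \<subseteq> zeros a b"
  shows "(\<Sum>x\<in>F. 1 / kern x x) \<le> 1"
  using bessel[OF assms, of 0] by simp

lemma kern_diag_bounded: "\<exists>M\<ge>1. \<forall>x. \<bar>x\<bar> \<le> R \<longrightarrow> kern x (x::real) \<le> M"
proof -
  have "continuous_on {-R..R} (\<lambda>x::real. kern x x)"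
    using continuous_on_compose2[OF kern_continuous, of "{-R..R}" "\<lambda>x. (x, x)"] by (simp add: continuous_intros)
  then have "bounded ((\<lambda>x. kern x x) ` {-R..R})"
    by (intro compact_imp_bounded compact_continuous_image) auto
  then obtain M where "\<forall>x\<in>{-R..R}. \<bar>kern x x\<bar> \<le> M" by (auto simp: bounded_iff)
  then have "kern x x \<le> max M 1" if "\<bar>x\<bar> \<le> R" for x
    using that by (force simp: abs_le_iff le_max_iff_disj)
  then show ?thesis by (intro exI[of _ "max M 1"]) auto
qed

text \<open>
  On a bounded interval the weights \<open>1 / kern x x\<close> are bounded below, while their sum is at most \<open>1\<close>.
\<close>
lemma zeros_locally_finite:
  assumes "(a, b) \<noteq> (0, 0)" shows "finite (zeros a b \<inter> {-R..R})"
proof -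
  obtain M where M: "M \<ge> 1" "\<And>x::real. \<bar>x\<bar> \<le> R \<Longrightarrow> kern x x \<le> M" using kern_diag_bounded by blast
  have "finite (zeros a b \<inter> {-R..R}) \<and> card (zeros a b \<inter> {-R..R}) \<le> nat \<lfloor>M\<rfloor>"
  proof (rule finite_if_finite_subsets_card_bdd)
    fix G assume G: "G \<subseteq> zeros a b \<inter> {-R..R}" "finite G"
    have "real (card G) * (1 / M) = (\<Sum>x\<in>G. 1 / M)" by simp
    also have "\<dots> \<le> (\<Sum>x\<in>G. 1 / kern x x)"
    proof (rule sum_mono)
      fix x assume "x \<in> G"
      then have "kern x x \<le> M" using G M(2)[of x] by (auto simp: abs_le_iff)
      then show "1 / M \<le> 1 / kern x x" using kern_diag_ge_1[of x] by (intro divide_left_mono) auto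
    qed
    also have "\<dots> \<le> 1" using G by (intro bessel_0[OF assms]) auto
    finally have "real (card G) \<le> M" using M(1) by (simp add: field_simps)
    then show "card G \<le> nat \<lfloor>M\<rfloor>" by (simp add: le_nat_iff le_floor_iff)
  qed
  then show ?thesis ..
qed

section \<open>Completeness of the kernels at the zeros\<close>

lemma uniform_limit_at_0:
  fixes U V :: "nat \<Rightarrow> 'a::{real_normed_field,banach} \<Rightarrow> 'a"
  assumes lim: "uniform_limit (cball 0 R \<times> cball 0 R) (\<lambda>N (z, w). \<Sum>k\<le>N. U k z * V k w)
       (\<lambda>(z, w). \<Sum>k. U k z * V k w) sequentially" and R: "0 \<le> R"
  shows "uniform_limit (cball 0 R) (\<lambda>N z. c + z * (\<Sum>k\<le>N. U k z * V k 0))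
       (\<lambda>z. c + z * (\<Sum>k. U k z * V k 0)) sequentially"
proof (rule uniform_limitI)
  fix e :: real assume e: "0 < e"
  then have "0 < e / (R + 1)" using R by simp
  from uniform_limitD[OF lim this] show "\<forall>\<^sub>F n in sequentially. \<forall>z\<in>cball 0 R.
      dist (c + z * (\<Sum>k\<le>n. U k z * V k 0)) (c + z * (\<Sum>k. U k z * V k 0)) < e"
  proof eventually_elim
    case (elim n)
    show ?case
    proof
      fix z :: 'a assume z: "z \<in> cball 0 R"
      have d: "norm ((\<Sum>k\<le>n. U k z * V k 0) - (\<Sum>k. U k z * V k 0)) < e / (R + 1)"
        using elim z R by (auto simp: dist_norm)
      have "dist (c + z * (\<Sum>k\<le>n. U k z * V k 0)) (c + z * (\<Sum>k. U k z * V k 0))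
         = norm z * norm ((\<Sum>k\<le>n. U k z * V k 0) - (\<Sum>k. U k z * V k 0))"
        by (simp add: dist_norm norm_mult[symmetric] right_diff_distrib)
      also have "\<dots> \<le> R * (e / (R + 1))"
        using z d R by (intro mult_mono) auto
      also have "\<dots> < e" using R e by (simp add: field_simps)
      finally show "dist (c + z * (\<Sum>k\<le>n. U k z * V k 0)) (c + z * (\<Sum>k. U k z * V k 0)) < e" .
    qed
  qed
qed

lemma casorati_uniform_limit:
  fixes R :: real assumes R: "0 \<le> R"
  shows "uniform_limit (cball 0 R) (\<lambda>N z. casorati (\<lambda>n. P n z) (\<lambda>n. P n 0) N) (qsin :: 'a \<Rightarrow> 'a::{real_normed_field,banach}) sequentially"
    and "uniform_limit (cball 0 R) (\<lambda>N z. - casorati (\<lambda>n. P n z) (\<lambda>n. Q n 0) N) (qcos :: 'a \<Rightarrow> 'a) sequentially"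
proof -
  have "qsin = (\<lambda>z::'a. 0 + z * (\<Sum>k. P k z * P k 0))"
    by (simp add: fun_eq_iff qsin_eq_kern kern_def)
  moreover have "(\<lambda>N z::'a. casorati (\<lambda>n. P n z) (\<lambda>n. P n 0) N) = (\<lambda>N z. 0 + z * (\<Sum>k\<le>N. P k z * P k 0))"
    unfolding casorati_PP by simp
  ultimately show "uniform_limit (cball 0 R) (\<lambda>N z. casorati (\<lambda>n. P n z) (\<lambda>n. P n 0) N) (qsin :: 'a \<Rightarrow> 'a) sequentially"
    using uniform_limit_at_0[where U = P and V = P, OF bilinear_series_uniform_limit[where U = P and V = P, OF norm_P_le norm_P_le] R, of 0] by simp
  have "(\<lambda>z. - qcos z) = (\<lambda>z::'a. - 1 + z * (\<Sum>k. P k z * Q k 0))"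
    by (rule ext) (rule qcos_eq_series)
  moreover have "(\<lambda>N z::'a. casorati (\<lambda>n. P n z) (\<lambda>n. Q n 0) N) = (\<lambda>N z. - 1 + z * (\<Sum>k\<le>N. P k z * Q k 0))"
    unfolding casorati_PQ by simp
  ultimately have "uniform_limit (cball 0 R) (\<lambda>N z. casorati (\<lambda>n. P n z) (\<lambda>n. Q n 0) N) (\<lambda>z::'a. - qcos z) sequentially"
    using uniform_limit_at_0[where U = P and V = Q, OF bilinear_series_uniform_limit[where U = P and V = Q, OF norm_P_le norm_Q_le] R, of "- 1"] by simp
  from uniform_limit_uminus[OF this]
  show "uniform_limit (cball 0 R) (\<lambda>N z. - casorati (\<lambda>n. P n z) (\<lambda>n. Q n 0) N) (qcos :: 'a \<Rightarrow> 'a) sequentially"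
    by simp
qed

text \<open>
  The finite approximants of \<open>a qcos + b qsin\<close>, built from those of \<open>- B\<close> and \<open>D\<close>.
\<close>
definition approx_fun :: "real \<Rightarrow> real \<Rightarrow> nat \<Rightarrow> real \<Rightarrow> real" where
  "approx_fun a b N x = a * - casorati (\<lambda>n. P n x) (\<lambda>n. Q n 0) N + b * casorati (\<lambda>n. P n x) (\<lambda>n. P n 0) N"

lemma approx_fun_uniform_limit:
  assumes "0 \<le> R"
  shows "uniform_limit (cball 0 R) (approx_fun a b) (\<lambda>x. a * qcos x + b * qsin x) sequentially"
  unfolding approx_fun_def[abs_def]
  by (intro uniform_limit_add uniform_limit_intros casorati_uniform_limit[OF assms])

text \<open>
  The parity of the index is chosen so that the coefficient \<open>\<tau> = b P\<^sub>N(0) - a Q\<^sub>N(0)\<close> of \<open>P\<^bsub>N+1\<^esub>\<close> does not vanish.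
  Total mass and second moment of the rule enter the tail estimate in \<open>weights_complete\<close>.
\<close>
lemma approx_nodes:
  assumes ab: "(a, b) \<noteq> (0, 0)"
  defines "idx \<equiv> (\<lambda>n::nat. if b = 0 then Suc (2 * n) else 2 * n)"
  assumes n: "n > 0"
  shows "\<exists>X. finite X \<and> (\<forall>x\<in>X. approx_fun a b (idx n) x = 0)
     \<and> (\<forall>x\<in>X. \<forall>y\<in>X. x \<noteq> y \<longrightarrow> kern_sum (idx n) x y = 0)
     \<and> (\<Sum>x\<in>X. 1 / kern_sum (idx n) x x) = 1 \<and> (\<Sum>x\<in>X. x\<^sup>2 / kern_sum (idx n) x x) = 1"
proof -
  define N where "N = idx n"
  define t where "t = b * P N 0 - a * Q N 0"
  define u where "u = b * P (Suc N) 0 - a * Q (Suc N) 0"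
  have t: "t \<noteq> 0"
    using ab r_pos q_pos unfolding t_def N_def idx_def
    by (auto simp: P_at_0 Q_at_0 simp del: P_poly.simps Q_poly.simps)
  have N: "1 \<le> N" using n by (simp add: N_def idx_def)
  have "approx_fun a b N x = beta q N * poly (quasi_poly t u N) x" for x
    unfolding approx_fun_def casorati_def quasi_poly_def[OF t] unfolding t_def u_def
    by (simp add: algebra_simps del: P_poly.simps Q_poly.simps)
  then have z: "approx_fun a b N x = 0" if "x \<in> nodes t u N" for x
    using that unfolding nodes_def[OF t] by simp
  show ?thesis unfolding N_def[symmetric]
    using finite_nodes[OF t] z nodes_kern_sum[OF t] nodes_orthogonal[OF t, of 0 N 0] nodes_orthogonal[OF t, of 1 N 1] N
    by (intro exI[of _ "nodes t u N"]) (auto simp: power2_eq_square)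
qed

lemma isCont_trig: "isCont (\<lambda>x::real. a * qcos x + b * qsin x) x"
  by (intro continuous_intros qcos_isCont qsin_isCont)

lemma kern_sum_LIM_uniform:
  "uniform_limit (cball 0 R \<times> cball 0 R) (\<lambda>N (z, w). kern_sum N z w) (\<lambda>(z, w). kern z (w::real)) sequentially"
  unfolding kern_sum_def by (rule kern_uniform_limit)

lemma idx_filterlim: "filterlim (\<lambda>n::nat. if c then Suc (2 * n) else 2 * n) sequentially sequentially"
  by (cases c) (auto intro!: filterlim_subseq simp: strict_mono_def)

text \<open>
  Fix a large interval.  The nodes outside it carry little mass, by the second moment.  For a large index each node inside
  is close to a zero, because the limit function is bounded away from \<open>0\<close> elsewhere.  Two nodes cannot be
  close to the same zero: \<open>kern_sum\<close> vanishes at two distinct nodes but is positive near the diagonal.  So the mass of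
  the nodes inside is at most that of the zeros, up to a small error.
\<close>
lemma weights_complete:
  assumes ab: "(a, b) \<noteq> (0, 0)" and e: "0 < e"
  shows "\<exists>F. finite F \<and> F \<subseteq> zeros a b \<and> 1 - e \<le> (\<Sum>x\<in>F. 1 / kern x x)"
proof -
  let ?f = "\<lambda>x::real. a * qcos x + b * qsin x"
  define idx where "idx = (\<lambda>n::nat. if b = 0 then Suc (2 * n) else 2 * n)"
  have idx: "filterlim idx sequentially sequentially" unfolding idx_def by (rule idx_filterlim)
  \<comment> \<open>\<open>\<rho>\<close> bounds the interval; nodes outside carry mass at most \<open>1 / \<rho>\<^sup>2\<close>.\<close>
  obtain \<rho> :: real where rho: "1 \<le> \<rho>" "1 / \<rho>\<^sup>2 \<le> e / 2"
  proof
    show "1 \<le> max 1 (2 / e)" by simp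
    have "2 / e \<le> max 1 (2 / e) * 1" by simp
    also have "\<dots> \<le> (max 1 (2 / e))\<^sup>2" unfolding power2_eq_square by (intro mult_left_mono) auto
    finally have "1 / (max 1 (2 / e))\<^sup>2 \<le> 1 / (2 / e)" using e by (intro divide_left_mono) auto
    then show "1 / (max 1 (2 / e))\<^sup>2 \<le> e / 2" using e by simp
  qed
  define J where "J = cball (0::real) (\<rho> + 1)"
  define F where "F = zeros a b \<inter> {- (\<rho> + 1)..\<rho> + 1}"
  have F: "finite F" "F \<subseteq> zeros a b" "F \<subseteq> J"
    unfolding F_def J_def by (rule zeros_locally_finite[OF ab]) auto
  define \<eta> where "\<eta> = min (1 / 2) (e / (2 * (card F + 1)))"
  have eta: "0 < \<eta>" "\<eta> \<le> 1 / 2" "\<eta> * card F \<le> e / 2"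
  proof -
    show "0 < \<eta>" using e by (auto simp: \<eta>_def)
    show "\<eta> \<le> 1 / 2" unfolding \<eta>_def by (rule min.cobounded1)
    have "\<eta> * card F \<le> e / (2 * (card F + 1)) * card F" by (intro mult_right_mono) (auto simp: \<eta>_def)
    also have "\<dots> \<le> e / 2" using e by (simp add: field_simps)
    finally show "\<eta> * card F \<le> e / 2" .
  qed
  have "uniformly_continuous_on (J \<times> J) (\<lambda>(x, y). kern x (y::real))"
    unfolding J_def by (intro compact_uniformly_continuous compact_Times compact_cball continuous_on_subset[OF kern_continuous]) auto
  then obtain d where d: "0 < d" "\<And>x y x' y'. \<lbrakk>x \<in> J; y \<in> J; x' \<in> J; y' \<in> J; dist (x', y') (x, y) < d\<rbrakk>
      \<Longrightarrow> \<bar>kern x' y' - kern x y\<bar> < \<eta> / 2"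
    unfolding uniformly_continuous_on_def using eta(1)
    by (metis (mono_tags, lifting) SigmaI case_prod_conv dist_real_def half_gt_zero)
  define \<delta> where "\<delta> = min (d / 2) 1"
  have delta: "0 < \<delta>" "2 * \<delta> \<le> d" "\<delta> \<le> 1" using d(1) by (auto simp: \<delta>_def)
  \<comment> \<open>the part of the interval that stays away from the zeros\<close>
  define J0 where "J0 = cball (0::real) \<rho> - (\<Union>l\<in>zeros a b. ball l \<delta>)"
  have "compact J0" unfolding J0_def by (intro compact_diff compact_cball open_UN) auto
  moreover have "continuous_on J0 ?f"
    by (intro continuous_at_imp_continuous_on ballI isCont_trig)
  ultimately obtain c where c: "0 < c" "\<And>x. x \<in> J0 \<Longrightarrow> c \<le> \<bar>?f x\<bar>"
  proof (cases "J0 = {}")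
    case True then show ?thesis using that[of 1] by auto
  next
    case False
    have "continuous_on J0 (\<lambda>x. \<bar>?f x\<bar>)" by (intro continuous_on_rabs) fact
    then obtain x0 where x0: "x0 \<in> J0" "\<And>x. x \<in> J0 \<Longrightarrow> \<bar>?f x0\<bar> \<le> \<bar>?f x\<bar>"
      using continuous_attains_inf[OF \<open>compact J0\<close> False] by blast
    have "?f x0 \<noteq> 0"
    proof
      assume "?f x0 = 0"
      then have "x0 \<in> zeros a b" by (simp add: zeros_def)
      then have "x0 \<in> (\<Union>l\<in>zeros a b. ball l \<delta>)" using delta(1) by (intro UN_I[of x0]) auto
      then show False using x0(1) by (simp add: J0_def)
    qed
    then show ?thesis using that[of "\<bar>?f x0\<bar>"] x0 by auto
  qed
  have 1: "\<forall>\<^sub>F n in sequentially. \<forall>x\<in>cball 0 \<rho>. dist (approx_fun a b (idx n) x) (?f x) < c"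
    by (rule uniform_limitD[OF filterlim_compose[OF approx_fun_uniform_limit idx] c(1)]) (use rho in simp)
  have 2: "\<forall>\<^sub>F n in sequentially. \<forall>p\<in>J \<times> J. dist (case p of (z, w) \<Rightarrow> kern_sum (idx n) z w) (case p of (z, w) \<Rightarrow> kern z w) < \<eta> / 2"
    unfolding J_def by (rule uniform_limitD[OF filterlim_compose[OF kern_sum_LIM_uniform idx]]) (use eta in simp)
  have "\<forall>\<^sub>F n in sequentially. n > (0::nat)" by (rule eventually_gt_at_top)
  with 1 2 have "\<forall>\<^sub>F n in sequentially. n > 0 \<and> (\<forall>x\<in>cball 0 \<rho>. dist (approx_fun a b (idx n) x) (?f x) < c)
     \<and> (\<forall>p\<in>J \<times> J. dist (case p of (z, w) \<Rightarrow> kern_sum (idx n) z w) (case p of (z, w) \<Rightarrow> kern z w) < \<eta> / 2)"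
    by eventually_elim simp
  then obtain n where n: "n > 0" "\<And>x. x \<in> cball 0 \<rho> \<Longrightarrow> \<bar>approx_fun a b (idx n) x - ?f x\<bar> < c"
     "\<And>x y. x \<in> J \<Longrightarrow> y \<in> J \<Longrightarrow> \<bar>kern_sum (idx n) x y - kern x y\<bar> < \<eta> / 2"
    by (auto simp: eventually_sequentially dist_real_def)
  let ?K = "kern_sum (idx n) :: real \<Rightarrow> real \<Rightarrow> real"
  obtain X where X: "finite X" "\<And>x. x \<in> X \<Longrightarrow> approx_fun a b (idx n) x = 0"
     "\<And>x y. \<lbrakk>x \<in> X; y \<in> X; x \<noteq> y\<rbrakk> \<Longrightarrow> ?K x y = 0"
     "(\<Sum>x\<in>X. 1 / ?K x x) = 1" "(\<Sum>x\<in>X. x\<^sup>2 / ?K x x) = 1"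
    using approx_nodes[OF ab n(1)] unfolding idx_def by blast
  have K1: "1 \<le> ?K x x" for x by (rule kern_sum_ge_1)
  define X1 where "X1 = X \<inter> cball 0 \<rho>"
  have "\<exists>l\<in>F. \<bar>x - l\<bar> < \<delta>" if x: "x \<in> X1" for x
  proof -
    have "x \<notin> J0" using c(2)[of x] n(2)[of x] X(2)[of x] x by (auto simp: X1_def)
    then obtain l where l: "l \<in> zeros a b" "\<bar>x - l\<bar> < \<delta>"
      using x by (auto simp: J0_def X1_def dist_real_def abs_minus_commute)
    then have "\<bar>l\<bar> \<le> \<rho> + 1" using x delta(3) by (auto simp: X1_def)
    then have "l \<in> F" unfolding F_def using l by (intro IntI) auto
    then show ?thesis using l by blast
  qed
  then obtain l where l: "\<And>x. x \<in> X1 \<Longrightarrow> l x \<in> F" "\<And>x. x \<in> X1 \<Longrightarrow> \<bar>x - l x\<bar> < \<delta>" by metis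
  have XJ: "x \<in> J" if "x \<in> X1" for x using that by (auto simp: X1_def J_def)
  have inj: "inj_on l X1"
  proof (rule inj_onI, rule ccontr)
    fix x y assume xy: "x \<in> X1" "y \<in> X1" "l x = l y" "x \<noteq> y"
    have "\<bar>x - y\<bar> < d" using l(2)[OF xy(1)] l(2)[OF xy(2)] xy(3) delta(2) by linarith
    then have "\<bar>kern x y - kern x x\<bar> < \<eta> / 2"
      using XJ xy by (intro d(2)) (auto simp: dist_Pair_Pair dist_real_def abs_minus_commute)
    moreover have "\<bar>?K x y - kern x y\<bar> < \<eta> / 2" using XJ xy by (intro n(3)) auto
    moreover have "?K x y = 0" using X(3) xy by (auto simp: X1_def)
    ultimately show False using kern_diag_ge_1[of x] eta by linarith
  qed
  have w: "1 / ?K x x \<le> 1 / kern (l x) (l x) + \<eta>" if x: "x \<in> X1" for x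
  proof -
    have lJ: "l x \<in> J" using l(1)[OF x] F(3) by blast
    have "dist (x, x) (l x, l x) \<le> \<bar>x - l x\<bar> + \<bar>x - l x\<bar>"
      unfolding dist_Pair_Pair dist_real_def by (rule order_trans[OF sqrt_sum_squares_le_sum_abs]) simp
    then have "dist (x, x) (l x, l x) < d" using l(2)[OF x] delta(2) by linarith
    then have "\<bar>kern x x - kern (l x) (l x)\<bar> < \<eta> / 2" using XJ x lJ by (intro d(2)) auto
    moreover have "\<bar>?K x x - kern x x\<bar> < \<eta> / 2" using XJ x by (intro n(3)) auto
    ultimately have k: "kern (l x) (l x) - ?K x x \<le> \<eta>" by linarith
    let ?a = "?K x x" and ?b = "kern (l x) (l x)"
    have pos: "1 \<le> ?a" "1 \<le> ?b" using K1 kern_diag_ge_1 by auto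
    then have "1 \<le> ?a * ?b" by (metis mult_mono' mult_1 zero_le_one)
    have "1 / ?a - 1 / ?b = (?b - ?a) / (?a * ?b)" using pos by (simp add: field_simps)
    also have "\<dots> \<le> \<eta> / (?a * ?b)" using k pos by (intro divide_right_mono) auto
    also have "\<dots> \<le> \<eta> / 1" using \<open>1 \<le> ?a * ?b\<close> eta(1) by (intro divide_left_mono) auto
    finally show ?thesis by simp
  qed
  have tail: "(\<Sum>x\<in>X - X1. 1 / ?K x x) \<le> 1 / \<rho>\<^sup>2"
  proof -
    have "(\<Sum>x\<in>X - X1. 1 / ?K x x) \<le> (\<Sum>x\<in>X - X1. 1 / \<rho>\<^sup>2 * (x\<^sup>2 / ?K x x))"
    proof (rule sum_mono)
      fix x assume "x \<in> X - X1"
      then have "\<rho> \<le> \<bar>x\<bar>" by (auto simp: X1_def)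
      then have "\<rho>\<^sup>2 \<le> x\<^sup>2" using rho(1) by (metis abs_le_square_iff abs_of_nonneg order_trans zero_le_one)
      then have "1 * (1 / ?K x x) \<le> x\<^sup>2 / \<rho>\<^sup>2 * (1 / ?K x x)"
        using rho(1) K1[of x] by (intro mult_right_mono) (auto simp: field_simps)
      then show "1 / ?K x x \<le> 1 / \<rho>\<^sup>2 * (x\<^sup>2 / ?K x x)" by simp
    qed
    also have "\<dots> = 1 / \<rho>\<^sup>2 * (\<Sum>x\<in>X - X1. x\<^sup>2 / ?K x x)" by (simp only: sum_distrib_left)
    also have "\<dots> \<le> 1 / \<rho>\<^sup>2 * (\<Sum>x\<in>X. x\<^sup>2 / ?K x x)"
      using X(1) K1 by (intro mult_left_mono sum_mono2) (auto intro!: divide_nonneg_nonneg order_trans[OF zero_le_one K1])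
    finally show ?thesis by (simp add: X(5))
  qed
  have card: "card X1 \<le> card F" using inj l(1) F(1) by (intro card_inj_on_le[of l]) auto
  have "1 = (\<Sum>x\<in>X - X1. 1 / ?K x x) + (\<Sum>x\<in>X1. 1 / ?K x x)"
    using X(4) sum.subset_diff[of X1 X "\<lambda>x. 1 / ?K x x"] X(1) unfolding X1_def by simp
  also have "\<dots> \<le> 1 / \<rho>\<^sup>2 + (\<Sum>x\<in>X1. 1 / kern (l x) (l x) + \<eta>)"
    by (intro add_mono tail sum_mono w)
  also have "\<dots> = 1 / \<rho>\<^sup>2 + (\<Sum>y\<in>l ` X1. 1 / kern y y) + card X1 * \<eta>"
    by (simp add: sum.distrib sum.reindex[OF inj])
  also have "\<dots> \<le> e / 2 + (\<Sum>y\<in>F. 1 / kern y y) + e / 2"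
  proof (intro add_mono rho(2))
    show "(\<Sum>y\<in>l ` X1. 1 / kern y y) \<le> (\<Sum>y\<in>F. 1 / kern y y)"
      using l(1) F(1) kern_diag_ge_1 by (intro sum_mono2) (auto intro: order_trans[OF zero_le_one])
    have "card X1 * \<eta> \<le> card F * \<eta>" using card eta(1) by (intro mult_right_mono) auto
    then show "card X1 * \<eta> \<le> e / 2" using eta(3) by (simp add: mult.commute)
  qed
  finally have "1 - e \<le> (\<Sum>y\<in>F. 1 / kern y y)" by simp
  then show ?thesis using F by blast
qed

section \<open>Orthogonality on the zero sets\<close>

text \<open>
  Every single term of the series in \<open>bessel_identity\<close> for \<open>n = 0\<close> is bounded by its sum, the defect
  \<open>1 - \<Sum> 1 / kern x x\<close>, which becomes arbitrarily small by completeness.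
\<close>
lemma orthogonal_to_P0:
  assumes ab: "(a, b) \<noteq> (0, 0)"
  shows "((\<lambda>x. P k x / kern x x) has_sum (if k = 0 then 1 else 0)) (zeros a b)"
  unfolding has_sum_def tendsto_iff eventually_finite_subsets_at_top
proof (intro allI impI)
  fix e :: real assume e: "0 < e"
  then have "0 < e\<^sup>2 / 2" by simp
  then obtain F where F: "finite F" "F \<subseteq> zeros a b" "1 - e\<^sup>2 / 2 \<le> (\<Sum>x\<in>F. 1 / kern x x)"
    using weights_complete[OF ab] by blast
  have "dist (\<Sum>x\<in>Y. P k x / kern x x) (if k = 0 then 1 else 0) < e"
    if Y: "finite Y" "F \<subseteq> Y" "Y \<subseteq> zeros a b" for Y
  proof -
    let ?h = "\<lambda>k. ((if k = 0 then 1 else 0) - (\<Sum>x\<in>Y. P 0 x * P k x / kern x x))\<^sup>2"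
    have s: "?h sums (1 - (\<Sum>x\<in>Y. (P 0 x)\<^sup>2 / kern x x))"
      by (rule bessel_identity[OF ab Y(1,3)])
    have "?h k \<le> suminf ?h" using sum_le_suminf[OF sums_summable[OF s], of "{k}"] by simp
    also have "\<dots> = 1 - (\<Sum>x\<in>Y. 1 / kern x x)" using sums_unique[OF s] by simp
    also have "\<dots> \<le> 1 - (\<Sum>x\<in>F. 1 / kern x x)"
      using Y kern_diag_ge_1 by (intro diff_left_mono sum_mono2) (auto intro: order_trans[OF zero_le_one])
    also have "\<dots> \<le> e\<^sup>2 / 2" using F(3) by simp
    also have "\<dots> < e\<^sup>2" using e by simp
    finally have "\<bar>(if k = 0 then 1 else 0) - (\<Sum>x\<in>Y. P 0 x * P k x / kern x x)\<bar>\<^sup>2 < e\<^sup>2"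
      by (simp only: power2_abs)
    then have "\<bar>(if k = 0 then 1 else 0) - (\<Sum>x\<in>Y. P 0 x * P k x / kern x x)\<bar> < e"
      by (rule power2_less_imp_less) (use e in simp)
    then show ?thesis by (simp add: dist_real_def abs_minus_commute)
  qed
  then show "\<exists>X. finite X \<and> X \<subseteq> zeros a b \<and> (\<forall>Y. finite Y \<and> X \<subseteq> Y \<and> Y \<subseteq> zeros a b \<longrightarrow>
      dist (\<Sum>x\<in>Y. P k x / kern x x) (if k = 0 then 1 else 0) < e)"
    using F by blast
qed

text \<open>
  Induction on \<open>m\<close>: multiplication by \<open>x\<close> acts on either factor by the same recurrence, so orthogonality to
  \<open>P\<^sub>0\<close> propagates.
\<close>
theorem zeros_orthogonal:
  assumes ab: "(a, b) \<noteq> (0, 0)"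
  shows "((\<lambda>x. P m x * P n x / kern x x) has_sum (if m = n then 1 else 0)) (zeros a b)"
proof -
  let ?d = "\<lambda>m n. if m = n then 1 else 0 :: real"
  \<comment> \<open>Orthogonality of \<open>P m\<close> to all \<open>P n\<close> determines its pairing with \<open>x P k\<close>.\<close>
  have xP: "((\<lambda>x. P m x * (x * P k x) / kern x x) has_sum
      ((if k = 0 then 0 else beta q (k - 1) * ?d m (k - 1)) + beta q k * ?d m (Suc k))) (zeros a b)"
    if IH: "\<And>n. ((\<lambda>x. P m x * P n x / kern x x) has_sum ?d m n) (zeros a b)" for m k
  proof -
    have "((\<lambda>x. (if k = 0 then 0 else beta q (k - 1) * (P m x * P (k - 1) x / kern x x))
        + beta q k * (P m x * P (Suc k) x / kern x x)) has_sum
      ((if k = 0 then 0 else beta q (k - 1) * ?d m (k - 1)) + beta q k * ?d m (Suc k))) (zeros a b)"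
    proof (intro has_sum_add has_sum_cmult_right IH)
      show "((\<lambda>x. if k = 0 then 0 else beta q (k - 1) * (P m x * P (k - 1) x / kern x x)) has_sum
        (if k = 0 then 0 else beta q (k - 1) * ?d m (k - 1))) (zeros a b)"
      proof (cases "k = 0")
        case False
        show ?thesis unfolding if_not_P[OF False] by (intro has_sum_cmult_right IH)
      qed simp
    qed
    then show ?thesis
      unfolding x_times_P[of _ k] of_real_eq_id id_apply
      by (elim has_sum_cong[THEN iffD1, rotated]) (simp add: algebra_simps add_divide_distrib del: P_poly.simps)
  qed
  have "\<forall>n. ((\<lambda>x. P m x * P n x / kern x x) has_sum ?d m n) (zeros a b)"
  proof (induction m rule: less_induct)
    case (less m)
    consider "m = 0" | "m = Suc 0" | j where "m = Suc (Suc j)"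
      by (metis not0_implies_Suc)
    then show ?case
    proof cases
      case 1 then show ?thesis using orthogonal_to_P0[OF ab] by (auto split: if_splits)
    next
      case 2
      have IH: "((\<lambda>x. P 0 x * P n x / kern x x) has_sum ?d 0 n) (zeros a b)" for n
        using less[of 0] 2 by auto
      have "((\<lambda>x. P 1 x * P n x / kern x x) has_sum ?d 1 n) (zeros a b)" for n
        using xP[OF IH, of n] by (auto simp: beta_0 split: if_splits)
      then show ?thesis unfolding 2 by simp
    next
      case 3
      have IH1: "((\<lambda>x. P (Suc j) x * P n x / kern x x) has_sum ?d (Suc j) n) (zeros a b)"
       and IH2: "((\<lambda>x. P j x * P n x / kern x x) has_sum ?d j n) (zeros a b)" for n
        using less[of "Suc j"] less[of j] unfolding 3 by simp_all
      have b: "beta q (Suc j) \<noteq> 0" using beta_pos[OF q_pos, of "Suc j"] by simp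
      have "((\<lambda>x. P m x * P n x / kern x x) has_sum ?d m n) (zeros a b)" for n
      proof -
        have "((\<lambda>x. 1 / beta q (Suc j) * (P (Suc j) x * (x * P n x) / kern x x + (- beta q j) * (P j x * P n x / kern x x)))
           has_sum (1 / beta q (Suc j) * (((if n = 0 then 0 else beta q (n - 1) * ?d (Suc j) (n - 1)) + beta q n * ?d (Suc j) (Suc n)) + (- beta q j) * ?d j n))) (zeros a b)"
          by (intro has_sum_cmult_right has_sum_add xP[OF IH1] IH2)
        moreover have "1 / beta q (Suc j) * (((if n = 0 then 0 else beta q (n - 1) * ?d (Suc j) (n - 1)) + beta q n * ?d (Suc j) (Suc n)) + (- beta q j) * ?d j n) = ?d m n"
          using b unfolding 3 by (cases n) auto
        moreover have "1 / beta q (Suc j) * (P (Suc j) x * (x * P n x) / kern x x + (- beta q j) * (P j x * P n x / kern x x)) = P m x * P n x / kern x x" for x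
        proof -
          have "1 / B * (A * (x * C) / K + (- D) * (E * C / K)) = 1 / B * (x * A - D * E) * C / K" for A B C D E K :: real
            by (simp add: algebra_simps diff_divide_distrib)
          then show ?thesis unfolding 3 P_poly.simps(3) by simp
        qed
        ultimately show ?thesis by simp
      qed
      then show ?thesis by blast
    qed
  qed
  then show ?thesis by blast
qed

text \<open>
  With only \<open>M\<close> zeros the orthonormal functions \<open>P\<^sub>0, \<dots>, P\<^sub>M\<close> would live in a space of dimension \<open>M\<close>; the count is done by
  computing a trace in two ways.
\<close>
lemma zeros_infinite:
  assumes ab: "(a, b) \<noteq> (0, 0)" shows "infinite (zeros a b)"
proof
  assume fin: "finite (zeros a b)"
  let ?M = "card (zeros a b)"
  have one: "(\<Sum>x\<in>zeros a b. P n x * P n x / kern x x) = 1" for n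
    using has_sum_unique[OF has_sum_finite[OF fin] zeros_orthogonal[OF ab, of n n]] by simp
  have "real (Suc ?M) = (\<Sum>n\<le>?M. \<Sum>x\<in>zeros a b. P n x * P n x / kern x x)"
    unfolding one by simp
  also have "\<dots> = (\<Sum>x\<in>zeros a b. kern_sum ?M x x / kern x x)"
    unfolding kern_sum_def sum_divide_distrib by (rule sum.swap)
  also have "\<dots> \<le> (\<Sum>x\<in>zeros a b. 1)"
  proof (rule sum_mono)
    fix x :: real
    have "kern_sum ?M x x \<le> kern x x"
      unfolding kern_sum_def kern_def by (rule sum_le_suminf[OF sums_summable[OF kern_sums]]) auto
    then show "kern_sum ?M x x / kern x x \<le> 1" using kern_diag_ge_1[of x] by (simp add: divide_le_eq)
  qed
  finally show False by simp
qed

lemma zeros_countable: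
  assumes ab: "(a, b) \<noteq> (0, 0)" shows "countable (zeros a b)"
proof -
  have "countable (\<Union>n::nat. zeros a b \<inter> {- real n..real n})"
    by (intro countable_UN countableI_type countable_finite[OF zeros_locally_finite[OF ab]])
  moreover have "zeros a b \<subseteq> (\<Union>n::nat. zeros a b \<inter> {- real n..real n})"
  proof
    fix x assume "x \<in> zeros a b"
    moreover obtain n :: nat where "\<bar>x\<bar> \<le> real n" using real_arch_simple by blast
    ultimately show "x \<in> (\<Union>n::nat. zeros a b \<inter> {- real n..real n})" by (intro UN_I[of n]) auto
  qed
  ultimately show ?thesis by (rule countable_subset[rotated])
qed

text \<open>
  As for \<open>quasi_poly_real_roots\<close>: a nonreal zero \<open>z\<close> would give \<open>K(cnj z, z) = 0\<close>, which is a sum of squared moduli.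
\<close>
lemma complex_zeros:
  assumes ab: "(a, b) \<noteq> (0, 0)"
  shows "{z. qcos z * of_real a + qsin z * of_real b = 0} = complex_of_real ` zeros a b"
proof (intro equalityI subsetI)
  fix z assume "z \<in> {z. qcos z * of_real a + qsin z * of_real b = (0::complex)}"
  then have z: "of_real a * qcos z + of_real b * qsin z = 0" by (simp add: mult.commute)
  then have "cnj (of_real a * qcos z + of_real b * qsin z) = 0" by simp
  then have z': "of_real a * cnj (qcos z) + of_real b * cnj (qsin z) = 0" by simp
  have A: "of_real a * qcos z = - (of_real b * qsin z)" "of_real a * cnj (qcos z) = - (of_real b * cnj (qsin z))"
    using z z' by (auto simp: add_eq_0_iff)
  have B: "of_real b * qsin z = - (of_real a * qcos z)" "of_real b * cnj (qsin z) = - (of_real a * cnj (qcos z))"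
    using A by simp_all
  let ?d = "qsin (cnj z) * qcos z - qcos (cnj z) * qsin z"
  have "of_real a * ?d = cnj (qsin z) * (of_real a * qcos z) - (of_real a * cnj (qcos z)) * qsin z"
    by (simp add: qcos_cnj qsin_cnj algebra_simps)
  then have 1: "of_real a * ?d = 0" unfolding A by simp
  have "of_real b * ?d = (of_real b * cnj (qsin z)) * qcos z - cnj (qcos z) * (of_real b * qsin z)"
    by (simp add: qcos_cnj qsin_cnj algebra_simps)
  then have 2: "of_real b * ?d = 0" unfolding B by simp
  have "?d = 0" using 1 2 ab by auto
  then have d: "(cnj z - z) * kern (cnj z) z = 0" unfolding kern_trig .
  have "kern (cnj z) z \<noteq> 0"
  proof -
    have c: "(\<lambda>k. P k (cnj z) * P k z) sums kern (cnj z) z" by (rule kern_sums)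
    then have "(\<lambda>k. Re (P k (cnj z) * P k z)) sums Re (kern (cnj z) z)" by (rule sums_Re)
    moreover have "Re (P k (cnj z) * P k z) = (cmod (P k z))\<^sup>2" for k
      unfolding P_cnj cmod_power2 by (simp add: power2_eq_square)
    ultimately have s: "(\<lambda>k. (cmod (P k z))\<^sup>2) sums Re (kern (cnj z) z)" by simp
    have "(\<Sum>k\<in>{0}. (cmod (P k z))\<^sup>2) \<le> Re (kern (cnj z) z)"
      unfolding sums_unique[OF s] by (rule sum_le_suminf[OF sums_summable[OF s]]) auto
    then show ?thesis by auto
  qed
  then have "cnj z = z" using d by simp
  then obtain x where x: "z = of_real x" by (metis Reals_cnj_iff Reals_cases)
  have "complex_of_real (a * qcos x + b * qsin x) = 0" using z by (simp add: x qcos_of_real qsin_of_real)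
  then show "z \<in> complex_of_real ` zeros a b" unfolding of_real_eq_0_iff by (simp add: x zeros_def)
next
  fix z assume "z \<in> complex_of_real ` zeros a b"
  then obtain x where x: "z = of_real x" "a * qcos x + b * qsin x = 0" by (auto simp: zeros_def)
  have "qcos z * of_real a + qsin z * of_real b = of_real (a * qcos x + b * qsin x)"
    by (simp add: x(1) qcos_of_real qsin_of_real mult.commute)
  then show "z \<in> {z. qcos z * of_real a + qsin z * of_real b = 0}" using x(2) by simp
qed

section \<open>The Nevanlinna functions\<close>

lemma nev_approx_eq_casorati:
  "nev_approx q u v N z = casorati (\<lambda>n. poly (u n) z) (\<lambda>n. poly (v n) 0) N"
  by (simp add: nev_approx_def casorati_def)

lemma locally_uniform_limit_the:
  assumes "locally_uniform_limit f g" shows "(THE g. locally_uniform_limit f g) = g"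
proof (rule the_equality[of "locally_uniform_limit f", OF assms])
  fix h assume h: "locally_uniform_limit f h"
  show "h = g"
  proof
    fix z
    have hz: "uniform_limit {z} f h sequentially" and gz: "uniform_limit {z} f g sequentially"
      using h assms compact_sing[of z] unfolding locally_uniform_limit_def by blast+
    have "(\<lambda>n. f n z) \<longlonglongrightarrow> h z" "(\<lambda>n. f n z) \<longlonglongrightarrow> g z"
      by (rule tendsto_uniform_limitI[OF hz singletonI], rule tendsto_uniform_limitI[OF gz singletonI])
    then show "h z = g z" by (rule LIMSEQ_unique)
  qed
qed

lemma locally_uniform_limitI:
  assumes "\<And>R. 0 \<le> R \<Longrightarrow> uniform_limit (cball 0 R) f g sequentially"
  shows "locally_uniform_limit f g"
  unfolding locally_uniform_limit_def
proof (intro allI impI)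
  fix K :: "complex set" assume "compact K"
  then obtain R where R: "\<forall>x\<in>K. norm x \<le> R" using compact_imp_bounded bounded_iff by blast
  then have "K \<subseteq> cball 0 (max R 0)" by auto
  then show "uniform_limit K f g sequentially"
    using uniform_limit_on_subset[OF assms[of "max R 0"]] by simp
qed

lemma nevanlinna_A_eq: "nevanlinna_A q z = z * (\<Sum>k. Q k z * Q k 0)"
proof -
  have "locally_uniform_limit (nev_approx q (Q_poly q) (Q_poly q)) (\<lambda>z. 0 + z * (\<Sum>k. Q k z * Q k 0))"
    using uniform_limit_at_0[where U = Q and V = Q, OF bilinear_series_uniform_limit[where U = Q and V = Q, OF norm_Q_le norm_Q_le], of _ 0]
    by (intro locally_uniform_limitI) (simp add: nev_approx_eq_casorati[abs_def] casorati_QQ)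
  then show ?thesis unfolding nevanlinna_A_def by (simp add: locally_uniform_limit_the)
qed

lemma nevanlinna_C_eq: "nevanlinna_C q z = 1 + z * (\<Sum>k. Q k z * P k 0)"
proof -
  have "locally_uniform_limit (nev_approx q (Q_poly q) (P_poly q)) (\<lambda>z. 1 + z * (\<Sum>k. Q k z * P k 0))"
    using uniform_limit_at_0[where U = Q and V = P, OF bilinear_series_uniform_limit[where U = Q and V = P, OF norm_Q_le norm_P_le], of _ 1]
    by (intro locally_uniform_limitI) (simp add: nev_approx_eq_casorati[abs_def] casorati_QP)
  then show ?thesis unfolding nevanlinna_C_def by (simp add: locally_uniform_limit_the)
qed

lemma nevanlinna_D_eq: "nevanlinna_D q z = qsin z"
proof -
  have "locally_uniform_limit (nev_approx q (P_poly q) (P_poly q)) qsin"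
    using casorati_uniform_limit(1)[where 'a = complex] by (intro locally_uniform_limitI) (simp add: nev_approx_eq_casorati[abs_def])
  then show ?thesis unfolding nevanlinna_D_def by (simp add: locally_uniform_limit_the)
qed

lemma nevanlinna_B_eq: "nevanlinna_B q z = - qcos z"
proof -
  have "locally_uniform_limit (nev_approx q (P_poly q) (Q_poly q)) (\<lambda>z. - qcos z)"
    using uniform_limit_uminus[OF casorati_uniform_limit(2)[where 'a = complex]] by (intro locally_uniform_limitI) (simp add: nev_approx_eq_casorati[abs_def])
  then show ?thesis unfolding nevanlinna_B_def by (simp add: locally_uniform_limit_the)
qed

lemma QP_sums: "(\<lambda>k. Q k z * P k w) sums (\<Sum>k. Q k z * P k (w::'a::{real_normed_field,banach}))"
  by (rule summable_sums[OF summable_norm_cancel[OF bilinear_series_summable[where U = Q and V = P, OF norm_Q_le norm_P_le]]])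
lemma QQ_sums: "(\<lambda>k. Q k z * Q k w) sums (\<Sum>k. Q k z * Q k (w::'a::{real_normed_field,banach}))"
  by (rule summable_sums[OF summable_norm_cancel[OF bilinear_series_summable[where U = Q and V = Q, OF norm_Q_le norm_Q_le]]])

lemma QP_LIM: "(\<lambda>N. \<Sum>k\<le>N. Q k z * P k w) \<longlonglongrightarrow> (\<Sum>k. Q k z * P k (w::'a::{real_normed_field,banach}))"
  using QP_sums unfolding sums_def_le .
lemma QQ_LIM: "(\<lambda>N. \<Sum>k\<le>N. Q k z * Q k w) \<longlonglongrightarrow> (\<Sum>k. Q k z * Q k (w::'a::{real_normed_field,banach}))"
  using QQ_sums unfolding sums_def_le .

text \<open>
  The limit of the Pluecker relation with solutions of both kinds; this is where \<open>A\<close> and \<open>C\<close> enter.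
\<close>
lemma QP_nevanlinna:
  "1 + (z - w) * (\<Sum>k. Q k z * P k w) = nevanlinna_A q z * qsin w + nevanlinna_C q z * qcos w"
proof -
  have A: "(\<lambda>N. casorati (\<lambda>n. Q n z) (\<lambda>n. Q n 0) N) \<longlonglongrightarrow> nevanlinna_A q z"
    unfolding casorati_QQ nevanlinna_A_eq diff_0_right by (intro tendsto_mult tendsto_const QQ_LIM)
  have C: "(\<lambda>N. casorati (\<lambda>n. Q n z) (\<lambda>n. P n 0) N) \<longlonglongrightarrow> nevanlinna_C q z"
    unfolding casorati_QP nevanlinna_C_eq diff_0_right by (intro tendsto_add tendsto_mult tendsto_const QP_LIM)
  have B: "(\<lambda>N. casorati (\<lambda>n. P n w) (\<lambda>n. Q n 0) N) \<longlonglongrightarrow> - qcos w"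
    unfolding qcos_eq_series by (rule casorati_Q0_LIM)
  have D: "(\<lambda>N. casorati (\<lambda>n. P n w) (\<lambda>n. P n 0) N) \<longlonglongrightarrow> qsin w"
    unfolding qsin_eq_kern by (rule casorati_P0_LIM)
  have "(\<lambda>N. casorati (\<lambda>n. Q n z) (\<lambda>n. P n w) N) \<longlonglongrightarrow> 1 + (z - w) * (\<Sum>k. Q k z * P k w)"
    unfolding casorati_QP by (intro tendsto_add tendsto_mult tendsto_const QP_LIM)
  moreover have "(\<lambda>N. casorati (\<lambda>n. Q n z) (\<lambda>n. P n w) N) = (\<lambda>N. casorati (\<lambda>n. Q n z) (\<lambda>n. Q n 0) N * casorati (\<lambda>n. P n w) (\<lambda>n. P n 0) N
      - casorati (\<lambda>n. Q n z) (\<lambda>n. P n 0) N * casorati (\<lambda>n. P n w) (\<lambda>n. Q n 0) N)"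
    unfolding casorati_pluecker casorati_QP_0 by simp
  moreover have "(\<lambda>N. casorati (\<lambda>n. Q n z) (\<lambda>n. Q n 0) N * casorati (\<lambda>n. P n w) (\<lambda>n. P n 0) N
      - casorati (\<lambda>n. Q n z) (\<lambda>n. P n 0) N * casorati (\<lambda>n. P n w) (\<lambda>n. Q n 0) N) \<longlonglongrightarrow>
      nevanlinna_A q z * qsin w - nevanlinna_C q z * (- qcos w)"
    by (intro tendsto_diff tendsto_mult A B C D)
  ultimately show ?thesis by (simp add: LIMSEQ_unique)
qed

section \<open>Integration against point masses\<close>

abbreviation point_masses :: "(nat \<Rightarrow> real) \<Rightarrow> real measure" where "point_masses \<equiv> point_mass_measure q"

lemma weight_eq: "(1 - q) * inverse (weight_fun q x) = 1 / kern x x"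
  using q_less_1 by (simp add: weight_fun_eq inverse_eq_divide)

lemma kern_diag_pos: "0 < kern x (x::real)"
  using kern_diag_ge_1[of x] by linarith

lemma sets_point_masses: "sets (point_masses l) = sets borel" and space_point_masses: "space (point_masses l) = UNIV"
  by (simp_all add: point_mass_measure_def)

lemma
  fixes f :: "real \<Rightarrow> 'b::{banach,second_countable_topology}"
  assumes f: "f \<in> borel_measurable borel"
  shows integrable_point_masses_iff: "integrable (point_masses l) f \<longleftrightarrow> summable (\<lambda>k. norm (f (l k)) / kern (l k) (l k))" (is ?A)
    and integral_point_masses: "integrable (point_masses l) f \<Longrightarrow> (\<integral>x. f x \<partial>point_masses l) = (\<Sum>k. (1 / kern (l k) (l k)) *\<^sub>R f (l k))" (is "_ \<Longrightarrow> ?B")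
proof -
  let ?w = "\<lambda>k. 1 / kern (l k) (l k)"
  have w: "0 \<le> ?w k" for k using kern_diag_pos[of "l k"] by simp
  have eq: "point_masses l = distr (density (count_space UNIV) (\<lambda>k. ennreal (?w k))) borel l"
    unfolding point_mass_measure_def point_measure_def weight_eq ..
  have i: "integrable (point_masses l) f \<longleftrightarrow> integrable (count_space UNIV) (\<lambda>k. ?w k *\<^sub>R f (l k))"
    unfolding eq using w f by (subst integrable_distr_eq) (auto simp: integrable_density)
  show A: ?A unfolding i integrable_count_space_nat_iff
    using less_imp_le[OF kern_diag_pos] by (simp add: mult.commute)
  show ?B if "integrable (point_masses l) f"
  proof -
    have "(\<integral>x. f x \<partial>point_masses l) = (\<integral>k. f (l k) \<partial>density (count_space UNIV) (\<lambda>k. ennreal (?w k)))"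
      unfolding eq using f by (subst integral_distr) auto
    also have "\<dots> = (\<integral>k. ?w k *\<^sub>R f (l k) \<partial>count_space UNIV)"
      using w by (subst integral_density) auto
    also have "\<dots> = (\<Sum>k. ?w k *\<^sub>R f (l k))"
      by (rule integral_count_space_nat) (use that i in blast)
    finally show ?thesis .
  qed
qed

lemma P_measurable: "(\<lambda>x::real. P n x) \<in> borel_measurable borel"
  by (intro borel_measurable_continuous_onI continuous_intros)

lemma zeros_enum_sums:
  assumes "(a, b) \<noteq> (0, 0)" "bij_betw l UNIV (zeros a b)"
  shows "summable (\<lambda>k. norm (P m (l k) * P n (l k) / kern (l k) (l k)))"
    and "(\<lambda>k. P m (l k) * P n (l k) / kern (l k) (l k)) sums (if m = n then 1 else 0)"
proof -
  have h: "((\<lambda>k. P m (l k) * P n (l k) / kern (l k) (l k)) has_sum (if m = n then 1 else 0)) UNIV"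
    using zeros_orthogonal[OF assms(1), of m n] has_sum_reindex_bij_betw[OF assms(2), of "\<lambda>x. P m x * P n x / kern x x"] by blast
  then show "(\<lambda>k. P m (l k) * P n (l k) / kern (l k) (l k)) sums (if m = n then 1 else 0)"
    by (rule has_sum_imp_sums)
  have "(\<lambda>k. norm (P m (l k) * P n (l k) / kern (l k) (l k))) summable_on UNIV"
    by (rule summable_on_iff_abs_summable_on_real[THEN iffD1]) (use h in \<open>auto simp only: summable_on_def\<close>)
  then show "summable (\<lambda>k. norm (P m (l k) * P n (l k) / kern (l k) (l k)))"
    by (rule summable_on_imp_summable)
qed

text \<open>
  The inner products are \<open>zeros_orthogonal\<close>, and in particular every \<open>P\<^sub>k\<close> is integrable.  Rewriting
  \<open>x P\<^sub>k\<close> by the recurrence extends this to all moments.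
\<close>
lemma point_masses_orthogonal:
  assumes "(a, b) \<noteq> (0, 0)" "bij_betw l UNIV (zeros a b)"
  shows "orthogonality_measure q (point_masses l)"
proof -
  have iPP: "integrable (point_masses l) (\<lambda>x. P m x * P n x)" for m n
    using zeros_enum_sums(1)[OF assms, of m n] less_imp_le[OF kern_diag_pos]
    by (subst integrable_point_masses_iff) (auto simp: abs_mult intro!: borel_measurable_times P_measurable)
  have iP: "integrable (point_masses l) (\<lambda>x. x ^ j * P k x)" for j k
  proof (induction j arbitrary: k)
    case 0 show ?case using iPP[of 0 k] by simp
  next
    case (Suc j)
    have "integrable (point_masses l) (\<lambda>x. (if k = 0 then 0 else beta q (k - 1) * (x ^ j * P (k - 1) x)) + beta q k * (x ^ j * P (Suc k) x))"
    proof (intro Bochner_Integration.integrable_add integrable_mult_right Suc)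
      show "integrable (point_masses l) (\<lambda>x. if k = 0 then 0 else beta q (k - 1) * (x ^ j * P (k - 1) x))"
      proof (cases "k = 0")
        case False
        show ?thesis unfolding if_not_P[OF False] by (intro integrable_mult_right Suc)
      qed simp
    qed
    moreover have "x ^ Suc j * P k x = (if k = 0 then 0 else beta q (k - 1) * (x ^ j * P (k - 1) x)) + beta q k * (x ^ j * P (Suc k) x)" for x
    proof -
      have "x ^ Suc j * P k x = x ^ j * (x * P k x)" by simp
      then show ?thesis unfolding x_times_P[of x k] of_real_eq_id id_apply
        by (simp add: algebra_simps del: P_poly.simps)
    qed
    ultimately show ?case by simp
  qed
  have "(\<integral>x. P m x * P n x \<partial>point_masses l) = (if m = n then 1 else 0)" for m n
  proof -
    have "(\<integral>x. P m x * P n x \<partial>point_masses l) = (\<Sum>k. (1 / kern (l k) (l k)) *\<^sub>R (P m (l k) * P n (l k)))"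
      by (rule integral_point_masses[OF _ iPP]) (intro borel_measurable_times P_measurable)
    then show ?thesis using sums_unique[OF zeros_enum_sums(2)[OF assms, of m n]] by simp
  qed
  moreover have "integrable (point_masses l) (\<lambda>x. x ^ n)" for n using iP[of n 0] by simp
  ultimately show ?thesis unfolding orthogonality_measure_def using sets_point_masses by blast
qed

section \<open>Stieltjes transforms\<close>

lemma cmod_ge_Im: "\<bar>Im z\<bar> \<le> cmod (z - of_real x)"
  using abs_Im_le_cmod[of "z - of_real x"] by simp

lemma Im_nz: "z \<notin> \<real> \<Longrightarrow> 0 < \<bar>Im z\<bar>"
  by (simp add: complex_is_Real_iff)

context
  fixes \<mu> :: "real measure" and z :: complex
  assumes mu: "orthogonality_measure q \<mu>" and z: "z \<notin> \<real>"
begin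

lemma mu_sets: "sets \<mu> = sets borel" using mu by (simp add: orthogonality_measure_def)

lemma mu_measurable: "f \<in> borel_measurable borel \<Longrightarrow> f \<in> borel_measurable \<mu>"
  using measurable_cong_sets[OF mu_sets refl] by blast

lemma mu_P: "integrable \<mu> (\<lambda>x. P n x)"
  unfolding poly_altdef using mu by (auto simp: orthogonality_measure_def intro!: Bochner_Integration.integrable_sum)

lemma mu_PP: "integrable \<mu> (\<lambda>x. P n x * P m x)"
  unfolding poly_mult[symmetric] poly_altdef[of "P_poly q n * P_poly q m"]
  using mu by (auto simp: orthogonality_measure_def intro!: Bochner_Integration.integrable_sum)

lemma mu_integral_P: "(\<integral>x. P n x \<partial>\<mu>) = (if n = 0 then 1 else 0)"
proof -
  have "(\<integral>x. P 0 x * P n x \<partial>\<mu>) = (if 0 = n then 1 else 0)"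
    using mu unfolding orthogonality_measure_def by blast
  then show ?thesis by (simp add: eq_commute[of 0])
qed

lemma mu_integral_PP: "(\<integral>x. P n x * P n x \<partial>\<mu>) = 1"
  using mu unfolding orthogonality_measure_def by auto

lemma Im_pos: "0 < \<bar>Im z\<bar>" using z by (rule Im_nz)

lemma denom_nz: "z - of_real x \<noteq> 0" using z by auto

text \<open>
  The integrals of these functions solve an inhomogeneous form of the recurrence (\<open>cauchy_P_integral_rec\<close>) and are thus
  combinations of \<open>P\<^sub>n(z)\<close> and \<open>Q\<^sub>n(z)\<close> (\<open>cauchy_P_integral\<close>).
\<close>
definition cauchy_P :: "nat \<Rightarrow> real \<Rightarrow> complex" where
  "cauchy_P n x = of_real (P n x) / (z - of_real x)"

lemma cauchy_P_le: "cmod (cauchy_P n x) \<le> \<bar>P n x\<bar> / \<bar>Im z\<bar>"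
  unfolding cauchy_P_def norm_divide norm_of_real using cmod_ge_Im[of z x] Im_pos
  by (intro divide_left_mono mult_pos_pos) linarith+

lemma cauchy_P_measurable: "cauchy_P n \<in> borel_measurable \<mu>"
  unfolding cauchy_P_def[abs_def]
  by (intro mu_measurable borel_measurable_continuous_onI continuous_intros) (use denom_nz in auto)

lemma cauchy_P_integrable: "integrable \<mu> (cauchy_P n)"
proof (rule Bochner_Integration.integrable_bound[OF _ cauchy_P_measurable])
  show "integrable \<mu> (\<lambda>x. P n x / \<bar>Im z\<bar>)" by (intro integrable_divide mu_P)
  show "AE x in \<mu>. cmod (cauchy_P n x) \<le> norm (P n x / \<bar>Im z\<bar>)"
    using cauchy_P_le by simp
qed

text \<open>
  From \<open>2 |P\<^sub>n| \<le> 1 + P\<^sub>n\<^sup>2\<close>, which has integral \<open>2\<close>.  The bound is uniform in \<open>n\<close> and allows to interchange sum and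
  integral in \<open>cauchy_kern\<close>.
\<close>
lemma cauchy_P_norm_integral: "(\<integral>x. cmod (cauchy_P n x) \<partial>\<mu>) \<le> 1 / \<bar>Im z\<bar>"
proof -
  have i: "integrable \<mu> (\<lambda>x. (P 0 x + P n x * P n x) / (2 * \<bar>Im z\<bar>))"
    by (intro integrable_divide Bochner_Integration.integrable_add mu_P mu_PP)
  have "(\<integral>x. cmod (cauchy_P n x) \<partial>\<mu>) \<le> (\<integral>x. (P 0 x + P n x * P n x) / (2 * \<bar>Im z\<bar>) \<partial>\<mu>)"
  proof (rule integral_mono[OF integrable_norm[OF cauchy_P_integrable] i])
    fix x :: real
    have "0 \<le> (1 - \<bar>P n x\<bar>)\<^sup>2" by simp
    then have "2 * \<bar>P n x\<bar> \<le> 1 + P n x * P n x" by (simp add: power2_diff flip: power2_eq_square)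
    then have "\<bar>P n x\<bar> / \<bar>Im z\<bar> \<le> (1 + P n x * P n x) / (2 * \<bar>Im z\<bar>)"
      using Im_pos by (simp add: field_simps)
    then show "cmod (cauchy_P n x) \<le> (P 0 x + P n x * P n x) / (2 * \<bar>Im z\<bar>)"
      using cauchy_P_le[of n x] by simp
  qed
  also have "\<dots> = (1 + 1) / (2 * \<bar>Im z\<bar>)"
    unfolding integral_divide_zero Bochner_Integration.integral_add[OF mu_P mu_PP] mu_integral_P mu_integral_PP by simp
  finally show ?thesis by simp
qed

definition stieltjes :: complex where "stieltjes = (\<integral>x. 1 / (z - of_real x) \<partial>\<mu>)"

lemma cauchy_P_integral_rec:
  "z * (\<integral>x. cauchy_P n x \<partial>\<mu>) = (if n = 0 then 1 else 0)
     + ((if n = 0 then 0 else of_real (beta q (n - 1)) * (\<integral>x. cauchy_P (n - 1) x \<partial>\<mu>))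
        + of_real (beta q n) * (\<integral>x. cauchy_P (Suc n) x \<partial>\<mu>))"
proof -
  have "z * cauchy_P n x = of_real (P n x) + ((if n = 0 then 0 else of_real (beta q (n - 1)) * cauchy_P (n - 1) x)
      + of_real (beta q n) * cauchy_P (Suc n) x)" for x
  proof -
    have "z * cauchy_P n x = of_real (P n x) + of_real (x * P n x) / (z - of_real x)"
      unfolding cauchy_P_def using denom_nz[of x] by (simp add: field_simps)
    also have "of_real (x * P n x) / (z - of_real x) = (if n = 0 then 0 else of_real (beta q (n - 1)) * cauchy_P (n - 1) x)
      + of_real (beta q n) * cauchy_P (Suc n) x"
      unfolding x_times_P[of x n] cauchy_P_def by (simp add: add_divide_distrib del: P_poly.simps)
    finally show ?thesis .
  qed
  then have "(\<integral>x. z * cauchy_P n x \<partial>\<mu>) = (\<integral>x. of_real (P n x) + ((if n = 0 then 0 else of_real (beta q (n - 1)) * cauchy_P (n - 1) x)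
      + of_real (beta q n) * cauchy_P (Suc n) x) \<partial>\<mu>)" by simp
  also have "\<dots> = (\<integral>x. of_real (P n x) \<partial>\<mu>) + ((\<integral>x. (if n = 0 then 0 else of_real (beta q (n - 1)) * cauchy_P (n - 1) x) \<partial>\<mu>)
      + (\<integral>x. of_real (beta q n) * cauchy_P (Suc n) x \<partial>\<mu>))"
    by (cases "n = 0") (simp_all add: integrable_of_real mu_P cauchy_P_integrable del: P_poly.simps)
  finally show ?thesis using mu_integral_P[of n] by simp
qed

lemma cauchy_P_integral: "(\<integral>x. cauchy_P n x \<partial>\<mu>) = P n z * stieltjes - Q n z"
proof (induction n rule: less_induct)
  case (less n)
  consider "n = 0" | "n = Suc 0" | m where "n = Suc (Suc m)"
    by (metis not0_implies_Suc)
  then show ?case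
  proof cases
    case 1 then show ?thesis by (simp add: stieltjes_def cauchy_P_def)
  next
    case 2
    have "z * stieltjes = 1 + (\<integral>x. cauchy_P 1 x \<partial>\<mu>)"
      using cauchy_P_integral_rec[of 0] by (simp add: stieltjes_def cauchy_P_def beta_0 del: P_poly.simps(2))
    then show ?thesis unfolding 2 by simp
  next
    case 3
    have b: "(of_real (beta q (Suc m)) :: complex) \<noteq> 0" using beta_pos[OF q_pos, of "Suc m"] by simp
    have "of_real (beta q (Suc m)) * (\<integral>x. cauchy_P n x \<partial>\<mu>) = z * (\<integral>x. cauchy_P (Suc m) x \<partial>\<mu>) - of_real (beta q m) * (\<integral>x. cauchy_P m x \<partial>\<mu>)"
      using cauchy_P_integral_rec[of "Suc m"] by (simp add: 3 algebra_simps)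
    also have "\<dots> = z * (P (Suc m) z * stieltjes - Q (Suc m) z) - of_real (beta q m) * (P m z * stieltjes - Q m z)"
      using less[of m] less[of "Suc m"] 3 by simp
    also have "\<dots> = of_real (beta q (Suc m)) * (P n z * stieltjes - Q n z)"
      using b unfolding 3 by (simp add: field_simps)
    finally show ?thesis using b by simp
  qed
qed

text \<open>
  Expand the kernel in the \<open>P\<^sub>n\<close> and integrate term by term with \<open>cauchy_P_integral\<close>.
\<close>
lemma cauchy_kern:
  "(\<integral>x. of_real (kern l x) / (z - of_real x) \<partial>\<mu>) = kern (of_real l) z * stieltjes - (\<Sum>n. Q n z * P n (of_real l))"
  and cauchy_kern_integrable: "integrable \<mu> (\<lambda>x. of_real (kern l x) / (z - of_real x))"
proof -
  let ?f = "\<lambda>n x. of_real (P n l) * cauchy_P n x"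
  have i: "integrable \<mu> (?f n)" for n by (intro integrable_mult_right cauchy_P_integrable)
  have s: "(\<lambda>n. ?f n x) sums (of_real (kern l x) / (z - of_real x))" for x
    using sums_divide[OF sums_of_real[OF kern_sums[of l x], where 'a = complex], of "z - of_real x"]
    unfolding cauchy_P_def by simp
  have ae: "AE x in \<mu>. summable (\<lambda>n. norm (?f n x))"
  proof (rule AE_I2)
    fix x
    have "summable (\<lambda>n. norm (P n l * P n x) / cmod (z - of_real x))"
      by (rule summable_divide[OF kern_summable_norm])
    then show "summable (\<lambda>n. norm (?f n x))" by (simp add: cauchy_P_def norm_mult norm_divide abs_mult)
  qed
  have P1: "norm (P n l) \<le> decay_const \<bar>l\<bar> * s ^ n" for n by (rule norm_P_le) simp
  have sum: "summable (\<lambda>n. \<integral>x. norm (?f n x) \<partial>\<mu>)"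
  proof (rule summable_comparison_test')
    show "summable (\<lambda>n. decay_const \<bar>l\<bar> / \<bar>Im z\<bar> * s ^ n)"
      using s_pos s_less_1 by (intro summable_mult summable_geometric) auto
    fix n
    have "norm (\<integral>x. norm (?f n x) \<partial>\<mu>) = norm (P n l) * (\<integral>x. norm (cauchy_P n x) \<partial>\<mu>)"
      by (simp add: norm_mult abs_mult integral_nonneg_AE)
    also have "\<dots> \<le> (decay_const \<bar>l\<bar> * s ^ n) * (1 / \<bar>Im z\<bar>)"
      by (intro mult_mono P1 cauchy_P_norm_integral order_trans[OF norm_ge_zero P1]) (simp add: integral_nonneg_AE)
    finally show "norm (\<integral>x. norm (?f n x) \<partial>\<mu>) \<le> decay_const \<bar>l\<bar> / \<bar>Im z\<bar> * s ^ n" by simp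
  qed
  have e: "(\<Sum>n. ?f n x) = of_real (kern l x) / (z - of_real x)" for x using s sums_unique by metis
  show "integrable \<mu> (\<lambda>x. of_real (kern l x) / (z - of_real x))"
    using integrable_suminf[OF i ae sum] unfolding e .
  have "(\<integral>x. of_real (kern l x) / (z - of_real x) \<partial>\<mu>) = (\<Sum>n. \<integral>x. ?f n x \<partial>\<mu>)"
    using integral_suminf[OF i ae sum] unfolding e .
  also have "\<dots> = (\<Sum>n. (P n (of_real l) * P n z) * stieltjes - Q n z * P n (of_real l))"
    by (simp add: cauchy_P_integral P_of_real algebra_simps)
  also have "\<dots> = kern (of_real l) z * stieltjes - (\<Sum>n. Q n z * P n (of_real l))"
    by (intro sums_unique[symmetric] sums_diff sums_mult2 kern_sums QP_sums)
  finally show "(\<integral>x. of_real (kern l x) / (z - of_real x) \<partial>\<mu>) = kern (of_real l) z * stieltjes - (\<Sum>n. Q n z * P n (of_real l))" .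
qed

end

text \<open>
  On the diagonal \<open>u = z\<close> the zero function reduces to its first term \<open>1\<close>; this is the analogue of \<open>cos\<^sup>2 + sin\<^sup>2 = 1\<close>.
\<close>
lemma trig_nonzero: "(qcos x, qsin x) \<noteq> (0, 0 :: real)"
proof -
  have "shift_term x x sums (\<Sum>k\<in>{0}. shift_term x x k)"
  proof (rule sums_finite)
    fix k :: nat assume "k \<notin> {0}"
    then have "(\<Prod>j<k. (x - x * q ^ j) * (x - x * q ^ Suc j)) = 0" by (intro prod_zero bexI[of _ 0]) auto
    then show "shift_term x x k = 0" by (simp add: shift_term_def)
  qed simp
  then have "qcos x * qcos (r * x) + qsin x * (qsin (r * x) / r) = 1"
    using shift_term_sums[of x x] sums_unique2 by (fastforce simp: shift_term_def qpoch_q_0)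
  then show ?thesis by auto
qed

text \<open>
  Evaluate the integral of \<open>K(x\<^sub>0, x) / (z - x)\<close> for a zero \<open>x\<^sub>0\<close> in two ways.  As \<open>K(x\<^sub>0, x)\<close> vanishes at all other zeros,
  it is \<open>1 / (z - x\<^sub>0)\<close>; by \<open>cauchy_kern\<close> it is an affine function of the Stieltjes transform.
\<close>
lemma point_masses_stieltjes:
  assumes ab: "(a, b) \<noteq> (0, 0)" and l: "bij_betw l UNIV (zeros a b)" and z: "z \<notin> \<real>"
  shows "(of_real a * qcos z + of_real b * qsin z) * (\<integral>x. 1 / (z - complex_of_real x) \<partial>point_masses l)
     = of_real b * nevanlinna_C q z - of_real a * nevanlinna_A q z"
proof -
  note orth = point_masses_orthogonal[OF ab l]
  define F where "F = (\<integral>x. 1 / (z - complex_of_real x) \<partial>point_masses l)"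
  have F: "stieltjes (point_masses l) z = F" unfolding F_def by (rule stieltjes_def[OF orth z])
  define x0 where "x0 = l 0"
  have inj: "l k = x0 \<Longrightarrow> k = 0" for k using l by (auto simp: x0_def bij_betw_def inj_def)
  have lz: "l k \<in> zeros a b" for k using l by (auto simp: bij_betw_def)
  have zx: "z - of_real x0 \<noteq> 0" using z by auto
  let ?h = "\<lambda>x. complex_of_real (kern x0 x) / (z - of_real x)"
  have hi: "integrable (point_masses l) ?h" by (rule cauchy_kern_integrable[OF orth z])
  have hm: "?h \<in> borel_measurable borel"
    using borel_measurable_integrable[OF hi] measurable_cong_sets[OF sets_point_masses refl] by blast
  have "(\<integral>x. ?h x \<partial>point_masses l) = (\<Sum>k. (1 / kern (l k) (l k)) *\<^sub>R ?h (l k))"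
    by (rule integral_point_masses[OF hm hi])
  also have "\<dots> = (\<Sum>k\<in>{0}. (1 / kern (l k) (l k)) *\<^sub>R ?h (l k))"
  proof (rule suminf_finite)
    fix k :: nat assume "k \<notin> {0}"
    then have "l 0 \<noteq> l k" using inj[of k] by (auto simp: x0_def)
    then have "kern x0 (l k) = 0" unfolding x0_def by (rule zeros_kern[OF ab lz lz])
    then show "(1 / kern (l k) (l k)) *\<^sub>R ?h (l k) = 0" by simp
  qed simp
  also have "\<dots> = 1 / (z - of_real x0)"
    using kern_diag_pos[of x0] by (simp add: scaleR_conv_of_real x0_def)
  finally have "1 / (z - of_real x0) = kern (of_real x0) z * F - (\<Sum>n. Q n z * P n (of_real x0))"
    unfolding cauchy_kern[OF orth z] F by simp
  then have "1 = (z - of_real x0) * (kern (of_real x0) z * F - (\<Sum>n. Q n z * P n (of_real x0)))"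
    using zx by (simp add: field_simps)
  then have "1 + (z - of_real x0) * (\<Sum>n. Q n z * P n (of_real x0)) = ((z - of_real x0) * kern z (of_real x0)) * F"
    unfolding kern_commute[of "of_real x0" z] by (simp add: algebra_simps)
  then have eq: "nevanlinna_A q z * of_real (qsin x0) + nevanlinna_C q z * of_real (qcos x0)
     = (qsin z * of_real (qcos x0) - qcos z * of_real (qsin x0)) * F"
    unfolding QP_nevanlinna kern_trig qcos_of_real qsin_of_real .
  have x0: "a * qcos x0 + b * qsin x0 = 0" using lz[of 0] by (simp add: zeros_def x0_def)
  \<comment> \<open>\<open>(qcos x0, qsin x0)\<close> is orthogonal to \<open>(a, b)\<close>, hence equal to \<open>\<kappa> (b, - a)\<close>.\<close>
  define \<kappa> where "\<kappa> = (if b = 0 then - qsin x0 / a else qcos x0 / b)"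
  have k: "qcos x0 = \<kappa> * b" "qsin x0 = - (\<kappa> * a)"
    using x0 ab by (auto simp: \<kappa>_def field_simps add_eq_0_iff)
  have "\<kappa> \<noteq> 0" using trig_nonzero[of x0] k by auto
  have "of_real \<kappa> * (of_real b * nevanlinna_C q z - of_real a * nevanlinna_A q z)
      = of_real \<kappa> * ((of_real a * qcos z + of_real b * qsin z) * F)"
    using eq unfolding k by (simp add: algebra_simps)
  then show ?thesis using \<open>\<kappa> \<noteq> 0\<close> by (simp add: F_def)
qed

lemma trig_combination_nonreal:
  fixes z :: complex
  assumes "(a, b) \<noteq> (0, 0)" "z \<notin> \<real>"
  shows "of_real a * qcos z + of_real b * qsin z \<noteq> 0"
proof
  assume "of_real a * qcos z + of_real b * qsin z = 0"
  then have "z \<in> {z. qcos z * of_real a + qsin z * of_real b = 0}" by (simp add: mult.commute)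
  then have "z \<in> complex_of_real ` zeros a b" using complex_zeros[OF assms(1)] by blast
  then show False using assms(2) by auto
qed

text \<open>
  The coefficients \<open>(a, b)\<close> for which \<open>a qcos + b qsin\<close> is the denominator \<open>- (B t - D)\<close>, or \<open>- B\<close> for \<open>t = \<infinity>\<close>.
\<close>
fun ratio_coeffs :: "real option \<Rightarrow> real \<times> real" where
  "ratio_coeffs None = (1, 0)"
| "ratio_coeffs (Some t) = (t, 1)"

lemma point_masses_nevanlinna:
  assumes "ratio_coeffs t = (a, b)" and l: "bij_betw l UNIV (zeros a b)" and z: "z \<notin> \<real>"
  shows "(\<integral>x. 1 / (z - complex_of_real x) \<partial>point_masses l) = nevanlinna_quotient q t z"
proof -
  have ab: "(a, b) \<noteq> (0, 0)" using assms(1) by (cases t) auto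
  have nz: "of_real a * qcos z + of_real b * qsin z \<noteq> 0" by (rule trig_combination_nonreal[OF ab z])
  have "(\<integral>x. 1 / (z - complex_of_real x) \<partial>point_masses l)
      = (of_real b * nevanlinna_C q z - of_real a * nevanlinna_A q z) / (of_real a * qcos z + of_real b * qsin z)"
    using point_masses_stieltjes[OF ab l z] nz by (simp add: nonzero_eq_divide_eq mult.commute)
  also have "\<dots> = (of_real a * nevanlinna_A q z - of_real b * nevanlinna_C q z) / (- (of_real a * qcos z + of_real b * qsin z))"
    by (simp only: minus_divide_right[symmetric] minus_divide_left minus_diff_eq)
  also have "\<dots> = nevanlinna_quotient q t z"
    using assms(1) by (cases t) (auto simp: nevanlinna_B_eq nevanlinna_D_eq mult.commute)
  finally show ?thesis .
qed

section \<open>Recovering a measure from its Stieltjes transform\<close>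

lemma orth_finite_measure:
  assumes mu: "orthogonality_measure q \<mu>"
  shows "finite_measure \<mu>" "measure \<mu> (space \<mu>) = 1"
proof -
  have i: "integrable \<mu> (\<lambda>x::real. 1::real)"
    using mu unfolding orthogonality_measure_def by (metis (no_types, lifting) power_0 Bochner_Integration.integrable_cong)
  then have "(\<integral>\<^sup>+x. 1 \<partial>\<mu>) < \<infinity>" by (simp add: integrable_iff_bounded)
  then show "finite_measure \<mu>" by (intro finite_measureI) auto
  have "(\<integral>x. P 0 x * P 0 x \<partial>\<mu>) = (if (0::nat) = 0 then 1 else 0)"
    using mu unfolding orthogonality_measure_def by blast
  then show "measure \<mu> (space \<mu>) = 1" by simp
qed

text \<open>
  For \<open>y = i / (n + 1)\<close> the functions \<open>y / (x + y - t)\<close> of \<open>t\<close> are bounded by \<open>1\<close> and tend to the indicator of \<open>{x}\<close>.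
\<close>
lemma point_mass_limit:
  assumes mu: "orthogonality_measure q \<mu>"
  defines "y \<equiv> \<lambda>n::nat. \<i> * complex_of_real (1 / real (Suc n))"
  shows "(\<lambda>n. y n * (\<integral>t. 1 / (of_real x + y n - complex_of_real t) \<partial>\<mu>)) \<longlonglongrightarrow> of_real (measure \<mu> {x})"
proof -
  interpret finite_measure \<mu> by (rule orth_finite_measure[OF mu])
  have sets: "sets \<mu> = sets borel" using mu by (simp add: orthogonality_measure_def)
  have sp: "space \<mu> = UNIV" using sets_eq_imp_space_eq[OF sets] by simp
  have m: "f \<in> borel_measurable borel \<Longrightarrow> f \<in> borel_measurable \<mu>" for f :: "real \<Rightarrow> complex"
    using measurable_cong_sets[OF sets refl] by blast
  have y0: "y \<longlonglongrightarrow> 0"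
  proof -
    have "y \<longlonglongrightarrow> \<i> * complex_of_real 0"
      unfolding y_def using LIMSEQ_inverse_real_of_nat
      by (intro tendsto_mult tendsto_const tendsto_of_real) (simp add: inverse_eq_divide)
    then show ?thesis by simp
  qed
  have cy: "cmod (y n) = 1 / real (Suc n)" for n unfolding y_def norm_mult norm_of_real by simp
  have Im: "\<bar>Im (of_real x + y n - complex_of_real t)\<bar> = cmod (y n)" for n t
  proof -
    have "Im (y n) = 1 / real (Suc n)" unfolding y_def Im_i_times Re_complex_of_real ..
    then show ?thesis by (simp add: cy)
  qed
  have ynz: "y n \<noteq> 0" for n using cy[of n] by auto
  have dnz: "of_real x + y n - complex_of_real t \<noteq> 0" for n t
  proof
    assume "of_real x + y n - complex_of_real t = 0"
    then have "cmod (y n) = 0" using Im[of n t] by (simp only: zero_complex.simps abs_zero)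
    then show False using ynz[of n] by simp
  qed
  have "(\<lambda>n. \<integral>t. y n / (of_real x + y n - complex_of_real t) \<partial>\<mu>) \<longlonglongrightarrow> (\<integral>t. of_real (indicat_real {x} t) \<partial>\<mu>)"
  proof (rule integral_dominated_convergence[where w = "\<lambda>_. 1"])
    show "(\<lambda>t. complex_of_real (indicat_real {x} t)) \<in> borel_measurable \<mu>" by (intro m) measurable
    show "(\<lambda>t. y n / (of_real x + y n - complex_of_real t)) \<in> borel_measurable \<mu>" for n
      by (intro m borel_measurable_continuous_onI continuous_intros) (use dnz in auto)
    show "AE t in \<mu>. (\<lambda>n. y n / (of_real x + y n - complex_of_real t)) \<longlonglongrightarrow> complex_of_real (indicat_real {x} t)"
    proof (rule AE_I2)
      fix t
      show "(\<lambda>n. y n / (of_real x + y n - complex_of_real t)) \<longlonglongrightarrow> complex_of_real (indicat_real {x} t)"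
      proof (cases "t = x")
        case True
        then have "(\<lambda>n. y n / (of_real x + y n - complex_of_real t)) = (\<lambda>n. 1)" using ynz by auto
        then show ?thesis using True by simp
      next
        case False
        have "(\<lambda>n. y n / (of_real x + y n - complex_of_real t)) \<longlonglongrightarrow> 0 / (of_real x + 0 - complex_of_real t)"
          using False by (intro tendsto_divide tendsto_add tendsto_diff tendsto_const y0) auto
        then show ?thesis using False by simp
      qed
    qed
    show "AE t in \<mu>. norm (y n / (of_real x + y n - complex_of_real t)) \<le> 1" for n
    proof (rule AE_I2)
      fix t
      have "cmod (y n) \<le> cmod (of_real x + y n - complex_of_real t)" using abs_Im_le_cmod Im by metis
      then show "norm (y n / (of_real x + y n - complex_of_real t)) \<le> 1"
        using dnz[of n t] by (simp add: norm_divide divide_le_eq)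
    qed
  qed simp
  moreover have "(\<integral>t. of_real (indicat_real {x} t) \<partial>\<mu>) = complex_of_real (measure \<mu> {x})"
    by (simp add: sets sp)
  moreover have "(\<integral>t. y n / (of_real x + y n - complex_of_real t) \<partial>\<mu>) = y n * (\<integral>t. 1 / (of_real x + y n - complex_of_real t) \<partial>\<mu>)" for n
    by (subst integral_mult_right_zero[symmetric]) simp
  ultimately show ?thesis by simp
qed

lemma stieltjes_eq_imp_mass_eq:
  assumes "orthogonality_measure q \<mu>" "orthogonality_measure q \<nu>"
    and eq: "\<And>z. z \<notin> \<real> \<Longrightarrow> (\<integral>x. 1 / (z - complex_of_real x) \<partial>\<mu>) = (\<integral>x. 1 / (z - complex_of_real x) \<partial>\<nu>)"
  shows "measure \<mu> {x} = measure \<nu> {x}"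
proof -
  have "of_real x + \<i> * complex_of_real (1 / real (Suc n)) \<notin> \<real>" for n
    by (simp add: complex_is_Real_iff)
  then have "(\<lambda>n. \<i> * complex_of_real (1 / real (Suc n)) * (\<integral>t. 1 / (of_real x + \<i> * complex_of_real (1 / real (Suc n)) - complex_of_real t) \<partial>\<mu>))
     = (\<lambda>n. \<i> * complex_of_real (1 / real (Suc n)) * (\<integral>t. 1 / (of_real x + \<i> * complex_of_real (1 / real (Suc n)) - complex_of_real t) \<partial>\<nu>))"
    using eq by presburger
  then have "complex_of_real (measure \<mu> {x}) = complex_of_real (measure \<nu> {x})"
    by (intro LIMSEQ_unique[OF point_mass_limit[OF assms(1)]]) (simp only: point_mass_limit[OF assms(2)])
  then show ?thesis by simp
qed

lemma measure_point_masses: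
  assumes ab: "(a, b) \<noteq> (0, 0)" and l: "bij_betw l UNIV (zeros a b)" and A: "A \<in> sets borel"
  shows "(\<lambda>k. indicat_real A (l k) / kern (l k) (l k)) sums measure (point_masses l) A"
proof -
  interpret finite_measure "point_masses l" by (rule orth_finite_measure[OF point_masses_orthogonal[OF ab l]])
  have i: "integrable (point_masses l) (indicat_real A)"
    using A by (intro integrable_real_indicator) (auto simp: sets_point_masses emeasure_eq_measure)
  have m: "indicat_real A \<in> borel_measurable borel" using A by simp
  have "summable (\<lambda>k. norm (indicat_real A (l k)) / kern (l k) (l k))"
    using i unfolding integrable_point_masses_iff[OF m] .
  then have "summable (\<lambda>k. indicat_real A (l k) / kern (l k) (l k))" by simp
  moreover have "measure (point_masses l) A = (\<Sum>k. indicat_real A (l k) / kern (l k) (l k))"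
    using integral_point_masses[OF m i] by (simp add: space_point_masses)
  ultimately show ?thesis by (simp add: sums_iff)
qed

lemma measure_point_masses_singleton:
  assumes ab: "(a, b) \<noteq> (0, 0)" and l: "bij_betw l UNIV (zeros a b)"
  shows "measure (point_masses l) {x} = (if x \<in> zeros a b then 1 / kern x x else 0)"
proof -
  have s: "(\<lambda>k. indicat_real {x} (l k) / kern (l k) (l k)) sums measure (point_masses l) {x}"
    by (rule measure_point_masses[OF ab l]) simp
  show ?thesis
  proof (cases "x \<in> zeros a b")
    case False
    then have "l k \<noteq> x" for k using l by (auto simp: bij_betw_def)
    then have "(\<lambda>k. indicat_real {x} (l k) / kern (l k) (l k)) = (\<lambda>k. 0)" by (simp add: indicator_def)
    then have "(\<lambda>k. 0) sums measure (point_masses l) {x}" using s by simp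
    then have "measure (point_masses l) {x} = 0" by (rule sums_unique2[OF _ sums_zero])
    then show ?thesis using False by simp
  next
    case True
    then obtain j where j: "x = l j" using l by (auto simp: bij_betw_def)
    then have "l k = x \<longleftrightarrow> k = j" for k using l by (auto simp: bij_betw_def inj_def)
    then have "(\<lambda>k. indicat_real {x} (l k) / kern (l k) (l k)) = (\<lambda>k. if k = j then 1 / kern (l k) (l k) else 0)"
      by (auto simp: indicator_def)
    then have "(\<lambda>k. if k = j then 1 / kern (l k) (l k) else 0) sums measure (point_masses l) {x}" using s by simp
    then have "measure (point_masses l) {x} = 1 / kern (l j) (l j)"
      by (rule sums_unique2[OF _ sums_single])
    then show ?thesis using True by (simp add: j)
  qed
qed

text \<open>
  The point masses agree by \<open>point_mass_limit\<close>.  Hence \<open>point_masses l\<close> is bounded by \<open>\<mu>\<close> on every Borel set, and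
  passing to complements gives equality because both have total mass \<open>1\<close>.
\<close>
lemma eq_point_masses_if_stieltjes_eq:
  assumes mu: "orthogonality_measure q \<mu>" and ab: "(a, b) \<noteq> (0, 0)" and l: "bij_betw l UNIV (zeros a b)"
    and eq: "\<And>z. z \<notin> \<real> \<Longrightarrow> (\<integral>x. 1 / (z - complex_of_real x) \<partial>\<mu>) = (\<integral>x. 1 / (z - complex_of_real x) \<partial>point_masses l)"
  shows "\<mu> = point_masses l"
proof -
  note orth = point_masses_orthogonal[OF ab l]
  interpret m: finite_measure \<mu> by (rule orth_finite_measure[OF mu])
  interpret n: finite_measure "point_masses l" by (rule orth_finite_measure[OF orth])
  have sets: "sets \<mu> = sets borel" using mu by (simp add: orthogonality_measure_def)
  have sp: "space \<mu> = UNIV" using sets_eq_imp_space_eq[OF sets] by simp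
  have inj: "inj l" and lz: "l k \<in> zeros a b" for k using l by (auto simp: bij_betw_def)
  have mass: "measure \<mu> {l k} = 1 / kern (l k) (l k)" for k
    using stieltjes_eq_imp_mass_eq[OF mu orth eq, of "l k"] measure_point_masses_singleton[OF ab l, of "l k"] lz by simp
  have le: "measure (point_masses l) A \<le> measure \<mu> A" if A: "A \<in> sets borel" for A
  proof (rule LIMSEQ_le_const2)
    show "(\<lambda>n. \<Sum>k<n. indicat_real A (l k) / kern (l k) (l k)) \<longlonglongrightarrow> measure (point_masses l) A"
      using measure_point_masses[OF ab l A] by (simp add: sums_def)
    have "(\<Sum>k<n. indicat_real A (l k) / kern (l k) (l k)) \<le> measure \<mu> A" for n
    proof -
      let ?S = "{k. k < n \<and> l k \<in> A}"
      have "(\<Sum>k<n. indicat_real A (l k) / kern (l k) (l k)) = (\<Sum>k\<in>?S. measure \<mu> {l k})"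
        unfolding mass by (rule sum.mono_neutral_cong_right) (auto simp: indicator_def)
      also have "\<dots> = (\<Sum>x\<in>l ` ?S. measure \<mu> {x})"
        by (subst sum.reindex) (auto intro: inj_on_subset[OF inj])
      also have "\<dots> = measure \<mu> (l ` ?S)"
        by (rule m.finite_measure_eq_sum_singleton[symmetric]) (auto simp: sets)
      also have "\<dots> \<le> measure \<mu> A"
        using A by (intro m.finite_measure_mono) (auto simp: sets)
      finally show ?thesis .
    qed
    then show "\<exists>N. \<forall>n\<ge>N. (\<Sum>k<n. indicat_real A (l k) / kern (l k) (l k)) \<le> measure \<mu> A" by blast
  qed
  have "measure \<mu> A = measure (point_masses l) A" if A: "A \<in> sets borel" for A
  proof (rule antisym)
    show "measure (point_masses l) A \<le> measure \<mu> A" by (rule le[OF A])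
    have "measure (point_masses l) (UNIV - A) \<le> measure \<mu> (UNIV - A)" using A by (intro le) auto
    then show "measure \<mu> A \<le> measure (point_masses l) A"
      using m.finite_measure_compl[of A] n.finite_measure_compl[of A] A
        orth_finite_measure(2)[OF mu] orth_finite_measure(2)[OF orth]
      by (simp add: sets sp sets_point_masses space_point_masses)
  qed
  then show ?thesis
    by (intro measure_eqI) (auto simp: sets sets_point_masses m.emeasure_eq_measure n.emeasure_eq_measure)
qed

section \<open>The parametrization of the N-extremal measures\<close>

lemma zeros_scale: "c \<noteq> 0 \<Longrightarrow> zeros (c * a) (c * b) = zeros a b"
proof -
  assume "c \<noteq> 0"
  moreover have "c * a * qcos x + c * b * qsin x = c * (a * qcos x + b * qsin x)" for x by (simp add: algebra_simps)
  ultimately show ?thesis by (simp add: zeros_def)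
qed

lemma lowest_zero_qsin_exists: "\<exists>v. lowest_positive_zero qsin v"
proof -
  have ab: "(0, 1) \<noteq> (0, 0 :: real)" by simp
  obtain x0 where x0: "x0 \<in> zeros 0 1" "x0 \<noteq> 0"
    using zeros_infinite[OF ab] by (metis finite.emptyI finite_insert insertI1 subsetI finite_subset)
  define y where "y = \<bar>x0\<bar>"
  have y: "0 < y" "qsin y = 0"
    using x0 qsin_odd[of x0] by (auto simp: y_def zeros_def abs_if)
  define S where "S = {x \<in> zeros 0 1 \<inter> {-y..y}. 0 < x}"
  have "finite S" unfolding S_def by (rule finite_subset[OF _ zeros_locally_finite[OF ab, of y]]) auto
  moreover have "y \<in> S" using y by (simp add: S_def zeros_def)
  ultimately have S: "finite S" "y \<in> S" by auto
  have "Min S \<in> S" using S by (intro Min_in) auto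
  moreover have "qsin x \<noteq> 0" if "0 < x" "x < Min S" for x
  proof
    assume "qsin x = 0"
    moreover have "x \<le> y" using that(2) Min_le[OF S] by linarith
    ultimately have "x \<in> S" using that(1) y(1) by (auto simp: S_def zeros_def)
    then show False using Min_le[OF S(1)] that(2) by fastforce
  qed
  ultimately show ?thesis unfolding lowest_positive_zero_def S_def by (intro exI[of _ "Min S"]) (auto simp: S_def zeros_def)
qed

context
  fixes v1 :: real
  assumes v1: "lowest_positive_zero qsin v1"
begin

text \<open>
  \<open>qsin x = x K(x, 0)\<close>, and \<open>K(x, 0)\<close> keeps the sign of \<open>K(0, 0)\<close> up to the first zero.
\<close>
lemma qsin_pos: assumes "0 < x" "x < v1" shows "0 < qsin x"
proof -
  have nz: "kern t 0 \<noteq> 0" if "0 \<le> t" "t \<le> x" for t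
  proof (cases "t = 0")
    case True then show ?thesis using kern_diag_pos[of 0] by simp
  next
    case False
    then have "qsin t \<noteq> 0" using v1 that assms by (auto simp: lowest_positive_zero_def)
    then show ?thesis by (auto simp: qsin_eq_kern)
  qed
  have "0 < kern x 0"
  proof (rule ccontr)
    assume "\<not> 0 < kern x 0"
    then have "\<exists>t\<ge>0. t \<le> x \<and> kern t 0 = 0"
      using kern_diag_pos[of 0] assms by (intro IVT2 allI impI kern_continuous_left) auto
    then show False using nz by blast
  qed
  then show ?thesis using assms by (simp add: qsin_eq_kern)
qed

text \<open>
  \<open>(x - v1) K(x, v1) = qsin x qcos v1\<close>, where \<open>K(x, v1) > 0\<close> and \<open>qsin x > 0\<close> for \<open>x\<close> slightly below \<open>v1\<close>.
\<close>
lemma qcos_v1: "qcos v1 < 0"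
proof -
  have v: "0 < v1" "qsin v1 = 0" using v1 by (auto simp: lowest_positive_zero_def)
  have "((\<lambda>x. kern x v1) \<longlongrightarrow> kern v1 v1) (at_left v1)"
    using kern_continuous_left[of v1 v1] unfolding isCont_def by (rule tendsto_within_subset) simp
  then have "eventually (\<lambda>x. 0 < kern x v1) (at_left v1)" by (rule order_tendstoD) (rule kern_diag_pos)
  moreover have "eventually (\<lambda>x. x \<in> {0<..<v1}) (at_left v1)" using v(1) by (rule eventually_at_left_real)
  ultimately have "eventually (\<lambda>x. 0 < kern x v1 \<and> x \<in> {0<..<v1}) (at_left v1)" by (rule eventually_conj)
  then obtain x where x: "0 < kern x v1" "0 < x" "x < v1"
    using eventually_happens[of _ "at_left v1"] by (auto simp: trivial_limit_at_left_real)
  have "(x - v1) * kern x v1 = qsin x * qcos v1" using kern_trig[of x v1] v(2) by simp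
  moreover have "(x - v1) * kern x v1 < 0" using x by (simp add: mult_neg_pos)
  ultimately show ?thesis using qsin_pos[OF x(2,3)] by (simp add: mult_less_0_iff)
qed

text \<open>
  By \<open>kern_trig\<close> the difference quotient of \<open>qcos / qsin\<close> is \<open>- K(x, y) / (qsin x qsin y)\<close>.
\<close>
lemma cot_decreasing:
  assumes "0 < x" "x < y" "y < v1"
  shows "qcos y / qsin y < qcos x / qsin x"
proof (rule DERIV_neg_imp_decreasing[OF assms(2)])
  fix t assume t: "x \<le> t" "t \<le> y"
  let ?g = "\<lambda>t. qcos t / qsin t"
  have st: "0 < qsin t" using t assms by (intro qsin_pos) auto
  have "((\<lambda>u. - kern u t / (qsin u * qsin t)) \<longlongrightarrow> - kern t t / (qsin t * qsin t)) (at t)"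
    using kern_continuous_left[of t t] qsin_isCont[of t] st unfolding isCont_def
    by (intro tendsto_intros) auto
  moreover have "eventually (\<lambda>u. - kern u t / (qsin u * qsin t) = (?g u - ?g t) / (u - t)) (at t)"
  proof -
    have "eventually (\<lambda>u. 0 < qsin u) (at t)"
      using qsin_isCont[of t] unfolding isCont_def by (rule order_tendstoD) (rule st)
    moreover have "eventually (\<lambda>u. u \<noteq> t) (at t)" by (simp add: eventually_at_filter)
    ultimately show ?thesis
    proof eventually_elim
      case (elim u)
      have "?g u - ?g t = - ((u - t) * kern u t) / (qsin u * qsin t)"
        unfolding kern_trig using elim st by (simp add: field_simps)
      also have "\<dots> = (u - t) * (- kern u t / (qsin u * qsin t))" by simp
      finally have e: "?g u - ?g t = (u - t) * (- kern u t / (qsin u * qsin t))" .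
      show ?case unfolding e using elim by simp
    qed
  qed
  ultimately have "((\<lambda>u. (?g u - ?g t) / (u - t)) \<longlongrightarrow> - kern t t / (qsin t * qsin t)) (at t)"
    by (rule Lim_transform_eventually)
  then have "(?g has_real_derivative - kern t t / (qsin t * qsin t)) (at t)"
    by (simp add: has_field_derivative_iff)
  moreover have "- kern t t / (qsin t * qsin t) < 0" using kern_diag_pos[of t] st by (simp add: divide_neg_pos)
  ultimately show "\<exists>y. (?g has_real_derivative y) (at t) \<and> y < 0" by blast
qed

lemma cot_surj: "\<exists>v. 0 < v \<and> v < v1 \<and> qcos v = t * qsin v"
proof -
  have v: "0 < v1" "qsin v1 = 0" using v1 by (auto simp: lowest_positive_zero_def)
  have "\<exists>x\<ge>0. x \<le> v1 \<and> qcos x - t * qsin x = 0"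
    using qcos_v1 v by (intro IVT2) (auto simp: qcos_0 qsin_0 intro!: continuous_intros qcos_isCont qsin_isCont)
  then obtain x where x: "0 \<le> x" "x \<le> v1" "qcos x = t * qsin x" by auto
  then have "x \<noteq> 0" "x \<noteq> v1" using v qcos_v1 by (auto simp: qcos_0 qsin_0)
  then show ?thesis using x by (intro exI[of _ x]) auto
qed

text \<open>
  A common zero forces the two pairs of coefficients to be proportional, that is, equal values of \<open>qcos / qsin\<close>.
  The value at \<open>0\<close>, where the quotient is infinite, is treated separately.
\<close>
lemma zeros_param_inj:
  assumes "0 \<le> v" "v < v1" "0 \<le> w" "w < v1" "zeros (qcos v) (qsin v / r) = zeros (qcos w) (qsin w / r)"
  shows "v = w"
proof -
  have "(qcos v, qsin v / r) \<noteq> (0, 0)" using trig_nonzero[of v] r_pos by auto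
  then obtain x where "x \<in> zeros (qcos v) (qsin v / r)" using zeros_infinite by (metis finite.emptyI ex_in_conv)
  then have x: "qcos v * qcos x + qsin v / r * qsin x = 0" "qcos w * qcos x + qsin w / r * qsin x = 0"
    using assms(5) by (auto simp: zeros_def)
  have det: "qcos v * qsin w = qcos w * qsin v"
  proof -
    have "qcos x * (qcos v * qsin w - qcos w * qsin v) = (qcos v * qcos x + qsin v / r * qsin x) * qsin w - (qcos w * qcos x + qsin w / r * qsin x) * qsin v"
      by (simp add: algebra_simps)
    then have 1: "qcos x * (qcos v * qsin w - qcos w * qsin v) = 0" using x by simp
    have "qsin x / r * (qcos v * qsin w - qcos w * qsin v) = qcos v * (qcos w * qcos x + qsin w / r * qsin x) - qcos w * (qcos v * qcos x + qsin v / r * qsin x)"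
      by (simp add: algebra_simps)
    then have 2: "qsin x / r * (qcos v * qsin w - qcos w * qsin v) = 0" using x by simp
    show ?thesis using 1 2 trig_nonzero[of x] r_pos by auto
  qed
  have z: "qsin t = 0 \<Longrightarrow> t = 0" if "0 \<le> t" "t < v1" for t using qsin_pos[of t] that by fastforce
  show ?thesis
  proof (cases "v = 0 \<or> w = 0")
    case True
    then show ?thesis
    proof
      assume "v = 0" then show ?thesis using det z[of w] assms by (simp add: qcos_0 qsin_0)
    next
      assume "w = 0" then show ?thesis using det z[of v] assms by (simp add: qcos_0 qsin_0)
    qed
  next
    case False
    then have p: "0 < v" "0 < w" using assms by auto
    have "qcos v / qsin v = qcos w / qsin w"
      using det qsin_pos[of v] qsin_pos[of w] p assms by (simp add: field_simps)
    then show ?thesis using cot_decreasing[of v w] cot_decreasing[of w v] p assms by linarith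
  qed
qed

end

lemma coeffs_nonzero: "(qcos (r * u), S_fun q u) \<noteq> (0, 0)"
  using trig_nonzero[of "r * u"] r_pos by (auto simp: S_fun_eq)

lemma enumerates_zeros_iff:
  "enumerates_zeros (zero_fun q u) l \<longleftrightarrow> bij_betw l UNIV (zeros (qcos (r * u)) (S_fun q u))"
proof -
  have "{z. zero_fun q u z = 0} = complex_of_real ` zeros (qcos (r * u)) (S_fun q u)"
    unfolding zero_fun_eq by (rule complex_zeros[OF coeffs_nonzero])
  then show ?thesis
    unfolding enumerates_zeros_def
    by (auto simp: bij_betw_def inj_def image_image[symmetric] inj_image_eq_iff[OF inj_of_real] intro!: inj_of_real)
qed

lemma point_masses_N_extremal:
  assumes ab: "(a, b) \<noteq> (0, 0)" and l: "bij_betw l UNIV (zeros a b)"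
  shows "point_masses l \<in> N_extremal_measures q"
proof -
  define t where "t = (if b = 0 then None else Some (a / b))"
  obtain a' b' where t': "ratio_coeffs t = (a', b')" by fastforce
  have "zeros a b = zeros a' b'"
  proof (cases "b = 0")
    case True
    then have "a \<noteq> 0" "a' = 1" "b' = 0" using t' ab by (auto simp: t_def)
    then show ?thesis using zeros_scale[of a 1 0] True by simp
  next
    case False
    then have "a' = a / b" "b' = 1" using t' by (auto simp: t_def)
    then show ?thesis using zeros_scale[OF False, of "a / b" 1] False by simp
  qed
  then have l': "bij_betw l UNIV (zeros a' b')" using l by simp
  show ?thesis unfolding N_extremal_measures_def
    using point_masses_orthogonal[OF ab l] point_masses_nevanlinna[OF t' l'] by blast
qed

lemma N_extremal_bijection:
  assumes lam: "\<And>u. enumerates_zeros (zero_fun q u) (lam u)"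
  shows "\<exists>s1. lowest_positive_zero (S_fun q) s1 \<and>
              bij_betw (\<lambda>u. point_masses (lam u)) {0..<s1} (N_extremal_measures q)"
proof -
  obtain v1 where v1: "lowest_positive_zero qsin v1" using lowest_zero_qsin_exists by blast
  have l: "bij_betw (lam u) UNIV (zeros (qcos (r * u)) (S_fun q u))" for u
    using lam[of u] by (simp only: enumerates_zeros_iff)
  have ru: "0 \<le> r * u" "r * u < v1" if "u \<in> {0..<v1 / r}" for u
    using that r_pos by (auto simp: field_simps)
  have "lowest_positive_zero (S_fun q) (v1 / r)"
    using v1 r_pos q_pos unfolding lowest_positive_zero_def S_fun_eq
    by (auto simp: field_simps)
  moreover have "bij_betw (\<lambda>u. point_masses (lam u)) {0..<v1 / r} (N_extremal_measures q)"
    unfolding bij_betw_def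
  proof (intro conjI equalityI subsetI)
    show "inj_on (\<lambda>u. point_masses (lam u)) {0..<v1 / r}"
    proof (rule inj_onI)
      fix u w assume uw: "u \<in> {0..<v1 / r}" "w \<in> {0..<v1 / r}" "point_masses (lam u) = point_masses (lam w)"
      have "x \<in> zeros (qcos (r * u)) (S_fun q u) \<longleftrightarrow> measure (point_masses (lam u)) {x} \<noteq> 0" for x u
        using measure_point_masses_singleton[OF coeffs_nonzero l, of u x] kern_diag_pos[of x] by simp
      then have "zeros (qcos (r * u)) (S_fun q u) = zeros (qcos (r * w)) (S_fun q w)"
        using uw(3) by (simp add: set_eq_iff)
      then have "r * u = r * w"
        using zeros_param_inj[OF v1 ru[OF uw(1)] ru[OF uw(2)]] by (simp add: S_fun_eq)
      then show "u = w" using r_pos by simp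
    qed
  next
    fix \<mu> assume "\<mu> \<in> (\<lambda>u. point_masses (lam u)) ` {0..<v1 / r}"
    then show "\<mu> \<in> N_extremal_measures q" using point_masses_N_extremal[OF coeffs_nonzero l] by blast
  next
    fix \<mu> assume "\<mu> \<in> N_extremal_measures q"
    then obtain t where mu: "orthogonality_measure q \<mu>"
      and t: "\<And>z. z \<notin> \<real> \<Longrightarrow> (\<integral>x. 1 / (z - complex_of_real x) \<partial>\<mu>) = nevanlinna_quotient q t z"
      unfolding N_extremal_measures_def by blast
    obtain a b where ab: "ratio_coeffs t = (a, b)" by fastforce
    have nz: "(a, b) \<noteq> (0, 0)" using ab by (cases t) auto
    obtain u where u: "u \<in> {0..<v1 / r}" "zeros (qcos (r * u)) (S_fun q u) = zeros a b"
    proof (cases t)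
      case None
      have "0 < v1" using v1 by (simp add: lowest_positive_zero_def)
      then show ?thesis using that[of 0] ab None r_pos by (simp add: qcos_0 qsin_0 S_fun_eq)
    next
      case (Some t')
      obtain v where v: "0 < v" "v < v1" "qcos v = t' / r * qsin v" using cot_surj[OF v1] by blast
      have "zeros (qcos v) (qsin v / r) = zeros (qsin v / r * t') (qsin v / r * 1)"
        unfolding v(3) by (simp add: mult_ac)
      also have "\<dots> = zeros t' 1" using qsin_pos[OF v1 v(1,2)] r_pos by (intro zeros_scale) auto
      finally have "zeros (qcos (r * (v / r))) (S_fun q (v / r)) = zeros a b"
        using ab Some r_pos by (simp add: S_fun_eq)
      then show ?thesis using that[of "v / r"] v r_pos by (auto simp: field_simps)
    qed
    have l': "bij_betw (lam u) UNIV (zeros a b)" using l[of u] u(2) by simp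
    have "\<mu> = point_masses (lam u)"
      by (rule eq_point_masses_if_stieltjes_eq[OF mu nz l']) (simp add: t point_masses_nevanlinna[OF ab l'])
    then show "\<mu> \<in> (\<lambda>u. point_masses (lam u)) ` {0..<v1 / r}" using u(1) by blast
  qed
  ultimately show ?thesis by blast
qed

lemma enumeration_exists: "\<exists>l. enumerates_zeros (zero_fun q u) l"
  unfolding enumerates_zeros_iff
  using bij_betw_from_nat_into[OF zeros_countable zeros_infinite] coeffs_nonzero by blast

lemma orthogonality_relation:
  assumes "enumerates_zeros (zero_fun q u) l"
  shows "0 < weight_fun q (l k)"
    and "(\<lambda>k. inverse (weight_fun q (l k)) * P n (l k) * P m (l k)) sums (1 / (1 - q) * (if m = n then 1 else 0))"
proof -
  show "0 < weight_fun q (l k)" using q_less_1 kern_diag_pos by (simp add: weight_fun_eq)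
  have "(\<lambda>k. 1 / (1 - q) * (P m (l k) * P n (l k) / kern (l k) (l k))) sums (1 / (1 - q) * (if m = n then 1 else 0))"
    by (intro sums_mult zeros_enum_sums(2)[OF coeffs_nonzero]) (use assms in \<open>simp only: enumerates_zeros_iff\<close>)
  moreover have "1 / (1 - q) * (P m (l k) * P n (l k) / kern (l k) (l k)) = inverse (weight_fun q (l k)) * P n (l k) * P m (l k)" for k
    by (simp add: weight_fun_eq inverse_eq_divide)
  ultimately show "(\<lambda>k. inverse (weight_fun q (l k)) * P n (l k) * P m (l k)) sums (1 / (1 - q) * (if m = n then 1 else 0))"
    by simp
qed

end

theorem theorem14:
  fixes q :: real
  assumes "0 < q" and "q < 1"
  shows
    "(\<forall>u::real. \<exists>l. enumerates_zeros (zero_fun q u) l) \<and>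
     (\<forall>(u::real) l. enumerates_zeros (zero_fun q u) l \<longrightarrow>
        (\<forall>k. 0 < weight_fun q (l k)) \<and>
        (\<forall>m n. (\<lambda>k. inverse (weight_fun q (l k)) * poly (P_poly q n) (l k) * poly (P_poly q m) (l k))
                sums (1 / (1 - q) * (if m = n then 1 else 0)))) \<and>
     (\<forall>lam :: real \<Rightarrow> nat \<Rightarrow> real. (\<forall>u. enumerates_zeros (zero_fun q u) (lam u)) \<longrightarrow>
        (\<exists>s1. lowest_positive_zero (S_fun q) s1 \<and>
              bij_betw (\<lambda>u. point_mass_measure q (lam u)) {0..<s1} (N_extremal_measures q)))"
proof -
  interpret q_recurrence q using assms by unfold_locales
  show ?thesis
    using enumeration_exists orthogonality_relation N_extremal_bijection by blast
qed

end
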